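(* Let $p=6$, let $(\mathcal G_\ell)_{\ell>0}$ be a family of compact connected metric graphs without terminal edges and without cycle coverings, whose longest bridging edge has variable length $\ell$, the remaining part of the graph being fixed in the sense specified in the context, and write $\mu_1=\mu_1(\mathcal G_\ell,6)$, $\mu_{\mathbb R}=\frac{\pi\sqrt3}{2}$. If $\ell$ is small enough, then, for every $\mu\in(\mu_{\mathbb R},\mu_1)$, there exists a solution $u\in H^2_K(\mathcal G_\ell)$, for some $\lambda\in\mathbb R$, of $u''+|u|^4u-\lambda u=0$ with $\|u\|_2^2=\mu$ which is orbitally stable, namely the constant $u=\kappa_\mu:=\sqrt{\mu/|\mathcal G_\ell|}$.
   Context: A compact metric graph $\mathcal G$ is formed by finitely many edges (bounded intervals $I_e=[0,\ell_e]$, $0<\ell_e<\infty$) with some endpoints glued together at vertices; self-loops and multiple edges are allowed. All graphs are connected. $|\mathcal G|=\sum_e\ell_e$ is the total length. Integrals and $L^p(\mathcal G)$ norms $\|\cdot\|_p$ are defined edge by edge with Lebesgue measure. $H^1(\mathcal G)$ is the space of continuous $u:\mathcal G\to\mathbb C$ whose restriction $u_e$ to each edge is in $H^1(I_e)$, with norm $\|u\|_{H^1}=\|u'\|_2+\|u\|_2$. $H^2_K(\mathcal G)$ is the space of $u\in H^1(\mathcal G)$ with $u_e\in H^2(I_e)$ for all $e$ satisfying the Kirchhoff condition at each vertex: the sum of outgoing derivatives along all edges incident at the vertex is $0$. For $\mu>0$, $H^1_\mu(\mathcal G)=\{u\in H^1(\mathcal G):\|u\|_2^2=\mu\}$. A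 terminal edge is an edge ending at a vertex of degree 1. $\mathcal G$ admits a cycle covering if it can be covered by cycles, a cycle being a closed path (loop) without edge repetitions. A bridging edge is an edge whose removal disconnects the graph into two disjoint components. A graph with no terminal edge and no cycle covering has at least one bridging edge. The family $\mathcal G_\ell$: the underlying combinatorial graph (with no terminal edge and no cycle covering) is the same for all $\ell$; the lengths of all non-bridging edges are fixed, independent of $\ell$; a distinguished bridging edge has length $\ell$; all other bridging edges (if any) have length at most $\ell$ and bounded uniformly in $\ell$. (If there is exactly one bridging edge, this means $\mathcal G_\ell$ consists of two fixed compact graphs $\Gamma_1,\Gamma_2$, independent of $\ell$, joined by an edge of length $\ell$.) Let $E(u)=\frac12\|u'\|_2^2-\frac16\|u\|_6^6$. $\mu_1(\mathcal G,6)>0$ denotes the threshold mass for local minimality of the constants: $\kappa_\mu=\sqrt{\mu/|\mathcal G|}$ is a local minimizer (in the $H^1$ topology) of $E$ in $H^1_\mu(\mathcal G)$ for $\mu<\mu_1(\mathcal G,6)$, and is not for $\mu>\mu_1(\mathcal G,6)$. In the paper it is defined explicitly by $\mu_1(\mathcal G,6)=|\mathcal G|\left(\lambda_2(\mathcal G)/4\right)^{1/2}$, where $\lambda_2(\mathcal G)=\inf\{\int_{\mathcal G}|\varphi'|^2dx/\int_{\mathcal G}|\varphi|^2dx:\ \varphi\in H^1(\mathcal G)\setminus\{0\},\ \int_{\mathcal G}\varphi\,dx=0\}$. The NLS equation is $i\partial_t v=-v''-|v|^{4}v$ on $\mathcal G$ (with Kirchhoff conditions), solved with initial data in $H^1(\mathcal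 G)$. A stationary solution $u$ is orbitally stable if for every $\varepsilon>0$ there is $\delta>0$ such that, whenever $v_0\in H^1(\mathcal G)$ satisfies $\inf_{\theta\in\mathbb R}\|v_0-e^{i\theta}u\|_{H^1}<\delta$, the solution $v$ of the NLS equation with initial datum $v_0$ satisfies $\sup_t\inf_{\theta\in\mathbb R}\|v(t)-e^{i\theta}u\|_{H^1}<\varepsilon$, with $t\ge0$ ranging over its interval of existence. *)

theory Defs
  imports "HOL-Analysis.Analysis" "Graph_Theory.Digraph_Component"
begin

section \<open>Compact metric graphs\<close>

text \<open>
  A metric graph is a multigraph \<open>G\<close> (loops and parallel edges allowed) with a length function
  \<open>len\<close>. The edge \<open>e\<close> is identified with \<open>[0, len e]\<close>, the point \<open>0\<close> being glued to \<open>tail G e\<close> and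
  \<open>len e\<close> to \<open>head G e\<close>. The orientation only serves as a choice of coordinate on the edge.
\<close>

definition compact_metric_graph :: "('v, 'e) pre_digraph \<Rightarrow> ('e \<Rightarrow> real) \<Rightarrow> bool" where
  "compact_metric_graph G len \<longleftrightarrow>
     fin_digraph G \<and> Digraph_Component.connected G \<and> (\<forall>e\<in>arcs G. 0 < len e)"

definition total_length :: "('v, 'e) pre_digraph \<Rightarrow> ('e \<Rightarrow> real) \<Rightarrow> real" where
  "total_length G len = (\<Sum>e\<in>arcs G. len e)"

text \<open>A loop contributes 2 to the degree of its vertex.\<close>

definition vertex_degree :: "('v, 'e) pre_digraph \<Rightarrow> 'v \<Rightarrow> nat" where
  "vertex_degree G v = in_degree G v + out_degree G v"

definition terminal_edge :: "('v, 'e) pre_digraph \<Rightarrow> 'e \<Rightarrow> bool" where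
  "terminal_edge G e \<longleftrightarrow>
     e \<in> arcs G \<and> (vertex_degree G (tail G e) = 1 \<or> vertex_degree G (head G e) = 1)"

definition bridging_edge :: "('v, 'e) pre_digraph \<Rightarrow> 'e \<Rightarrow> bool" where
  "bridging_edge G e \<longleftrightarrow> e \<in> arcs G \<and> \<not> Digraph_Component.connected (pre_digraph.del_arc G e)"

text \<open>
  Paths in a metric graph may traverse edges in either direction: they are the arc walks of the
  digraph in which \<open>(e, True)\<close> and \<open>(e, False)\<close> are the two orientations of the edge \<open>e\<close>.
\<close>

definition both_orientations :: "('v, 'e) pre_digraph \<Rightarrow> ('v, 'e \<times> bool) pre_digraph" where
  "both_orientations G =
     \<lparr> verts = verts G, arcs = arcs G \<times> UNIV,
       tail = (\<lambda>(e, b). if b then tail G e else head G e),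
       head = (\<lambda>(e, b). if b then head G e else tail G e) \<rparr>"

definition edge_cycle :: "('v, 'e) pre_digraph \<Rightarrow> ('e \<times> bool) list \<Rightarrow> bool" where
  "edge_cycle G p \<longleftrightarrow>
     p \<noteq> [] \<and> (\<exists>v. pre_digraph.awalk (both_orientations G) v p v) \<and> distinct (map fst p)"

definition admits_cycle_covering :: "('v, 'e) pre_digraph \<Rightarrow> bool" where
  "admits_cycle_covering G \<longleftrightarrow> (\<forall>e\<in>arcs G. \<exists>p. edge_cycle G p \<and> e \<in> fst ` set p)"


section \<open>Sobolev spaces on an interval\<close>

definition L2_interval :: "real \<Rightarrow> (real \<Rightarrow> complex) set" where
  "L2_interval l = {f. set_borel_measurable lebesgue {0..l} f \<and>
                       set_integrable lebesgue {0..l} (\<lambda>x. (cmod (f x))\<^sup>2)}"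

definition test_function :: "real \<Rightarrow> (real \<Rightarrow> real) \<Rightarrow> bool" where
  "test_function l \<phi> \<longleftrightarrow>
     (\<forall>x. \<phi> differentiable at x) \<and> continuous_on UNIV (deriv \<phi>) \<and>
     (\<exists>a b. 0 < a \<and> b < l \<and> (\<forall>x. x \<notin> {a..b} \<longrightarrow> \<phi> x = 0))"

definition has_weak_deriv :: "real \<Rightarrow> (real \<Rightarrow> complex) \<Rightarrow> (real \<Rightarrow> complex) \<Rightarrow> bool" where
  "has_weak_deriv l f g \<longleftrightarrow>
     (\<forall>\<phi>. test_function l \<phi> \<longrightarrow>
        (LINT x:{0..l}|lebesgue. complex_of_real (deriv \<phi> x) * f x) =
          - (LINT x:{0..l}|lebesgue. complex_of_real (\<phi> x) * g x))"

definition H1_interval :: "real \<Rightarrow> (real \<Rightarrow> complex) set" where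
  "H1_interval l = {f \<in> L2_interval l. \<exists>g\<in>L2_interval l. has_weak_deriv l f g}"

definition H2_interval :: "real \<Rightarrow> (real \<Rightarrow> complex) set" where
  "H2_interval l = {f \<in> L2_interval l. \<exists>g\<in>H1_interval l. has_weak_deriv l f g}"

text \<open>A representative of the weak derivative, which is unique only up to null sets.\<close>

definition weak_deriv :: "real \<Rightarrow> (real \<Rightarrow> complex) \<Rightarrow> real \<Rightarrow> complex" where
  "weak_deriv l f = (SOME g. g \<in> L2_interval l \<and> has_weak_deriv l f g)"


section \<open>Function spaces on a metric graph\<close>

text \<open>
  A function on the graph is a family \<open>u\<close> of functions indexed by the edges. The values \<open>u e x\<close> with
  \<open>e \<notin> arcs G\<close> or \<open>x \<notin> [0, len e]\<close> are irrelevant.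
\<close>

type_synonym 'e graph_fun = "'e \<Rightarrow> real \<Rightarrow> complex"

definition graph_integral ::
  "('v, 'e) pre_digraph \<Rightarrow> ('e \<Rightarrow> real) \<Rightarrow> ('e \<Rightarrow> real \<Rightarrow> 'b) \<Rightarrow> 'b::{banach, second_countable_topology}"
  where
  "graph_integral G len f = (\<Sum>e\<in>arcs G. LINT x:{0..len e}|lebesgue. f e x)"

definition Lp_norm :: "real \<Rightarrow> ('v, 'e) pre_digraph \<Rightarrow> ('e \<Rightarrow> real) \<Rightarrow> 'e graph_fun \<Rightarrow> real" where
  "Lp_norm p G len u = (graph_integral G len (\<lambda>e x. cmod (u e x) powr p)) powr (1 / p)"

text \<open>The function \<open>w\<close> gives the common value at a vertex of the restrictions to the incident edges.\<close>

definition continuous_on_graph ::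
  "('v, 'e) pre_digraph \<Rightarrow> ('e \<Rightarrow> real) \<Rightarrow> 'e graph_fun \<Rightarrow> bool" where
  "continuous_on_graph G len u \<longleftrightarrow>
     (\<forall>e\<in>arcs G. continuous_on {0..len e} (u e)) \<and>
     (\<exists>w. \<forall>e\<in>arcs G. u e 0 = w (tail G e) \<and> u e (len e) = w (head G e))"

definition H1_graph :: "('v, 'e) pre_digraph \<Rightarrow> ('e \<Rightarrow> real) \<Rightarrow> 'e graph_fun set" where
  "H1_graph G len =
     {u. continuous_on_graph G len u \<and> (\<forall>e\<in>arcs G. u e \<in> H1_interval (len e))}"

definition graph_deriv :: "('e \<Rightarrow> real) \<Rightarrow> 'e graph_fun \<Rightarrow> 'e graph_fun" where
  "graph_deriv len u = (\<lambda>e. weak_deriv (len e) (u e))"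

definition H1_norm :: "('v, 'e) pre_digraph \<Rightarrow> ('e \<Rightarrow> real) \<Rightarrow> 'e graph_fun \<Rightarrow> real" where
  "H1_norm G len u = Lp_norm 2 G len (graph_deriv len u) + Lp_norm 2 G len u"

text \<open>
  A continuous function in \<open>H\<^sup>2(0, l)\<close> is \<open>C\<^sup>1\<close> on \<open>[0, l]\<close>, so its one-sided derivatives at the end
  points exist. At \<open>0\<close> the derivative in the coordinate of the edge points away from the vertex; at
  \<open>len e\<close> it points towards the vertex, hence the minus sign.
\<close>

definition kirchhoff :: "('v, 'e) pre_digraph \<Rightarrow> ('e \<Rightarrow> real) \<Rightarrow> 'e graph_fun \<Rightarrow> bool" where
  "kirchhoff G len u \<longleftrightarrow>
     (\<forall>v\<in>verts G.
        (\<Sum>e\<in>out_arcs G v. vector_derivative (u e) (at 0 within {0..len e})) -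
        (\<Sum>e\<in>in_arcs G v. vector_derivative (u e) (at (len e) within {0..len e})) = 0)"

definition H2K_graph :: "('v, 'e) pre_digraph \<Rightarrow> ('e \<Rightarrow> real) \<Rightarrow> 'e graph_fun set" where
  "H2K_graph G len =
     {u \<in> H1_graph G len. (\<forall>e\<in>arcs G. u e \<in> H2_interval (len e)) \<and> kirchhoff G len u}"

definition lambda2 :: "('v, 'e) pre_digraph \<Rightarrow> ('e \<Rightarrow> real) \<Rightarrow> real" where
  "lambda2 G len =
     Inf {(Lp_norm 2 G len (graph_deriv len \<phi>))\<^sup>2 / (Lp_norm 2 G len \<phi>)\<^sup>2 |\<phi>.
            \<phi> \<in> H1_graph G len \<and> (\<exists>e\<in>arcs G. \<exists>x\<in>{0..len e}. \<phi> e x \<noteq> 0) \<and>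
            graph_integral G len \<phi> = 0}"

definition \<mu>1 :: "('v, 'e) pre_digraph \<Rightarrow> ('e \<Rightarrow> real) \<Rightarrow> real" where
  "\<mu>1 G len = total_length G len * sqrt (lambda2 G len / 4)"

definition \<mu>R :: real where
  "\<mu>R = pi * sqrt 3 / 2"


section \<open>The quintic NLS equation\<close>

definition stationary_nls ::
  "('v, 'e) pre_digraph \<Rightarrow> ('e \<Rightarrow> real) \<Rightarrow> real \<Rightarrow> 'e graph_fun \<Rightarrow> bool" where
  "stationary_nls G len lam u \<longleftrightarrow>
     (\<forall>e\<in>arcs G. AE x in lebesgue. x \<in> {0..len e} \<longrightarrow>
        graph_deriv len (graph_deriv len u) e x
          + complex_of_real (cmod (u e x) ^ 4) * u e x - complex_of_real lam * u e x = 0)"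

definition L2_inner ::
  "('v, 'e) pre_digraph \<Rightarrow> ('e \<Rightarrow> real) \<Rightarrow> 'e graph_fun \<Rightarrow> 'e graph_fun \<Rightarrow> complex" where
  "L2_inner G len f g = graph_integral G len (\<lambda>e x. f e x * cnj (g e x))"

text \<open>
  \<open>H\<^sup>1\<close> solutions on \<open>[0, T)\<close>, \<open>0 < T \<le> \<infinity>\<close>, of \<open>i v\<^sub>t = - v'' - |v|\<^sup>4 v\<close> with Kirchhoff conditions, in the
  usual weak sense: \<open>v \<in> C([0, T); H\<^sup>1)\<close> and the equation holds in the dual of \<open>H\<^sup>1\<close>. The Kirchhoff
  conditions are the natural boundary conditions of the form \<open>(v', \<phi>')\<close>. Since the right-hand side
  is continuous in time with values in the dual of \<open>H\<^sup>1\<close>, testing with each fixed \<open>\<phi>\<close> is the same as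
  requiring \<open>v \<in> C\<^sup>1([0, T); (H\<^sup>1)\<^sup>*)\<close>.
\<close>

definition nls_solution ::
  "('v, 'e) pre_digraph \<Rightarrow> ('e \<Rightarrow> real) \<Rightarrow> ereal \<Rightarrow> (real \<Rightarrow> 'e graph_fun) \<Rightarrow> bool" where
  "nls_solution G len T v \<longleftrightarrow>
     (let J = {t. 0 \<le> t \<and> ereal t < T} in
        0 < T \<and>
        (\<forall>t\<in>J. v t \<in> H1_graph G len) \<and>
        (\<forall>t\<in>J. ((\<lambda>s. H1_norm G len (\<lambda>e x. v s e x - v t e x)) \<longlongrightarrow> 0) (at t within J)) \<and>
        (\<forall>\<phi>\<in>H1_graph G len. \<forall>t\<in>J.
           ((\<lambda>s. \<i> * L2_inner G len (v s) \<phi>) has_vector_derivative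
              (L2_inner G len (graph_deriv len (v t)) (graph_deriv len \<phi>)
               - L2_inner G len (\<lambda>e x. complex_of_real (cmod (v t e x) ^ 4) * v t e x) \<phi>))
             (at t within J)))"

definition orbit_dist ::
  "('v, 'e) pre_digraph \<Rightarrow> ('e \<Rightarrow> real) \<Rightarrow> 'e graph_fun \<Rightarrow> 'e graph_fun \<Rightarrow> real" where
  "orbit_dist G len u w = (INF \<theta>::real. H1_norm G len (\<lambda>e x. w e x - cis \<theta> * u e x))"

text \<open>
  Quantifying over all solutions on some \<open>[0, T)\<close> covers the maximal one. The supremum is taken in
  the extended reals, so that it is not junk when the distance is unbounded.
\<close>

definition orbitally_stable ::
  "('v, 'e) pre_digraph \<Rightarrow> ('e \<Rightarrow> real) \<Rightarrow> 'e graph_fun \<Rightarrow> bool" where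
  "orbitally_stable G len u \<longleftrightarrow>
     (\<forall>\<epsilon>>0. \<exists>\<delta>>0. \<forall>v0\<in>H1_graph G len. orbit_dist G len u v0 < \<delta> \<longrightarrow>
        (\<forall>T v. nls_solution G len T v \<and> v 0 = v0 \<longrightarrow>
           (SUP t\<in>{t. 0 \<le> t \<and> ereal t < T}. ereal (orbit_dist G len u (v t))) < ereal \<epsilon>))"

end

theory Submission
  imports Defs
begin

text \<open>
  The constant \<open>\<kappa> = sqrt (\<mu> / L)\<close>, \<open>L\<close> the total length, is stationary with \<open>\<lambda> = \<kappa>\<^sup>4\<close>, and it is orbitally
  stable on every compact metric graph as soon as \<open>\<mu> < \<mu>1\<close>, that is, \<open>4 \<kappa>\<^sup>4 < \<lambda>\<^sub>2\<close>. The argument is the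
  classical one by Lyapunov's method with mass and energy.

  Coercivity (\<open>energy_coercive\<close>). Let \<open>u\<close> have mean \<open>c\<close>, put \<open>\<phi> = u - c\<close>, and let \<open>q\<close> be the mean of
  \<open>\<bar>u\<bar>\<^sup>2\<close>. Since \<open>\<bar>u\<bar>\<^sup>2 - q\<close> has integral zero, expanding \<open>\<bar>u\<bar>\<^sup>6\<close> around \<open>q\<close> leaves no linear term:
  \<open>\<parallel>u\<parallel>\<^sub>6\<^sup>6 = L q\<^sup>3 + \<integral> (\<bar>u\<bar>\<^sup>2 - q)\<^sup>2 (\<bar>u\<bar>\<^sup>2 + 2 q)\<close>. If \<open>\<bar>u\<bar> \<le> K\<close>, the last integral is at most
  \<open>12 K\<^sup>4 \<parallel>\<phi>\<parallel>\<^sup>2 \<le> 12 K\<^sup>4 \<parallel>u'\<parallel>\<^sup>2 / \<lambda>\<^sub>2\<close>, so that \<open>2 E(u) + L q\<^sup>3 / 3\<close> lies between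
  \<open>(1 - 4 K\<^sup>4 / \<lambda>\<^sub>2) \<parallel>u'\<parallel>\<^sup>2\<close> and \<open>\<parallel>u'\<parallel>\<^sup>2\<close>. As \<open>q\<close> and \<open>E\<close> are conserved, \<open>\<parallel>u'\<parallel>\<close> is controlled by its
  initial value as long as \<open>\<bar>u\<bar> \<le> K\<close>, with \<open>K\<close> slightly larger than \<open>\<kappa>\<close>; a continuity argument in time
  removes this proviso (\<open>gradient_stays_small\<close>). The gradient and the mass control the distance to the
  orbit of \<open>\<kappa>\<close> (\<open>orbit_dist_const_le\<close>).

  Conservation laws (\<open>mass_conservation\<close>, \<open>energy_conservation\<close>). A solution is only known to be
  continuous with values in \<open>H\<^sup>1\<close> and to satisfy the equation against fixed test functions, so
  neither law follows by formally testing with \<open>v\<close> or \<open>v\<^sub>t\<close>. Both are read off the correlation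
  \<open>M(s, t) = (v(s), v(t))\<close>. The equation gives \<open>\<partial>\<^sub>s M = - i P(s, t)\<close> with
  \<open>P(s, t) = (v(s)', v(t)') - (\<bar>v(s)\<bar>\<^sup>4 v(s), v(t))\<close>. Along the diagonals \<open>s - t = h\<close> the gradient terms
  cancel, which leaves the derivative
  \<open>i N(s, t)\<close>, \<open>N(s, t) = \<integral> (\<bar>v(s)\<bar>\<^sup>4 - \<bar>v(t)\<bar>\<^sup>4) v(s) cnj (v(t))\<close>. For \<open>h = 0\<close> this is conservation of mass.
  For small \<open>h\<close>, the real part of \<open>N(t + h, t)\<close> is \<open>2/3 (\<parallel>v(t + h)\<parallel>\<^sub>6\<^sup>6 - \<parallel>v(t)\<parallel>\<^sub>6\<^sup>6)\<close> up to
  \<open>O(\<parallel>v(t + h) - v(t)\<parallel>\<^sup>2) = o(h)\<close>; dividing the imaginary part of \<open>M(t + h, t)\<close> by \<open>h\<close> and letting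
  \<open>h \<rightarrow> 0\<close> shows that \<open>\<parallel>v'\<parallel>\<^sup>2 - \<parallel>v\<parallel>\<^sub>6\<^sup>6 / 3\<close> is constant.

  On a single edge, all that is needed from Sobolev space theory is that a weak derivative is unique
  almost everywhere and that it bounds the increments of the function. Both follow by testing with
  smoothed indicator functions of intervals.
\<close>

section \<open>Square-integrable functions on an interval\<close>

lemma set_LINT_eq_lebesgue_on:
  fixes f :: "real \<Rightarrow> 'b::{banach, second_countable_topology}"
  shows "(LINT x:{a..b}|lebesgue. f x) = integral\<^sup>L (lebesgue_on {a..b}) f"
  unfolding set_lebesgue_integral_def by (subst integral_restrict_space) auto

lemma L2_interval_iff:
  "f \<in> L2_interval l \<longleftrightarrow>
     f \<in> borel_measurable (lebesgue_on {0..l}) \<and> integrable (lebesgue_on {0..l}) (\<lambda>x. (cmod (f x))\<^sup>2)"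
  unfolding L2_interval_def set_borel_measurable_def set_integrable_def
  by (auto simp: borel_measurable_restrict_space_iff integrable_restrict_space)

lemma finite_measure_lebesgue_on_Icc: "finite_measure (lebesgue_on {a..b::real})"
  by (rule finite_measure_lebesgue_on) auto

lemma integrable_lebesgue_on_const: "integrable (lebesgue_on {a..b::real}) (\<lambda>x. c::'b::{banach, second_countable_topology})"
  using finite_measure.integrable_const[OF finite_measure_lebesgue_on_Icc] .

lemma L2_interval_measurable: "f \<in> L2_interval l \<Longrightarrow> f \<in> borel_measurable (lebesgue_on {0..l})"
  and L2_interval_sq: "f \<in> L2_interval l \<Longrightarrow> integrable (lebesgue_on {0..l}) (\<lambda>x. (cmod (f x))\<^sup>2)"
  by (auto simp: L2_interval_iff)

lemma L2_interval_cmod_mult: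
  assumes "f \<in> L2_interval l" "g \<in> L2_interval l"
  shows "integrable (lebesgue_on {0..l}) (\<lambda>x. cmod (f x) * cmod (g x))"
proof (rule Bochner_Integration.integrable_bound)
  show "integrable (lebesgue_on {0..l}) (\<lambda>x. (cmod (f x))\<^sup>2 + (cmod (g x))\<^sup>2)"
    using assms by (auto simp: L2_interval_iff)
  show "(\<lambda>x. cmod (f x) * cmod (g x)) \<in> borel_measurable (lebesgue_on {0..l})"
    using assms[THEN L2_interval_measurable] by measurable
  have "cmod (f x) * cmod (g x) \<le> (cmod (f x))\<^sup>2 + (cmod (g x))\<^sup>2" for x
    using sum_squares_bound[of "cmod (f x)" "cmod (g x)"] mult_nonneg_nonneg[OF norm_ge_zero norm_ge_zero, of "f x" "g x"]
    by linarith
  then show "AE x in lebesgue_on {0..l}. norm (cmod (f x) * cmod (g x)) \<le> norm ((cmod (f x))\<^sup>2 + (cmod (g x))\<^sup>2)"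
    by auto
qed

lemma L2_interval_mult:
  assumes "f \<in> L2_interval l" "g \<in> L2_interval l"
  shows "integrable (lebesgue_on {0..l}) (\<lambda>x. f x * g x)"
proof (rule Bochner_Integration.integrable_bound[OF L2_interval_cmod_mult[OF assms]])
  show "(\<lambda>x. f x * g x) \<in> borel_measurable (lebesgue_on {0..l})"
    using assms[THEN L2_interval_measurable] by measurable
qed (auto simp: norm_mult)

lemma L2_interval_cnj: "f \<in> L2_interval l \<Longrightarrow> (\<lambda>x. cnj (f x)) \<in> L2_interval l"
  unfolding L2_interval_iff
  using measurable_compose[OF _ borel_measurable_continuous_onI[OF continuous_on_cnj[OF continuous_on_id]], of f]
  by simp

lemma L2_interval_mult_cnj:
  assumes "f \<in> L2_interval l" "g \<in> L2_interval l"
  shows "integrable (lebesgue_on {0..l}) (\<lambda>x. f x * cnj (g x))"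
  using L2_interval_mult[OF assms(1) L2_interval_cnj[OF assms(2)]] .

lemma L2_interval_continuous:
  assumes "continuous_on {0..l} f" shows "f \<in> L2_interval l"
  unfolding L2_interval_iff
proof
  show "f \<in> borel_measurable (lebesgue_on {0..l})"
    using assms by (rule continuous_imp_measurable_on_sets_lebesgue) auto
  show "integrable (lebesgue_on {0..l}) (\<lambda>x. (cmod (f x))\<^sup>2)"
    by (rule continuous_imp_integrable_real) (intro continuous_intros assms)
qed

lemma L2_interval_integrable:
  assumes "f \<in> L2_interval l" shows "integrable (lebesgue_on {0..l}) f"
  using L2_interval_mult[OF assms L2_interval_continuous[of l "\<lambda>_. 1"]] by simp

lemma L2_interval_cmult:
  assumes "f \<in> L2_interval l" shows "(\<lambda>x. c * f x) \<in> L2_interval l"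
  using assms unfolding L2_interval_iff by (auto simp: norm_mult power_mult_distrib)

lemma L2_interval_add:
  assumes "f \<in> L2_interval l" "g \<in> L2_interval l"
  shows "(\<lambda>x. f x + g x) \<in> L2_interval l"
  unfolding L2_interval_iff
proof
  show m: "(\<lambda>x. f x + g x) \<in> borel_measurable (lebesgue_on {0..l})"
    using assms[THEN L2_interval_measurable] by measurable
  show "integrable (lebesgue_on {0..l}) (\<lambda>x. (cmod (f x + g x))\<^sup>2)"
  proof (rule Bochner_Integration.integrable_bound)
    show "integrable (lebesgue_on {0..l}) (\<lambda>x. 2 * (cmod (f x))\<^sup>2 + 2 * (cmod (g x))\<^sup>2)"
      using assms by (auto simp: L2_interval_iff)
    show "(\<lambda>x. (cmod (f x + g x))\<^sup>2) \<in> borel_measurable (lebesgue_on {0..l})"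
      using m by measurable
    have "(cmod (f x + g x))\<^sup>2 \<le> 2 * (cmod (f x))\<^sup>2 + 2 * (cmod (g x))\<^sup>2" for x
    proof -
      have "(cmod (f x + g x))\<^sup>2 \<le> (cmod (f x) + cmod (g x))\<^sup>2"
        by (intro power_mono norm_triangle_ineq) auto
      also have "\<dots> \<le> 2 * (cmod (f x))\<^sup>2 + 2 * (cmod (g x))\<^sup>2"
        using sum_squares_bound[of "cmod (f x)" "cmod (g x)"] by (simp add: power2_sum)
      finally show ?thesis .
    qed
    then show "AE x in lebesgue_on {0..l}. norm ((cmod (f x + g x))\<^sup>2) \<le> norm (2 * (cmod (f x))\<^sup>2 + 2 * (cmod (g x))\<^sup>2)"
      by auto
  qed
qed

lemma L2_interval_diff:
  assumes "f \<in> L2_interval l" "g \<in> L2_interval l"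
  shows "(\<lambda>x. f x - g x) \<in> L2_interval l"
  using L2_interval_add[OF assms(1) L2_interval_cmult[OF assms(2), of "-1"]] by simp

lemma quadratic_nonneg_discriminant:
  fixes a b c :: real
  assumes "\<And>t. 0 \<le> a + 2 * b * t + c * t\<^sup>2" "0 \<le> c"
  shows "b\<^sup>2 \<le> a * c"
proof (cases "c = 0")
  case True
  have "b = 0"
  proof (rule ccontr)
    assume "b \<noteq> 0"
    with assms(1)[of "- (a + 1) / (2 * b)"] True show False by (simp add: field_simps)
  qed
  with True show ?thesis by simp
next
  case False
  with assms have c: "c > 0" by simp
  have "0 \<le> a - b\<^sup>2 / c"
    using assms(1)[of "- b / c"] c by (simp add: field_simps power2_eq_square)
  with c show ?thesis by (simp add: field_simps)
qed

text \<open>This is \<open>quadratic_nonneg_discriminant\<close> for the square of the norm of \<open>\<bar>f\<bar> + t \<bar>g\<bar>\<close>.\<close>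

lemma L2_interval_Cauchy_Schwarz:
  assumes "f \<in> L2_interval l" "g \<in> L2_interval l"
  shows "(integral\<^sup>L (lebesgue_on {0..l}) (\<lambda>x. cmod (f x) * cmod (g x)))\<^sup>2
           \<le> integral\<^sup>L (lebesgue_on {0..l}) (\<lambda>x. (cmod (f x))\<^sup>2)
             * integral\<^sup>L (lebesgue_on {0..l}) (\<lambda>x. (cmod (g x))\<^sup>2)"
proof (rule quadratic_nonneg_discriminant)
  note i = L2_interval_sq[OF assms(1)] L2_interval_sq[OF assms(2)] L2_interval_cmod_mult[OF assms]
  fix t :: real
  have "0 \<le> integral\<^sup>L (lebesgue_on {0..l}) (\<lambda>x. (cmod (f x) + t * cmod (g x))\<^sup>2)"
    by simp
  also have "(\<lambda>x. (cmod (f x) + t * cmod (g x))\<^sup>2)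
     = (\<lambda>x. (cmod (f x))\<^sup>2 + 2 * t * (cmod (f x) * cmod (g x)) + t\<^sup>2 * (cmod (g x))\<^sup>2)"
    by (auto simp: power2_eq_square algebra_simps)
  finally show "0 \<le> integral\<^sup>L (lebesgue_on {0..l}) (\<lambda>x. (cmod (f x))\<^sup>2)
     + 2 * integral\<^sup>L (lebesgue_on {0..l}) (\<lambda>x. cmod (f x) * cmod (g x)) * t
     + integral\<^sup>L (lebesgue_on {0..l}) (\<lambda>x. (cmod (g x))\<^sup>2) * t\<^sup>2"
    using i by (simp add: algebra_simps)
qed simp

text \<open>An integrable function with vanishing integral over every open interval is null: the Borel
  sets over which the integral vanishes form a Dynkin system that contains the intervals.\<close>

lemma AE_eq_0_of_integral_intervals_eq_0:
  fixes G :: "real \<Rightarrow> complex"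
  assumes G: "integrable lebesgue G"
    and 0: "\<And>a b. (LINT x:box a b|lebesgue. G x) = 0"
  shows "AE x in lebesgue. G x = 0"
proof -
  have si: "set_integrable lebesgue A G" if "A \<in> sets lebesgue" for A
    using integrable_mult_indicator[OF that G] by (simp add: set_integrable_def)
  have borel: "(LINT x:A|lebesgue. G x) = 0" if "A \<in> sets borel" for A
  proof -
    let ?E = "range (\<lambda>(a, b). box a b :: real set)"
    have A: "A \<in> sigma_sets UNIV ?E"
      using that by (simp add: borel_eq_box)
    have E: "Int_stable ?E" "?E \<subseteq> Pow UNIV"
      by (auto simp: Int_stable_def box_Int_box)
    have leb: "B \<in> sets lebesgue" if "B \<in> sigma_sets UNIV ?E" for B
    proof -
      have "B \<in> sets borel" using that by (simp add: borel_eq_box)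
      then show ?thesis by (simp add: sets_completionI_sets)
    qed
    have tot: "(LINT x|lebesgue. G x) = 0"
    proof -
      let ?B = "\<lambda>n::nat. box (- real n) (real n)"
      have "(\<lambda>n. LINT x:?B n|lebesgue. G x) \<longlonglongrightarrow> (LINT x:(\<Union>n. ?B n)|lebesgue. G x)"
      proof (rule set_integral_cont_up)
        show "?B i \<in> sets lebesgue" for i by simp
        show "incseq ?B" by (auto simp: incseq_def box_real)
        show "set_integrable lebesgue (\<Union>n. ?B n) G" by (rule si) auto
      qed
      moreover have "(\<Union>n. ?B n) = UNIV"
        using UN_box_eq_UNIV[where 'a=real] by (simp add: mult.commute)
      ultimately show ?thesis using 0 by (simp add: set_lebesgue_integral_def LIMSEQ_const_iff)
    qed
    show ?thesis
      using E A
    proof (induction rule: sigma_sets_induct_disjoint)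
      case (basic B) then show ?case using 0 by auto
    next
      case empty show ?case by (simp add: set_lebesgue_integral_def)
    next
      case (compl B)
      have "(LINT x:B \<union> (UNIV - B)|lebesgue. G x) = (LINT x:B|lebesgue. G x) + (LINT x:(UNIV - B)|lebesgue. G x)"
        using leb[OF compl(1)] by (intro set_integral_Un si) auto
      moreover have "B \<union> (UNIV - B) = UNIV" by auto
      ultimately show ?case using compl tot by (simp add: set_lebesgue_integral_def)
    next
      case (union A)
      have "(LINT x:(\<Union>i. A i)|lebesgue. G x) = (\<Sum>i. LINT x:A i|lebesgue. G x)"
      proof (rule lebesgue_integral_countable_add)
        show "A i \<in> sets lebesgue" for i using union(2) leb by auto
        show "set_integrable lebesgue (\<Union>i. A i) G"
          by (intro si sets.countable_UN) (use union(2) leb in auto)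
        show "A i \<inter> A j = {}" if "i \<noteq> j" for i j using union(1) that by (auto simp: disjoint_family_on_def)
      qed
      then show ?case using union by simp
    qed
  qed
  interpret sigma_finite_measure "lebesgue :: real measure"
  proof
    let ?A = "range (\<lambda>n::nat. box (- real n) (real n))"
    have "\<Union>?A = UNIV"
      using UN_box_eq_UNIV[where 'a=real] by (simp add: mult.commute)
    moreover have "emeasure lebesgue a \<noteq> \<infinity>" if "a \<in> ?A" for a
      using that by auto
    ultimately show "\<exists>A::real set set. countable A \<and> A \<subseteq> sets lebesgue \<and> \<Union>A = space lebesgue
        \<and> (\<forall>a\<in>A. emeasure lebesgue a \<noteq> \<infinity>)"
      by (intro exI[of _ ?A]) auto
  qed
  show ?thesis
  proof (rule density_zero[OF G])
    fix A :: "real set" assume A: "A \<in> sets lebesgue"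
    then obtain S N N' where S: "A = S \<union> N" "N \<subseteq> N'" "N' \<in> null_sets lborel" "S \<in> sets lborel"
      by (rule sets_completionE)
    have N: "N' \<in> null_sets lebesgue" using S(3) by (rule null_sets_completionI)
    have "(LINT x:A|lebesgue. G x) = (LINT x:S|lebesgue. G x)"
      unfolding set_lebesgue_integral_def
    proof (rule integral_cong_AE)
      show "(\<lambda>x. indicat_real A x *\<^sub>R G x) \<in> borel_measurable lebesgue"
        using si[OF A] by (simp add: set_integrable_def borel_measurable_integrable)
      show "(\<lambda>x. indicat_real S x *\<^sub>R G x) \<in> borel_measurable lebesgue"
        using si[of S] S(4) by (simp add: set_integrable_def borel_measurable_integrable sets_completionI_sets)
      show "AE x in lebesgue. indicat_real A x *\<^sub>R G x = indicat_real S x *\<^sub>R G x"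
        using AE_not_in[OF N] by eventually_elim (use S in \<open>auto simp: indicator_def\<close>)
    qed
    then show "(LINT x:A|lebesgue. G x) = 0" using borel S(4) by simp
  qed
qed


section \<open>Weak derivatives on an interval\<close>

text \<open>The square of the positive part is continuously differentiable.\<close>

definition sq_pos :: "real \<Rightarrow> real" where "sq_pos y = (max 0 y)\<^sup>2"

lemma DERIV_sq_pos: "(sq_pos has_real_derivative 2 * max 0 y) (at y)"
proof -
  have key: "\<bar>sq_pos z - sq_pos y - 2 * max 0 y * (z - y)\<bar> \<le> (z - y)\<^sup>2" for z
  proof -
    consider "0 \<le> y" "0 \<le> z" | "0 \<le> y" "z \<le> 0" | "y \<le> 0" "0 \<le> z" | "y \<le> 0" "z \<le> 0" by linarith
    then show ?thesis
    proof cases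
      case 1
      then have "sq_pos z - sq_pos y - 2 * max 0 y * (z - y) = (z - y)\<^sup>2"
        by (simp add: sq_pos_def power2_eq_square algebra_simps)
      then show ?thesis by simp
    next
      case 2
      then have m: "max 0 y = y" "max 0 z = 0" by auto
      have "y * z \<le> 0" using 2 by (rule mult_nonneg_nonpos)
      moreover have "0 \<le> z\<^sup>2" "0 \<le> y\<^sup>2" by auto
      moreover have "sq_pos z - sq_pos y - 2 * max 0 y * (z - y) = y\<^sup>2 - 2 * (y * z)"
        "(z - y)\<^sup>2 = z\<^sup>2 + y\<^sup>2 - 2 * (y * z)"
        unfolding sq_pos_def m by (simp_all add: power2_eq_square algebra_simps)
      ultimately show ?thesis by linarith
    next
      case 3
      then have m: "max 0 y = 0" "max 0 z = z" by auto
      have "z * y \<le> 0" using 3 by (simp add: mult_nonneg_nonpos)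
      moreover have "0 \<le> z\<^sup>2" "0 \<le> y\<^sup>2" by auto
      moreover have "sq_pos z - sq_pos y - 2 * max 0 y * (z - y) = z\<^sup>2"
        "(z - y)\<^sup>2 = z\<^sup>2 + y\<^sup>2 - 2 * (z * y)"
        unfolding sq_pos_def m by (simp_all add: power2_eq_square algebra_simps)
      ultimately show ?thesis by linarith
    next
      case 4 then show ?thesis by (simp add: sq_pos_def max_def)
    qed
  qed
  have "((\<lambda>z. (sq_pos z - sq_pos y) / (z - y) - 2 * max 0 y) \<longlongrightarrow> 0) (at y)"
  proof (rule Lim_null_comparison)
    show "\<forall>\<^sub>F z in at y. norm ((sq_pos z - sq_pos y) / (z - y) - 2 * max 0 y) \<le> \<bar>z - y\<bar>"
      unfolding eventually_at_filter
    proof (intro always_eventually allI impI)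
      fix z assume z: "z \<noteq> y"
      have "(sq_pos z - sq_pos y) / (z - y) - 2 * max 0 y = (sq_pos z - sq_pos y - 2 * max 0 y * (z - y)) / (z - y)"
        using z by (simp add: field_simps)
      also have "norm \<dots> \<le> (z - y)\<^sup>2 / \<bar>z - y\<bar>"
        unfolding real_norm_def abs_divide by (intro divide_right_mono key) auto
      also have "\<dots> = \<bar>z - y\<bar>" using z by (simp add: power2_eq_square abs_if field_simps)
      finally show "norm ((sq_pos z - sq_pos y) / (z - y) - 2 * max 0 y) \<le> \<bar>z - y\<bar>" .
    qed
    have "((\<lambda>z. \<bar>z - y\<bar>) \<longlongrightarrow> \<bar>y - y\<bar>) (at y)" by (intro tendsto_intros)
    then show "((\<lambda>z. \<bar>z - y\<bar>) \<longlongrightarrow> 0) (at y)" by simp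
  qed
  then show ?thesis unfolding has_field_derivative_iff by (simp add: LIM_zero_iff)
qed

text \<open>A continuously differentiable step, equal to \<open>0\<close> for \<open>y \<le> 0\<close> and to \<open>1\<close> for \<open>y \<ge> 1\<close>, given as a
  quadratic spline with knots \<open>0, 1/2, 1\<close>. Its derivative \<open>hat\<close> is the piecewise linear function that is
  supported on \<open>[0, 1]\<close> and peaks at \<open>1/2\<close>.\<close>

definition smooth_step :: "real \<Rightarrow> real" where
  "smooth_step y = 2 * sq_pos y - 4 * sq_pos (y - 1/2) + 2 * sq_pos (y - 1)"

definition hat :: "real \<Rightarrow> real" where
  "hat y = 4 * max 0 y - 8 * max 0 (y - 1/2) + 4 * max 0 (y - 1)"

lemma DERIV_smooth_step: "(smooth_step has_real_derivative hat y) (at y)"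
proof -
  have *: "((\<lambda>y. sq_pos (y - c)) has_real_derivative 2 * max 0 (y - c)) (at y)" for c
    using DERIV_shift[of sq_pos "2 * max 0 (y - c)" y "- c"] DERIV_sq_pos[of "y - c"] by simp
  show ?thesis
    unfolding smooth_step_def[abs_def]
    by (rule derivative_eq_intros DERIV_sq_pos * refl)+ (simp add: hat_def)
qed

lemma smooth_step_simps [simp]: "y \<le> 0 \<Longrightarrow> smooth_step y = 0" "1 \<le> y \<Longrightarrow> smooth_step y = 1"
  by (auto simp: smooth_step_def sq_pos_def max_def power2_eq_square algebra_simps)

lemma smooth_step_abs_le: "\<bar>smooth_step y\<bar> \<le> 1"
proof -
  consider "y \<le> 0" | "0 \<le> y" "y \<le> 1/2" | "1/2 \<le> y" "y \<le> 1" | "1 \<le> y" by linarith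
  then show ?thesis
  proof cases
    case 2
    then have "smooth_step y = 2 * y\<^sup>2" by (auto simp: smooth_step_def sq_pos_def max_def)
    moreover have "y\<^sup>2 \<le> (1/2)\<^sup>2" using 2 by (intro power_mono) auto
    ultimately show ?thesis by (simp add: power2_eq_square)
  next
    case 3
    then have "smooth_step y = 1 - 2 * (1 - y)\<^sup>2"
      by (auto simp: smooth_step_def sq_pos_def max_def power2_eq_square algebra_simps)
    moreover have "(1 - y)\<^sup>2 \<le> (1/2)\<^sup>2" using 3 by (intro power_mono) auto
    ultimately show ?thesis by (simp add: power2_eq_square)
  qed auto
qed

lemma hat_nonneg: "0 \<le> hat y"
  by (auto simp: hat_def max_def)

lemma hat_eq_0: "y \<le> 0 \<or> 1 \<le> y \<Longrightarrow> hat y = 0"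
  by (auto simp: hat_def max_def)

lemma continuous_on_hat [continuous_intros]:
  "continuous_on S f \<Longrightarrow> continuous_on S (\<lambda>x. hat (f x))"
  unfolding hat_def by (intro continuous_intros)

lemma DERIV_smooth_step_scaled:
  "((\<lambda>x. smooth_step (c * (x - a))) has_real_derivative c * hat (c * (x - a))) (at x)"
proof -
  have "((\<lambda>x. c * (x - a)) has_real_derivative c) (at x)"
    by (auto intro!: derivative_eq_intros)
  from DERIV_chain2[OF DERIV_smooth_step this] show ?thesis by (simp add: mult.commute)
qed

text \<open>The derivatives of \<open>smooth_step (n (x - a))\<close> are an approximate identity at \<open>a\<close>.\<close>

lemma hat_approximate_identity:
  fixes f :: "real \<Rightarrow> complex"
  assumes f: "continuous_on {0..l} f" and a: "0 < a" "a < l"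
  shows "(\<lambda>n. integral\<^sup>L (lebesgue_on {0..l}) (\<lambda>x. complex_of_real (real n * hat (real n * (x - a))) * f x)) \<longlonglongrightarrow> f a"
proof (rule LIMSEQ_I)
  fix r :: real assume r: "0 < r"
  have "a \<in> {0..l}" using a by auto
  with f r obtain d where d: "d > 0" "\<And>x. x \<in> {0..l} \<Longrightarrow> dist x a < d \<Longrightarrow> dist (f x) (f a) < r / 2"
    unfolding continuous_on_iff by (meson half_gt_zero)
  obtain N :: nat where N: "1 / d < real N" "1 / (l - a) < real N" "0 < real N"
  proof -
    obtain N where "max (1/d) (max (1/(l-a)) 0) < real N" using reals_Archimedean2 by blast
    then show ?thesis by (intro that[of N]) auto
  qed
  show "\<exists>no. \<forall>n\<ge>no. norm (integral\<^sup>L (lebesgue_on {0..l}) (\<lambda>x. complex_of_real (real n * hat (real n * (x - a))) * f x) - f a) < r"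
  proof (intro exI[of _ N] allI impI)
    fix n assume n: "N \<le> n"
    let ?k = "\<lambda>x. real n * hat (real n * (x - a))"
    let ?M = "lebesgue_on {0..l}"
    have n1: "1 / d < real n" "1 / (l - a) < real n" "0 < real n"
      using N n by (auto intro: less_le_trans)
    have nl: "1 \<le> real n * (l - a)" using n1(2) a by (simp add: field_simps)
    have ck: "continuous_on {0..l} ?k" by (intro continuous_intros)
    have ik: "integrable ?M ?k" by (rule continuous_imp_integrable_real[OF ck])
    have "(?k has_integral (smooth_step (real n * (l - a)) - smooth_step (real n * (0 - a)))) {0..l}"
      using a by (intro fundamental_theorem_of_calculus)
        (auto simp: has_real_derivative_iff_has_vector_derivative[symmetric] intro!: DERIV_subset[OF DERIV_smooth_step_scaled])
    moreover have "real n * (0 - a) \<le> 0" using a by (intro mult_nonneg_nonpos) auto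
    ultimately have "(?k has_integral 1) {0..l}"
      using nl by simp
    then have "integral {0..l} ?k = 1" by (rule integral_unique)
    then have 1: "integral\<^sup>L ?M ?k = 1"
      using lebesgue_integral_eq_integral[OF ik] by simp
    have if1: "integrable ?M (\<lambda>x. complex_of_real (?k x) * f x)"
      by (intro continuous_imp_integrable_real continuous_intros f ck continuous_on_of_real)
    have if2: "integrable ?M (\<lambda>x. complex_of_real (?k x) * f a)"
      by (intro continuous_imp_integrable_real continuous_intros f ck continuous_on_of_real)
    have if3: "integrable ?M (\<lambda>x. ?k x * (r / 2))"
      by (intro continuous_imp_integrable_real continuous_intros)
    have "integral\<^sup>L ?M (\<lambda>x. complex_of_real (?k x) * f a) = f a"
      by (simp only: integral_mult_left_zero integral_complex_of_real 1 of_real_1 mult_1)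
    then have split: "integral\<^sup>L ?M (\<lambda>x. complex_of_real (?k x) * f x) - f a
        = integral\<^sup>L ?M (\<lambda>x. complex_of_real (?k x) * f x - complex_of_real (?k x) * f a)"
      by (simp only: Bochner_Integration.integral_diff[OF if1 if2])
    have "norm (integral\<^sup>L ?M (\<lambda>x. complex_of_real (?k x) * f x) - f a)
        \<le> integral\<^sup>L ?M (\<lambda>x. norm (complex_of_real (?k x) * f x - complex_of_real (?k x) * f a))"
      unfolding split by (rule integral_norm_bound)
    also have "\<dots> \<le> integral\<^sup>L ?M (\<lambda>x. ?k x * (r / 2))"
    proof (rule integral_mono)
      show "integrable ?M (\<lambda>x. norm (complex_of_real (?k x) * f x - complex_of_real (?k x) * f a))"
        by (rule integrable_norm[OF Bochner_Integration.integrable_diff[OF if1 if2]])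
      fix x assume "x \<in> space ?M"
      then have x: "x \<in> {0..l}" by simp
      have "norm (f x - f a) \<le> r / 2" if "hat (real n * (x - a)) \<noteq> 0"
      proof -
        have "0 < real n * (x - a)" "real n * (x - a) < 1"
          using that hat_eq_0 by (auto simp: not_le[symmetric])
        then have "0 < x - a" "x - a < 1 / real n"
          using n1(3) by (auto simp: zero_less_mult_iff field_simps)
        moreover have "1 / real n < d" using n1 d by (simp add: field_simps)
        ultimately have "dist x a < d" by (simp add: dist_real_def)
        then show ?thesis using d(2)[OF x] by (simp add: dist_norm)
      qed
      then have "?k x * norm (f x - f a) \<le> ?k x * (r / 2)"
        using n1(3) hat_nonneg by (cases "hat (real n * (x - a)) = 0") (auto intro!: mult_left_mono)
      moreover have "norm (complex_of_real (?k x) * f x - complex_of_real (?k x) * f a) = ?k x * norm (f x - f a)"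
        using n1(3) hat_nonneg[of "real n * (x - a)"]
        by (simp only: right_diff_distrib[symmetric] norm_mult norm_of_real) simp
      ultimately show "norm (complex_of_real (?k x) * f x - complex_of_real (?k x) * f a) \<le> ?k x * (r / 2)"
        by simp
    qed (rule if3)
    also have "\<dots> = r / 2" using ik 1 by (subst integral_mult_left_zero) simp
    also have "\<dots> < r" using r by simp
    finally show "norm (integral\<^sup>L ?M (\<lambda>x. complex_of_real (?k x) * f x) - f a) < r" .
  qed
qed

lemma test_function_steps:
  assumes "0 < a" "a < b" "1 / real n < l - b" "0 < n"
  shows "test_function l (\<lambda>x. smooth_step (real n * (x - a)) - smooth_step (real n * (x - b)))"
    and "deriv (\<lambda>x. smooth_step (real n * (x - a)) - smooth_step (real n * (x - b)))
           = (\<lambda>x. real n * hat (real n * (x - a)) - real n * hat (real n * (x - b)))"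
proof -
  have D: "((\<lambda>x. smooth_step (real n * (x - a)) - smooth_step (real n * (x - b))) has_real_derivative
      real n * hat (real n * (x - a)) - real n * hat (real n * (x - b))) (at x)" for x
    by (intro DERIV_diff DERIV_smooth_step_scaled)
  show eq: "deriv (\<lambda>x. smooth_step (real n * (x - a)) - smooth_step (real n * (x - b)))
           = (\<lambda>x. real n * hat (real n * (x - a)) - real n * hat (real n * (x - b)))"
    using DERIV_imp_deriv[OF D] by auto
  show "test_function l (\<lambda>x. smooth_step (real n * (x - a)) - smooth_step (real n * (x - b)))"
    unfolding test_function_def eq
  proof (intro conjI allI)
    show "(\<lambda>x. smooth_step (real n * (x - a)) - smooth_step (real n * (x - b))) differentiable at x" for x
      using D[of x] real_differentiable_def by blast
    show "continuous_on UNIV (\<lambda>x. real n * hat (real n * (x - a)) - real n * hat (real n * (x - b)))"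
      by (intro continuous_intros)
    show "\<exists>a' b'. 0 < a' \<and> b' < l \<and> (\<forall>x. x \<notin> {a'..b'} \<longrightarrow>
        smooth_step (real n * (x - a)) - smooth_step (real n * (x - b)) = 0)"
    proof (rule exI[of _ a], rule exI[of _ "b + 1 / real n"], intro conjI allI impI)
      fix x assume "x \<notin> {a..b + 1 / real n}"
      then consider "x < a" | "b + 1 / real n < x" by fastforce
      then show "smooth_step (real n * (x - a)) - smooth_step (real n * (x - b)) = 0"
      proof cases
        case 1
        then have "real n * (x - a) \<le> 0" "real n * (x - b) \<le> 0"
          using assms by (auto intro!: mult_nonneg_nonpos)
        then show ?thesis by simp
      next
        case 2
        then have "1 / real n \<le> x - a" "1 / real n \<le> x - b" using assms by auto
        then have "1 \<le> real n * (x - a)" "1 \<le> real n * (x - b)"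
          using assms by (auto simp: field_simps)
        then show ?thesis by simp
      qed
    qed (use assms in auto)
  qed
qed

text \<open>The fundamental theorem of calculus for a weak derivative of a continuous function. The test
  functions are the smoothed indicators \<open>smooth_step (n (x - a)) - smooth_step (n (x - b))\<close>, which tend
  to the indicator of \<open>(a, b]\<close> while their derivatives concentrate at \<open>a\<close> and at \<open>b\<close>.\<close>

lemma weak_deriv_increment:
  assumes f: "continuous_on {0..l} f" and g: "g \<in> L2_interval l" and w: "has_weak_deriv l f g"
    and ab: "0 < a" "a < b" "b < l"
  shows "f b - f a = (LINT x:{a<..b}|lebesgue. g x)"
proof -
  let ?M = "lebesgue_on {0..l}"
  let ?\<phi> = "\<lambda>n x. smooth_step (real n * (x - a)) - smooth_step (real n * (x - b))"
  let ?I = "\<lambda>a n. integral\<^sup>L ?M (\<lambda>x. complex_of_real (real n * hat (real n * (x - a))) * f x)"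
  obtain N :: nat where N: "1 / (l - b) < real N" using reals_Archimedean2 by blast
  have eq: "?I a n - ?I b n = - integral\<^sup>L ?M (\<lambda>x. complex_of_real (?\<phi> n x) * g x)" if "n \<ge> Suc N" for n
  proof -
    have "0 < n" "1 / (l - b) < real n" using that N by auto
    then have n: "1 / real n < l - b" "0 < n" using ab by (auto simp: field_simps)
    have i: "integrable ?M (\<lambda>x. complex_of_real (real n * hat (real n * (x - c))) * f x)" for c
      by (intro continuous_imp_integrable_real continuous_intros f continuous_on_of_real)
    have "integral\<^sup>L ?M (\<lambda>x. complex_of_real (real n * hat (real n * (x - a)) - real n * hat (real n * (x - b))) * f x)
        = - integral\<^sup>L ?M (\<lambda>x. complex_of_real (?\<phi> n x) * g x)"
      using w[unfolded has_weak_deriv_def set_LINT_eq_lebesgue_on, rule_format, OF test_function_steps(1)[OF ab(1,2) n]]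
      unfolding test_function_steps(2)[OF ab(1,2) n] .
    moreover have "(\<lambda>x. complex_of_real (real n * hat (real n * (x - a)) - real n * hat (real n * (x - b))) * f x)
       = (\<lambda>x. complex_of_real (real n * hat (real n * (x - a))) * f x - complex_of_real (real n * hat (real n * (x - b))) * f x)"
      by (auto simp: algebra_simps)
    ultimately show ?thesis using i by simp
  qed
  have L1: "(\<lambda>n. ?I a n - ?I b n) \<longlonglongrightarrow> f a - f b"
    by (intro tendsto_diff hat_approximate_identity f) (use ab in auto)
  have L2: "(\<lambda>n. integral\<^sup>L ?M (\<lambda>x. complex_of_real (?\<phi> n x) * g x)) \<longlonglongrightarrow> integral\<^sup>L ?M (\<lambda>x. indicator {a<..b} x * g x)"
  proof (rule integral_dominated_convergence[where w = "\<lambda>x. 2 * cmod (g x)"])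
    have m: "(\<lambda>x. complex_of_real (?\<phi> n x)) \<in> borel_measurable ?M" for n
    proof (rule continuous_imp_measurable_on_sets_lebesgue)
      have "continuous_on {0..l} (\<lambda>x. smooth_step (real n * (x - c)))" for c
        by (rule DERIV_continuous_on[OF DERIV_subset[OF DERIV_smooth_step_scaled subset_UNIV]])
      then show "continuous_on {0..l} (\<lambda>x. complex_of_real (?\<phi> n x))"
        by (intro continuous_intros continuous_on_of_real)
    qed auto
    show "(\<lambda>x. complex_of_real (?\<phi> n x) * g x) \<in> borel_measurable ?M" for n
      using m L2_interval_measurable[OF g] by measurable
    have "{a<..b} \<inter> {0..l} \<in> sets (restrict_space lebesgue {0..l})"
      by (subst sets_restrict_space_iff) auto
    then have "(\<lambda>x. indicator {a<..b} x :: complex) \<in> borel_measurable ?M"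
      by (subst borel_measurable_indicator_iff) (auto simp: Int_commute)
    then show "(\<lambda>x. indicator {a<..b} x * g x) \<in> borel_measurable ?M"
      using L2_interval_measurable[OF g] by measurable
    show "integrable ?M (\<lambda>x. 2 * cmod (g x))"
      using L2_interval_integrable[OF g] by simp
    have "norm (complex_of_real (?\<phi> n x) * g x) \<le> 2 * cmod (g x)" for n x
    proof -
      have "\<bar>?\<phi> n x\<bar> \<le> 2"
        using smooth_step_abs_le[of "real n * (x - a)"] smooth_step_abs_le[of "real n * (x - b)"] by linarith
      then show ?thesis unfolding norm_mult norm_of_real by (intro mult_right_mono) auto
    qed
    then show "AE x in ?M. norm (complex_of_real (?\<phi> n x) * g x) \<le> 2 * cmod (g x)" for n
      by simp
    have lim: "(\<lambda>n. smooth_step (real n * (x - c))) \<longlonglongrightarrow> indicator {c<..} x" for x c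
    proof (cases "x \<le> c")
      case True
      then have "real n * (x - c) \<le> 0" for n by (intro mult_nonneg_nonpos) auto
      then show ?thesis using True by simp
    next
      case False
      obtain K :: nat where K: "1 / (x - c) < real K" using reals_Archimedean2 by blast
      have "\<forall>\<^sub>F n in sequentially. smooth_step (real n * (x - c)) = 1"
        using eventually_ge_at_top[of K]
      proof eventually_elim
        case (elim n)
        then have "1 / (x - c) < real n" using K by (meson le_less_trans less_le_trans of_nat_le_iff)
        then show ?case using False by (intro smooth_step_simps) (auto simp: field_simps)
      qed
      then show ?thesis using False by (simp add: tendsto_eventually)
    qed
    have "(\<lambda>n. complex_of_real (?\<phi> n x) * g x) \<longlonglongrightarrow> complex_of_real (indicator {a<..} x - indicator {b<..} x) * g x" for x
      by (intro tendsto_intros lim)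
    moreover have "complex_of_real (indicator {a<..} x - indicator {b<..} x) = indicator {a<..b} x" for x
      using ab by (auto simp: indicator_def)
    ultimately show "AE x in ?M. (\<lambda>n. complex_of_real (?\<phi> n x) * g x) \<longlonglongrightarrow> indicator {a<..b} x * g x"
      by simp
  qed
  have "(\<lambda>n. ?I a n - ?I b n) \<longlonglongrightarrow> - integral\<^sup>L ?M (\<lambda>x. indicator {a<..b} x * g x)"
    using tendsto_minus[OF L2]
  proof (rule Lim_transform_eventually)
    show "\<forall>\<^sub>F n in sequentially. - integral\<^sup>L ?M (\<lambda>x. complex_of_real (?\<phi> n x) * g x) = ?I a n - ?I b n"
      using eventually_ge_at_top[of "Suc N"] by eventually_elim (rule eq[symmetric])
  qed
  with L1 have "f a - f b = - integral\<^sup>L ?M (\<lambda>x. indicator {a<..b} x * g x)"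
    by (rule LIMSEQ_unique)
  also have "integral\<^sup>L ?M (\<lambda>x. indicator {a<..b} x * g x) = (LINT x:{a<..b}|lebesgue. g x)"
    unfolding set_lebesgue_integral_def
    by (subst integral_restrict_space) (use ab in \<open>auto intro!: Bochner_Integration.integral_cong simp: indicator_def\<close>)
  finally show ?thesis by (simp add: algebra_simps)
qed


text \<open>By linearity, this is the uniqueness of the weak derivative almost everywhere. The increments are
  only available for \<open>0 < a < b < l\<close>, hence the exhaustion of \<open>(0, l)\<close> by compact intervals.\<close>

lemma weak_deriv_of_0_AE:
  assumes g: "g \<in> L2_interval l" and w: "has_weak_deriv l (\<lambda>_. 0) g"
  shows "AE x in lebesgue. x \<in> {0..l} \<longrightarrow> g x = 0"
proof -
  have gi: "set_integrable lebesgue {0..l} g"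
    using L2_interval_integrable[OF g] by (simp add: integrable_restrict_space set_integrable_def)
  have inner: "AE x in lebesgue. x \<in> {c..d} \<longrightarrow> g x = 0" if cd: "0 < c" "d < l" for c d
  proof -
    let ?G = "\<lambda>x. indicator {c..d} x *\<^sub>R g x"
    have gi': "set_integrable lebesgue A g" if "A \<in> sets lebesgue" "A \<subseteq> {0..l}" for A
      using set_integrable_subset[OF gi that] .
    have G: "integrable lebesgue ?G"
      using gi'[of "{c..d}"] cd by (auto simp: set_integrable_def)
    have "(LINT x:box a b|lebesgue. ?G x) = 0" for a b
    proof -
      let ?a = "max a c" and ?b = "min b d"
      have mb: "(\<lambda>x. indicator {?a<..?b} x *\<^sub>R g x) \<in> borel_measurable lebesgue"
      proof -
        have "set_integrable lebesgue {?a<..?b} g" using cd by (intro gi') auto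
        then show ?thesis by (auto simp: set_integrable_def dest: borel_measurable_integrable)
      qed
      have "(LINT x:box a b|lebesgue. ?G x) = (LINT x:{?a<..?b}|lebesgue. g x)"
        unfolding set_lebesgue_integral_def
      proof (rule integral_cong_AE)
        show "(\<lambda>x. indicat_real (box a b) x *\<^sub>R ?G x) \<in> borel_measurable lebesgue"
          by (rule borel_measurable_scaleR[OF borel_measurable_indicator borel_measurable_integrable[OF G]]) auto
        have "{c, b} \<in> null_sets lebesgue"
          by (intro null_sets_completionI finite_imp_null_set_lborel) auto
        from AE_not_in[OF this]
        show "AE x in lebesgue. indicat_real (box a b) x *\<^sub>R ?G x = indicat_real {?a<..?b} x *\<^sub>R g x"
          by eventually_elim (auto simp: indicator_def box_real)
      qed (rule mb)
      also have "\<dots> = 0"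
      proof (cases "?a < ?b")
        case True
        have "(0::complex) - 0 = (LINT x:{?a<..?b}|lebesgue. g x)"
          by (rule weak_deriv_increment[OF _ g w]) (use True cd in auto)
        then show ?thesis by simp
      next
        case False
        then have empty: "{?a<..?b} = {}" by auto
        show ?thesis unfolding empty by (simp add: set_lebesgue_integral_def)
      qed
      finally show ?thesis .
    qed
    from AE_eq_0_of_integral_intervals_eq_0[OF G this] show ?thesis
      by eventually_elim (auto simp: indicator_def)
  qed
  have "AE x in lebesgue. \<forall>n::nat. x \<in> {inverse (real (Suc n))..l - inverse (real (Suc n))} \<longrightarrow> g x = 0"
    unfolding AE_all_countable by (intro allI inner) auto
  moreover have "{0, l} \<in> null_sets lebesgue"
    by (intro null_sets_completionI finite_imp_null_set_lborel) auto
  then have "AE x in lebesgue. x \<notin> {0, l}" by (rule AE_not_in)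
  ultimately show ?thesis
  proof eventually_elim
    case (elim x)
    show ?case
    proof
      assume "x \<in> {0..l}"
      with elim have "0 < min x (l - x)" by auto
      then obtain n where "inverse (real (Suc n)) < min x (l - x)" using reals_Archimedean by blast
      then have "x \<in> {inverse (real (Suc n))..l - inverse (real (Suc n))}" by auto
      with elim(1) show "g x = 0" by blast
    qed
  qed
qed

text \<open>Unlike the exact formula, this estimate extends to the end points by mere continuity of \<open>f\<close>.\<close>

lemma weak_deriv_increment_le:
  assumes f: "continuous_on {0..l} f" and g: "g \<in> L2_interval l" and w: "has_weak_deriv l f g"
    and l: "0 < l" and xy: "x \<in> {0..l}" "y \<in> {0..l}"
  shows "cmod (f x - f y) \<le> integral\<^sup>L (lebesgue_on {0..l}) (\<lambda>x. cmod (g x))"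
proof -
  let ?K = "integral\<^sup>L (lebesgue_on {0..l}) (\<lambda>x. cmod (g x))"
  have gi: "set_integrable lebesgue {0..l} g"
    using L2_interval_integrable[OF g] by (simp add: integrable_restrict_space set_integrable_def)
  have K: "?K = (LINT x:{0..l}|lebesgue. cmod (g x))" by (simp add: set_LINT_eq_lebesgue_on)
  have lt: "cmod (f b - f a) \<le> ?K" if "0 < a" "a < b" "b < l" for a b
  proof -
    have "cmod (f b - f a) = cmod (LINT x:{a<..b}|lebesgue. g x)"
      using weak_deriv_increment[OF f g w that] by simp
    also have "\<dots> \<le> (LINT x:{a<..b}|lebesgue. cmod (g x))"
    proof (rule set_integral_norm_bound)
      show "set_integrable lebesgue {a<..b} g"
        by (rule set_integrable_subset[OF gi]) (use that in auto)
    qed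
    also have "\<dots> \<le> ?K" unfolding K set_lebesgue_integral_def
    proof (rule integral_mono)
      have n: "set_integrable lebesgue {0..l} (\<lambda>x. cmod (g x))" by (rule set_integrable_norm[OF gi])
      then show "integrable lebesgue (\<lambda>x. indicat_real {0..l} x *\<^sub>R cmod (g x))"
        by (simp add: set_integrable_def)
      have "set_integrable lebesgue {a<..b} (\<lambda>x. cmod (g x))"
        by (rule set_integrable_subset[OF n]) (use that in auto)
      then show "integrable lebesgue (\<lambda>x. indicat_real {a<..b} x *\<^sub>R cmod (g x))"
        by (simp add: set_integrable_def)
    qed (use that in \<open>auto simp: indicator_def\<close>)
    finally show ?thesis .
  qed
  have inside: "cmod (f x - f y) \<le> ?K" if "x \<in> {0<..<l}" "y \<in> {0<..<l}" for x y
  proof (cases x y rule: linorder_cases)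
    case less
    then show ?thesis using lt[of x y] that by (simp add: norm_minus_commute)
  next
    case equal
    then show ?thesis by simp
  next
    case greater
    then show ?thesis using lt[of y x] that by simp
  qed
  have cl: "closure {0<..<l} = {0..l}" using l by (simp add: closure_greaterThanLessThan)
  have half: "cmod (f x - f y) \<le> ?K" if "x \<in> {0..l}" "y \<in> {0<..<l}" for x y
  proof (rule continuous_le_on_closure[where S = "{0<..<l}" and f = "\<lambda>x. cmod (f x - f y)"])
    show "continuous_on (closure {0<..<l}) (\<lambda>x. cmod (f x - f y))"
      unfolding cl by (intro continuous_intros f)
  qed (use that inside cl in auto)
  show ?thesis
  proof (rule continuous_le_on_closure[where S = "{0<..<l}" and f = "\<lambda>y. cmod (f x - f y)"])
    show "continuous_on (closure {0<..<l}) (\<lambda>y. cmod (f x - f y))"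
      unfolding cl by (intro continuous_intros f)
  qed (use xy half cl in auto)
qed

lemma L2_interval_integral_cmod_le:
  assumes "f \<in> L2_interval l" "0 < l"
  shows "integral\<^sup>L (lebesgue_on {0..l}) (\<lambda>x. cmod (f x))
    \<le> sqrt l * sqrt (integral\<^sup>L (lebesgue_on {0..l}) (\<lambda>x. (cmod (f x))\<^sup>2))"
proof -
  have "(integral\<^sup>L (lebesgue_on {0..l}) (\<lambda>x. cmod (f x)))\<^sup>2
    \<le> integral\<^sup>L (lebesgue_on {0..l}) (\<lambda>x. (cmod (f x))\<^sup>2) * l"
    using L2_interval_Cauchy_Schwarz[OF assms(1) L2_interval_continuous[of l "\<lambda>_. 1"]] assms(2)
    by (simp add: measure_restrict_space)
  from real_sqrt_le_mono[OF this] show ?thesis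
    by (simp add: real_sqrt_mult mult.commute)
qed

text \<open>The embedding of \<open>H\<^sup>1(0, l)\<close> into the bounded functions: average
  \<open>\<bar>f x\<bar> \<le> \<bar>f y\<bar> + \<integral> \<bar>g\<bar>\<close> over \<open>y\<close>.\<close>

lemma H1_interval_sup_bound:
  assumes f: "continuous_on {0..l} f" and g: "g \<in> L2_interval l" and w: "has_weak_deriv l f g"
    and l: "0 < l" and x: "x \<in> {0..l}"
  shows "cmod (f x) \<le> (1 / sqrt l) * sqrt (integral\<^sup>L (lebesgue_on {0..l}) (\<lambda>x. (cmod (f x))\<^sup>2))
     + sqrt l * sqrt (integral\<^sup>L (lebesgue_on {0..l}) (\<lambda>x. (cmod (g x))\<^sup>2))"
    (is "_ \<le> _ * ?F + _ * ?G")
proof -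
  let ?M = "lebesgue_on {0..l}"
  let ?K = "integral\<^sup>L ?M (\<lambda>x. cmod (g x))"
  have fi: "integrable ?M (\<lambda>x. cmod (f x))"
    by (intro continuous_imp_integrable_real continuous_intros f)
  have "l * cmod (f x) = integral\<^sup>L ?M (\<lambda>y. cmod (f x))"
    using l by (simp add: measure_restrict_space)
  also have "\<dots> \<le> integral\<^sup>L ?M (\<lambda>y. cmod (f y) + ?K)"
  proof (rule integral_mono)
    show "integrable ?M (\<lambda>y. cmod (f y) + ?K)"
      using fi integrable_lebesgue_on_const by (rule Bochner_Integration.integrable_add)
    fix y assume "y \<in> space ?M"
    then have "cmod (f x - f y) \<le> ?K" using weak_deriv_increment_le[OF f g w l x] by simp
    then show "cmod (f x) \<le> cmod (f y) + ?K"
      using norm_triangle_sub[of "f x" "f y"] by linarith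
  qed (rule integrable_lebesgue_on_const)
  also have "\<dots> = integral\<^sup>L ?M (\<lambda>y. cmod (f y)) + l * ?K"
    using fi integrable_lebesgue_on_const l by (subst Bochner_Integration.integral_add) (auto simp: measure_restrict_space)
  also have "\<dots> \<le> sqrt l * ?F + l * (sqrt l * ?G)"
    using l by (intro add_mono mult_left_mono L2_interval_integral_cmod_le L2_interval_continuous f g) auto
  also have "\<dots> = l * ((1 / sqrt l) * ?F + sqrt l * ?G)"
  proof -
    have "sqrt l = l * (1 / sqrt l)" using l by (simp add: real_div_sqrt)
    then have "sqrt l * ?F = l * (1 / sqrt l) * ?F" by simp
    then show ?thesis by (simp only: distrib_left mult.assoc)
  qed
  finally show ?thesis using l by simp
qed

lemma weak_deriv_props:
  assumes "f \<in> H1_interval l"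
  shows "weak_deriv l f \<in> L2_interval l" "has_weak_deriv l f (weak_deriv l f)"
proof -
  have "\<exists>g. g \<in> L2_interval l \<and> has_weak_deriv l f g"
    using assms by (auto simp: H1_interval_def)
  from someI_ex[OF this] show "weak_deriv l f \<in> L2_interval l" "has_weak_deriv l f (weak_deriv l f)"
    by (auto simp: weak_deriv_def)
qed

lemma H1_interval_L2: "f \<in> H1_interval l \<Longrightarrow> f \<in> L2_interval l"
  by (simp add: H1_interval_def)

lemma test_function_L2:
  assumes "test_function l \<phi>"
  shows "(\<lambda>x. complex_of_real (\<phi> x)) \<in> L2_interval l" "(\<lambda>x. complex_of_real (deriv \<phi> x)) \<in> L2_interval l"
proof -
  have d: "\<phi> differentiable at x" and "continuous_on UNIV (deriv \<phi>)" for x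
    using assms by (auto simp: test_function_def)
  then have "continuous_on {0..l} (deriv \<phi>)" by (auto intro: continuous_on_subset)
  moreover have "continuous_on {0..l} \<phi>"
    using d by (intro continuous_at_imp_continuous_on ballI differentiable_imp_continuous_within)
  ultimately show "(\<lambda>x. complex_of_real (\<phi> x)) \<in> L2_interval l" "(\<lambda>x. complex_of_real (deriv \<phi> x)) \<in> L2_interval l"
    by (auto intro!: L2_interval_continuous continuous_on_of_real)
qed

lemma has_weak_deriv_lincomb:
  assumes f: "f1 \<in> L2_interval l" "f2 \<in> L2_interval l" and g: "g1 \<in> L2_interval l" "g2 \<in> L2_interval l"
    and w: "has_weak_deriv l f1 g1" "has_weak_deriv l f2 g2"
  shows "has_weak_deriv l (\<lambda>x. f1 x + c * f2 x) (\<lambda>x. g1 x + c * g2 x)"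
  unfolding has_weak_deriv_def set_LINT_eq_lebesgue_on
proof (intro allI impI)
  fix \<phi> assume t: "test_function l \<phi>"
  let ?M = "lebesgue_on {0..l}"
  have eq: "integral\<^sup>L ?M (\<lambda>x. p x * (h1 x + c * h2 x)) = integral\<^sup>L ?M (\<lambda>x. p x * h1 x) + c * integral\<^sup>L ?M (\<lambda>x. p x * h2 x)"
    if "p \<in> L2_interval l" "h1 \<in> L2_interval l" "h2 \<in> L2_interval l" for p h1 h2
  proof -
    have "(\<lambda>x. p x * (h1 x + c * h2 x)) = (\<lambda>x. p x * h1 x + c * (p x * h2 x))"
      by (auto simp: algebra_simps)
    then show ?thesis using L2_interval_mult that by simp
  qed
  have "integral\<^sup>L ?M (\<lambda>x. complex_of_real (deriv \<phi> x) * f1 x) = - integral\<^sup>L ?M (\<lambda>x. complex_of_real (\<phi> x) * g1 x)"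
    "integral\<^sup>L ?M (\<lambda>x. complex_of_real (deriv \<phi> x) * f2 x) = - integral\<^sup>L ?M (\<lambda>x. complex_of_real (\<phi> x) * g2 x)"
    using w t unfolding has_weak_deriv_def set_LINT_eq_lebesgue_on by blast+
  then show "integral\<^sup>L ?M (\<lambda>x. complex_of_real (deriv \<phi> x) * (f1 x + c * f2 x))
      = - integral\<^sup>L ?M (\<lambda>x. complex_of_real (\<phi> x) * (g1 x + c * g2 x))"
    by (simp only: eq[OF test_function_L2(1)[OF t] g] eq[OF test_function_L2(2)[OF t] f]) simp
qed

lemma L2_interval_lincomb:
  assumes "f \<in> L2_interval l" "g \<in> L2_interval l"
  shows "(\<lambda>x. f x + c * g x) \<in> L2_interval l"
  using L2_interval_add[OF assms(1) L2_interval_cmult[OF assms(2)]] .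

lemma H1_interval_lincomb:
  assumes "f1 \<in> H1_interval l" "f2 \<in> H1_interval l"
  shows "(\<lambda>x. f1 x + c * f2 x) \<in> H1_interval l"
proof -
  note w = weak_deriv_props[OF assms(1)] weak_deriv_props[OF assms(2)] assms[THEN H1_interval_L2]
  have "has_weak_deriv l (\<lambda>x. f1 x + c * f2 x) (\<lambda>x. weak_deriv l f1 x + c * weak_deriv l f2 x)"
    using w by (intro has_weak_deriv_lincomb)
  moreover have "(\<lambda>x. weak_deriv l f1 x + c * weak_deriv l f2 x) \<in> L2_interval l" "(\<lambda>x. f1 x + c * f2 x) \<in> L2_interval l"
    using w by (auto intro: L2_interval_lincomb)
  ultimately show ?thesis unfolding H1_interval_def by blast
qed

lemma weak_deriv_unique_AE:
  assumes f: "f \<in> L2_interval l" and g: "g1 \<in> L2_interval l" "g2 \<in> L2_interval l"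
    and w: "has_weak_deriv l f g1" "has_weak_deriv l f g2"
  shows "AE x in lebesgue. x \<in> {0..l} \<longrightarrow> g1 x = g2 x"
proof -
  have "AE x in lebesgue. x \<in> {0..l} \<longrightarrow> g1 x + (-1) * g2 x = 0"
  proof (rule weak_deriv_of_0_AE)
    show "(\<lambda>x. g1 x + (-1) * g2 x) \<in> L2_interval l" using g by (rule L2_interval_lincomb)
    have "has_weak_deriv l (\<lambda>x. f x + (-1) * f x) (\<lambda>x. g1 x + (-1) * g2 x)"
      using assms by (intro has_weak_deriv_lincomb)
    then show "has_weak_deriv l (\<lambda>_. 0) (\<lambda>x. g1 x + (-1) * g2 x)" by simp
  qed
  then show ?thesis by eventually_elim simp
qed

lemma weak_deriv_lincomb_AE:
  assumes "f1 \<in> H1_interval l" "f2 \<in> H1_interval l"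
  shows "AE x in lebesgue. x \<in> {0..l} \<longrightarrow>
     weak_deriv l (\<lambda>x. f1 x + c * f2 x) x = weak_deriv l f1 x + c * weak_deriv l f2 x"
proof (rule weak_deriv_unique_AE)
  note w = weak_deriv_props[OF assms(1)] weak_deriv_props[OF assms(2)] assms[THEN H1_interval_L2]
  note h = H1_interval_lincomb[OF assms, of c]
  show "(\<lambda>x. f1 x + c * f2 x) \<in> L2_interval l" using h by (rule H1_interval_L2)
  show "weak_deriv l (\<lambda>x. f1 x + c * f2 x) \<in> L2_interval l"
    "has_weak_deriv l (\<lambda>x. f1 x + c * f2 x) (weak_deriv l (\<lambda>x. f1 x + c * f2 x))"
    using weak_deriv_props[OF h] by auto
  show "(\<lambda>x. weak_deriv l f1 x + c * weak_deriv l f2 x) \<in> L2_interval l"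
    using w by (intro L2_interval_lincomb)
  show "has_weak_deriv l (\<lambda>x. f1 x + c * f2 x) (\<lambda>x. weak_deriv l f1 x + c * weak_deriv l f2 x)"
    using w by (intro has_weak_deriv_lincomb)
qed

lemma has_weak_deriv_const:
  "has_weak_deriv l (\<lambda>_. c) (\<lambda>_. 0)"
  unfolding has_weak_deriv_def set_LINT_eq_lebesgue_on
proof (intro allI impI)
  fix \<phi> assume t: "test_function l \<phi>"
  have d: "\<phi> differentiable at x" for x using t by (auto simp: test_function_def)
  obtain a b where ab: "0 < a" "b < l" "\<forall>x. x \<notin> {a..b} \<longrightarrow> \<phi> x = 0"
    using t by (auto simp: test_function_def)
  have "integral\<^sup>L (lebesgue_on {0..l}) (\<lambda>x. complex_of_real (deriv \<phi> x) * c) = 0"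
  proof (cases "0 \<le> l")
    case True
    have c: "continuous_on {0..l} (deriv \<phi>)"
      using t by (auto simp: test_function_def intro: continuous_on_subset)
    have "(deriv \<phi> has_integral (\<phi> l - \<phi> 0)) {0..l}"
    proof (rule fundamental_theorem_of_calculus[OF True])
      fix x
      have "(\<phi> has_real_derivative deriv \<phi> x) (at x)"
        using d[of x] by (auto simp: real_differentiable_def DERIV_imp_deriv)
      then show "(\<phi> has_vector_derivative deriv \<phi> x) (at x within {0..l})"
        by (simp add: has_real_derivative_iff_has_vector_derivative has_vector_derivative_at_within)
    qed
    moreover have "\<phi> l = 0" "\<phi> 0 = 0" using ab by auto
    ultimately have "integral {0..l} (deriv \<phi>) = 0" by (simp add: integral_unique)
    then have "integral\<^sup>L (lebesgue_on {0..l}) (deriv \<phi>) = 0"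
      using lebesgue_integral_eq_integral[OF continuous_imp_integrable_real[OF c]] by simp
    then show ?thesis by (simp only: integral_mult_left_zero integral_complex_of_real) simp
  next
    case False
    then have "{0..l} = {}" by simp
    then show ?thesis by (simp add: set_LINT_eq_lebesgue_on[symmetric] set_lebesgue_integral_def)
  qed
  then show "integral\<^sup>L (lebesgue_on {0..l}) (\<lambda>x. complex_of_real (deriv \<phi> x) * c)
     = - integral\<^sup>L (lebesgue_on {0..l}) (\<lambda>x. complex_of_real (\<phi> x) * 0)" by simp
qed

lemma H1_interval_const: "(\<lambda>_. c) \<in> H1_interval l"
  unfolding H1_interval_def
  using has_weak_deriv_const[of l c] L2_interval_continuous[of l "\<lambda>_. 0"] L2_interval_continuous[of l "\<lambda>_. c"] by auto

lemma weak_deriv_const_AE: "AE x in lebesgue. x \<in> {0..l} \<longrightarrow> weak_deriv l (\<lambda>_. c) x = 0"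
  using weak_deriv_unique_AE[OF H1_interval_L2[OF H1_interval_const] weak_deriv_props(1)[OF H1_interval_const]
    L2_interval_continuous[of l "\<lambda>_. 0"] weak_deriv_props(2)[OF H1_interval_const] has_weak_deriv_const] by simp


section \<open>The inner product and \<open>H\<^sup>1\<close> on a metric graph\<close>

lemma AE_lebesgue_on_Icc:
  "(AE x in lebesgue_on {a..b::real}. P x) \<longleftrightarrow> (AE x in lebesgue. x \<in> {a..b} \<longrightarrow> P x)"
  by (subst AE_restrict_space_iff) auto

text \<open>A metric graph with finitely many edges. The space \<open>L2\<close> is the space of families of square-integrable functions on the edges, \<open>ip\<close> its inner product,
  antilinear in the second argument, and \<open>nrm\<close> its seminorm. The operator \<open>D\<close> is linear only up to
  null sets, since it selects a representative of the weak derivative.\<close>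

locale finite_metric_graph =
  fixes G :: "('v, 'e) pre_digraph" and len :: "'e \<Rightarrow> real"
  assumes finite_arcs: "finite (arcs G)"
    and len_pos: "\<And>e. e \<in> arcs G \<Longrightarrow> 0 < len e"
begin

abbreviation ip :: "'e graph_fun \<Rightarrow> 'e graph_fun \<Rightarrow> complex" where
  "ip \<equiv> L2_inner G len"

abbreviation nrm :: "'e graph_fun \<Rightarrow> real" where
  "nrm \<equiv> Lp_norm 2 G len"

abbreviation D :: "'e graph_fun \<Rightarrow> 'e graph_fun" where
  "D \<equiv> graph_deriv len"

abbreviation H1 :: "'e graph_fun set" where
  "H1 \<equiv> H1_graph G len"

definition L2 :: "'e graph_fun set" where
  "L2 = {f. \<forall>e\<in>arcs G. f e \<in> L2_interval (len e)}"

lemma graph_integral_eq: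
  fixes f :: "'e \<Rightarrow> real \<Rightarrow> 'b::{banach, second_countable_topology}"
  shows "graph_integral G len f = (\<Sum>e\<in>arcs G. integral\<^sup>L (lebesgue_on {0..len e}) (f e))"
  by (simp add: graph_integral_def set_LINT_eq_lebesgue_on)

lemma graph_integral_cong:
  fixes f :: "'e \<Rightarrow> real \<Rightarrow> 'b::{banach, second_countable_topology}"
  assumes "\<And>e x. e \<in> arcs G \<Longrightarrow> 0 \<le> x \<Longrightarrow> x \<le> len e \<Longrightarrow> f e x = g e x"
  shows "graph_integral G len f = graph_integral G len g"
  unfolding graph_integral_eq
  by (intro sum.cong Bochner_Integration.integral_cong) (auto simp: assms)

lemma ip_eq: "ip f g = (\<Sum>e\<in>arcs G. integral\<^sup>L (lebesgue_on {0..len e}) (\<lambda>x. f e x * cnj (g e x)))"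
  by (simp add: L2_inner_def graph_integral_eq)

lemma nrm_sq: "(nrm f)\<^sup>2 = (\<Sum>e\<in>arcs G. integral\<^sup>L (lebesgue_on {0..len e}) (\<lambda>x. (cmod (f e x))\<^sup>2))"
proof -
  let ?S = "\<Sum>e\<in>arcs G. integral\<^sup>L (lebesgue_on {0..len e}) (\<lambda>x. (cmod (f e x))\<^sup>2)"
  have "cmod z powr 2 = (cmod z)\<^sup>2" for z
    by (simp add: powr_numeral)
  then have "nrm f = ?S powr (1/2)"
    unfolding Lp_norm_def graph_integral_eq by simp
  moreover have "0 \<le> ?S" by (intro sum_nonneg) simp
  ultimately show ?thesis by (simp add: powr_half_sqrt)
qed

lemma nrm_nonneg: "0 \<le> nrm f"
  by (simp add: Lp_norm_def)

lemma nrm_eq: "nrm f = sqrt (\<Sum>e\<in>arcs G. integral\<^sup>L (lebesgue_on {0..len e}) (\<lambda>x. (cmod (f e x))\<^sup>2))"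
  using nrm_sq[of f] nrm_nonneg[of f] by (metis real_sqrt_abs2 real_sqrt_pow2_iff real_sqrt_unique)

lemma ip_self: "ip f f = complex_of_real ((nrm f)\<^sup>2)"
proof -
  have "f e x * cnj (f e x) = complex_of_real ((cmod (f e x))\<^sup>2)" for e x
    by (rule complex_norm_square[symmetric])
  then show ?thesis unfolding ip_eq nrm_sq
    by (simp only: integral_complex_of_real of_real_sum)
qed

lemma L2_lincomb: "f \<in> L2 \<Longrightarrow> g \<in> L2 \<Longrightarrow> (\<lambda>e x. f e x + c * g e x) \<in> L2"
  by (auto simp: L2_def intro: L2_interval_lincomb)

lemma L2_diff: "f \<in> L2 \<Longrightarrow> g \<in> L2 \<Longrightarrow> (\<lambda>e x. f e x - g e x) \<in> L2"
  by (auto simp: L2_def intro: L2_interval_diff)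

lemma ip_commute: "ip g f = cnj (ip f g)"
proof -
  have "(\<lambda>x. g e x * cnj (f e x)) = (\<lambda>x. cnj (f e x * cnj (g e x)))" for e
    by (auto simp: mult.commute)
  then show ?thesis unfolding ip_eq cnj_sum by (simp only: Bochner_Integration.integral_cnj)
qed

lemma ip_lincomb_left:
  assumes "f \<in> L2" "g \<in> L2" "h \<in> L2"
  shows "ip (\<lambda>e x. f e x + c * g e x) h = ip f h + c * ip g h"
proof -
  have "integral\<^sup>L (lebesgue_on {0..len e}) (\<lambda>x. (f e x + c * g e x) * cnj (h e x))
     = integral\<^sup>L (lebesgue_on {0..len e}) (\<lambda>x. f e x * cnj (h e x))
      + c * integral\<^sup>L (lebesgue_on {0..len e}) (\<lambda>x. g e x * cnj (h e x))" if "e \<in> arcs G" for e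
  proof -
    have i: "integrable (lebesgue_on {0..len e}) (\<lambda>x. f e x * cnj (h e x))"
      "integrable (lebesgue_on {0..len e}) (\<lambda>x. g e x * cnj (h e x))"
      using assms that by (auto simp: L2_def intro!: L2_interval_mult_cnj)
    have "(\<lambda>x. (f e x + c * g e x) * cnj (h e x)) = (\<lambda>x. f e x * cnj (h e x) + c * (g e x * cnj (h e x)))"
      by (auto simp: algebra_simps)
    then show ?thesis using i by simp
  qed
  then show ?thesis unfolding ip_eq by (simp add: sum.distrib sum_distrib_left)
qed

lemma ip_lincomb_right:
  assumes "f \<in> L2" "g \<in> L2" "h \<in> L2"
  shows "ip h (\<lambda>e x. f e x + c * g e x) = ip h f + cnj c * ip h g"
  using ip_lincomb_left[OF assms, of c] ip_commute by (metis complex_cnj_add complex_cnj_mult)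

lemma ip_diff_left:
  assumes "f \<in> L2" "g \<in> L2" "h \<in> L2"
  shows "ip (\<lambda>e x. f e x - g e x) h = ip f h - ip g h"
  using ip_lincomb_left[OF assms, of "-1"] by simp

lemma ip_diff_right:
  assumes "f \<in> L2" "g \<in> L2" "h \<in> L2"
  shows "ip h (\<lambda>e x. f e x - g e x) = ip h f - ip h g"
  using ip_lincomb_right[OF assms, of "-1"] by simp

lemma ip_cong_AE_left:
  assumes "f \<in> L2" "g \<in> L2" "h \<in> L2"
    and "\<And>e. e \<in> arcs G \<Longrightarrow> AE x in lebesgue. x \<in> {0..len e} \<longrightarrow> f e x = g e x"
  shows "ip f h = ip g h"
  unfolding ip_eq
proof (rule sum.cong[OF refl], rule integral_cong_AE)
  fix e assume e: "e \<in> arcs G"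
  show "(\<lambda>x. f e x * cnj (h e x)) \<in> borel_measurable (lebesgue_on {0..len e})"
    "(\<lambda>x. g e x * cnj (h e x)) \<in> borel_measurable (lebesgue_on {0..len e})"
    using assms e by (auto simp: L2_def intro!: borel_measurable_integrable L2_interval_mult_cnj)
  show "AE x in lebesgue_on {0..len e}. f e x * cnj (h e x) = g e x * cnj (h e x)"
    using assms(4)[OF e] unfolding AE_lebesgue_on_Icc by eventually_elim auto
qed

text \<open>The Cauchy-Schwarz inequality on each edge, followed by the one for finite sums.\<close>

lemma ip_Cauchy_Schwarz:
  assumes "f \<in> L2" "g \<in> L2"
  shows "cmod (ip f g) \<le> nrm f * nrm g"
proof -
  let ?F = "\<lambda>e. integral\<^sup>L (lebesgue_on {0..len e}) (\<lambda>x. (cmod (f e x))\<^sup>2)"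
  let ?G = "\<lambda>e. integral\<^sup>L (lebesgue_on {0..len e}) (\<lambda>x. (cmod (g e x))\<^sup>2)"
  have "cmod (ip f g) \<le> (\<Sum>e\<in>arcs G. sqrt (?F e) * sqrt (?G e))"
    unfolding ip_eq
  proof (rule order_trans[OF norm_sum sum_mono])
    fix e assume e: "e \<in> arcs G"
    let ?P = "integral\<^sup>L (lebesgue_on {0..len e}) (\<lambda>x. cmod (f e x) * cmod (g e x))"
    have "cmod (integral\<^sup>L (lebesgue_on {0..len e}) (\<lambda>x. f e x * cnj (g e x)))
       \<le> integral\<^sup>L (lebesgue_on {0..len e}) (\<lambda>x. cmod (f e x * cnj (g e x)))"
      by (rule integral_norm_bound)
    also have "\<dots> = ?P" by (simp add: norm_mult)
    also have "?P \<le> sqrt (?F e * ?G e)"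
      by (rule real_le_rsqrt, rule L2_interval_Cauchy_Schwarz) (use assms e in \<open>auto simp: L2_def\<close>)
    finally show "cmod (integral\<^sup>L (lebesgue_on {0..len e}) (\<lambda>x. f e x * cnj (g e x))) \<le> sqrt (?F e) * sqrt (?G e)"
      by (simp add: real_sqrt_mult)
  qed
  also have "\<dots> \<le> nrm f * nrm g"
  proof (rule power2_le_imp_le)
    show "(\<Sum>e\<in>arcs G. sqrt (?F e) * sqrt (?G e))\<^sup>2 \<le> (nrm f * nrm g)\<^sup>2"
      using Cauchy_Schwarz_ineq_sum[of "\<lambda>e. sqrt (?F e)" "\<lambda>e. sqrt (?G e)" "arcs G"]
      by (simp add: power_mult_distrib nrm_sq)
    show "0 \<le> nrm f * nrm g" by (intro mult_nonneg_nonneg nrm_nonneg)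
  qed
  finally show ?thesis .
qed

lemma nrm_lincomb_sq:
  assumes "f \<in> L2" "g \<in> L2"
  shows "(nrm (\<lambda>e x. f e x + c * g e x))\<^sup>2 = (nrm f)\<^sup>2 + 2 * Re (cnj c * ip f g) + (cmod c)\<^sup>2 * (nrm g)\<^sup>2"
proof -
  let ?h = "\<lambda>e x. f e x + c * g e x"
  have h: "?h \<in> L2" using assms by (rule L2_lincomb)
  have "ip ?h ?h = ip f ?h + c * ip g ?h" using assms h by (intro ip_lincomb_left)
  also have "\<dots> = ip f f + cnj c * ip f g + c * (ip g f + cnj c * ip g g)"
    using assms by (simp add: ip_lincomb_right)
  also have "\<dots> = ip f f + (cnj c * ip f g + cnj (cnj c * ip f g)) + (c * cnj c) * ip g g"
    by (simp add: ip_commute[of g f] algebra_simps)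
  finally have "ip ?h ?h = complex_of_real ((nrm f)\<^sup>2 + 2 * Re (cnj c * ip f g) + (cmod c)\<^sup>2 * (nrm g)\<^sup>2)"
    unfolding complex_add_cnj ip_self complex_norm_square[symmetric] by simp
  then show ?thesis unfolding ip_self of_real_eq_iff .
qed

lemma nrm_lincomb_le:
  assumes "f \<in> L2" "g \<in> L2"
  shows "nrm (\<lambda>e x. f e x + c * g e x) \<le> nrm f + cmod c * nrm g"
proof (rule power2_le_imp_le)
  have "Re (cnj c * ip f g) \<le> cmod (cnj c * ip f g)" by (rule complex_Re_le_cmod)
  also have "\<dots> \<le> cmod c * (nrm f * nrm g)"
    unfolding norm_mult complex_mod_cnj by (intro mult_left_mono ip_Cauchy_Schwarz assms) auto
  finally show "(nrm (\<lambda>e x. f e x + c * g e x))\<^sup>2 \<le> (nrm f + cmod c * nrm g)\<^sup>2"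
    unfolding nrm_lincomb_sq[OF assms] by (simp add: power2_sum power_mult_distrib mult.commute mult.left_commute)
qed (intro add_nonneg_nonneg mult_nonneg_nonneg nrm_nonneg norm_ge_zero)

lemma nrm_diff_le:
  assumes "f \<in> L2" "g \<in> L2"
  shows "nrm (\<lambda>e x. f e x - g e x) \<le> nrm f + nrm g"
  using nrm_lincomb_le[OF assms, of "-1"] by simp

lemma nrm_cong_AE:
  assumes "f \<in> L2" "g \<in> L2"
    and "\<And>e. e \<in> arcs G \<Longrightarrow> AE x in lebesgue. x \<in> {0..len e} \<longrightarrow> f e x = g e x"
  shows "nrm f = nrm g"
proof -
  have "ip f f = ip g f" using assms by (intro ip_cong_AE_left)
  also have "\<dots> = cnj (ip f g)" by (rule ip_commute)
  also have "ip f g = ip g g" using assms by (intro ip_cong_AE_left)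
  finally have "complex_of_real ((nrm f)\<^sup>2) = complex_of_real ((nrm g)\<^sup>2)" by (simp only: ip_self complex_cnj_complex_of_real)
  then have "(nrm f)\<^sup>2 = (nrm g)\<^sup>2" unfolding of_real_eq_iff .
  then show ?thesis using nrm_nonneg by (simp add: power2_eq_iff_nonneg)
qed

lemma H1_interval: "u \<in> H1 \<Longrightarrow> e \<in> arcs G \<Longrightarrow> u e \<in> H1_interval (len e)"
  and H1_continuous: "u \<in> H1 \<Longrightarrow> e \<in> arcs G \<Longrightarrow> continuous_on {0..len e} (u e)"
  by (auto simp: H1_graph_def continuous_on_graph_def)

lemma H1_L2: "u \<in> H1 \<Longrightarrow> u \<in> L2"
  by (auto simp: L2_def dest: H1_interval H1_interval_L2)

lemma D_L2: "u \<in> H1 \<Longrightarrow> D u \<in> L2"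
  by (auto simp: L2_def graph_deriv_def dest: H1_interval weak_deriv_props(1))

lemma H1_lincomb:
  assumes "u \<in> H1" "w \<in> H1"
  shows "(\<lambda>e x. u e x + c * w e x) \<in> H1"
  unfolding H1_graph_def continuous_on_graph_def mem_Collect_eq
proof (intro conjI ballI)
  fix e assume "e \<in> arcs G"
  then show "(\<lambda>x. u e x + c * w e x) \<in> H1_interval (len e)" "continuous_on {0..len e} (\<lambda>x. u e x + c * w e x)"
    using assms by (auto intro!: H1_interval_lincomb continuous_intros dest: H1_interval H1_continuous)
next
  obtain p q where "\<forall>e\<in>arcs G. u e 0 = p (tail G e) \<and> u e (len e) = p (head G e)"
    "\<forall>e\<in>arcs G. w e 0 = q (tail G e) \<and> w e (len e) = q (head G e)"
    using assms unfolding H1_graph_def continuous_on_graph_def by blast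
  then show "\<exists>wa. \<forall>e\<in>arcs G. u e 0 + c * w e 0 = wa (tail G e) \<and> u e (len e) + c * w e (len e) = wa (head G e)"
    by (intro exI[of _ "\<lambda>v. p v + c * q v"]) auto
qed

lemma H1_diff: "u \<in> H1 \<Longrightarrow> w \<in> H1 \<Longrightarrow> (\<lambda>e x. u e x - w e x) \<in> H1"
  using H1_lincomb[of u w "-1"] by simp

lemma H1_const: "(\<lambda>e x. c) \<in> H1"
  by (auto simp: H1_graph_def continuous_on_graph_def H1_interval_const)

lemma D_lincomb_AE:
  assumes "u \<in> H1" "w \<in> H1" "e \<in> arcs G"
  shows "AE x in lebesgue. x \<in> {0..len e} \<longrightarrow> D (\<lambda>e x. u e x + c * w e x) e x = D u e x + c * D w e x"
  unfolding graph_deriv_def by (intro weak_deriv_lincomb_AE H1_interval assms)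

lemma ip_D_lincomb_left:
  assumes "u \<in> H1" "w \<in> H1" "h \<in> L2"
  shows "ip (D (\<lambda>e x. u e x + c * w e x)) h = ip (D u) h + c * ip (D w) h"
proof -
  have "ip (D (\<lambda>e x. u e x + c * w e x)) h = ip (\<lambda>e x. D u e x + c * D w e x) h"
    using assms by (intro ip_cong_AE_left D_L2 L2_lincomb H1_lincomb D_lincomb_AE)
  then show ?thesis using assms by (simp add: ip_lincomb_left D_L2)
qed

lemma ip_D_diff_left:
  assumes "u \<in> H1" "w \<in> H1" "h \<in> L2"
  shows "ip (D (\<lambda>e x. u e x - w e x)) h = ip (D u) h - ip (D w) h"
  using ip_D_lincomb_left[OF assms, of "-1"] by simp

lemma ip_D_diff_right:
  assumes "u \<in> H1" "w \<in> H1" "h \<in> L2"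
  shows "ip h (D (\<lambda>e x. u e x - w e x)) = ip h (D u) - ip h (D w)"
  using ip_D_diff_left[OF assms] by (metis ip_commute complex_cnj_diff)

lemma nrm_D_lincomb:
  assumes "u \<in> H1" "w \<in> H1"
  shows "nrm (D (\<lambda>e x. u e x + c * w e x)) = nrm (\<lambda>e x. D u e x + c * D w e x)"
  using assms by (intro nrm_cong_AE D_L2 L2_lincomb H1_lincomb D_lincomb_AE)

lemma nrm_D_const: "nrm (D (\<lambda>e x. c)) = 0"
proof -
  have "nrm (D (\<lambda>e x. c)) = nrm (\<lambda>e x. 0)"
    using weak_deriv_const_AE
    by (intro nrm_cong_AE D_L2 H1_const H1_L2) (simp add: graph_deriv_def)
  then show ?thesis by (simp add: nrm_eq)
qed

lemma nrm_D_diff_le: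
  assumes "u \<in> H1" "w \<in> H1"
  shows "nrm (D u) \<le> nrm (D w) + nrm (D (\<lambda>e x. u e x - w e x))"
proof -
  have d: "(\<lambda>e x. u e x - w e x) \<in> H1" using assms by (rule H1_diff)
  have "nrm (D u) = nrm (D (\<lambda>e x. w e x + 1 * (u e x - w e x)))" by simp
  also have "\<dots> = nrm (\<lambda>e x. D w e x + 1 * D (\<lambda>e x. u e x - w e x) e x)"
    using assms d by (intro nrm_D_lincomb)
  also have "\<dots> \<le> nrm (D w) + cmod 1 * nrm (D (\<lambda>e x. u e x - w e x))"
    using assms d by (intro nrm_lincomb_le D_L2)
  finally show ?thesis by simp
qed

text \<open>A bound for the norm of the embedding of \<open>H1\<close> into the bounded functions, see \<open>H1_sup_bound\<close>. It dominates the
  constants of all edges; the summand \<open>1\<close> keeps it positive.\<close>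

definition sup_const :: real where
  "sup_const = 1 + (\<Sum>e\<in>arcs G. 1 / sqrt (len e) + sqrt (len e))"

lemma sup_const_ge_1: "1 \<le> sup_const"
  unfolding sup_const_def using len_pos by (simp add: sum_nonneg less_imp_le)

lemma H1_sup_bound:
  assumes u: "u \<in> H1" and e: "e \<in> arcs G" and x: "x \<in> {0..len e}"
  shows "cmod (u e x) \<le> sup_const * (nrm (D u) + nrm u)"
proof -
  let ?a = "1 / sqrt (len e)" and ?b = "sqrt (len e)"
  have edge: "sqrt (integral\<^sup>L (lebesgue_on {0..len e}) (\<lambda>x. (cmod (f e x))\<^sup>2)) \<le> nrm f" for f
    unfolding nrm_eq
    by (intro real_sqrt_le_mono member_le_sum[of e "arcs G" "\<lambda>e. integral\<^sup>L (lebesgue_on {0..len e}) (\<lambda>x. (cmod (f e x))\<^sup>2)"])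
      (auto simp: e finite_arcs)
  have ab: "0 \<le> ?a" "0 \<le> ?b" using len_pos[OF e] by auto
  have "?a + ?b \<le> (\<Sum>e\<in>arcs G. 1 / sqrt (len e) + sqrt (len e))"
    using len_pos by (intro member_le_sum[of e "arcs G" "\<lambda>e. 1 / sqrt (len e) + sqrt (len e)"])
      (auto simp: e finite_arcs less_imp_le intro!: add_nonneg_nonneg)
  then have "?a + ?b \<le> sup_const" by (simp add: sup_const_def)
  with ab have S: "?a \<le> sup_const" "?b \<le> sup_const" by linarith+
  have "cmod (u e x) \<le> ?a * nrm u + ?b * nrm (D u)"
    using H1_interval_sup_bound[OF H1_continuous[OF u e] weak_deriv_props[OF H1_interval[OF u e]] len_pos[OF e] x]
      mult_left_mono[OF edge[of u] ab(1)] mult_left_mono[OF edge[of "D u"] ab(2)]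
    by (simp add: graph_deriv_def)
  also have "\<dots> \<le> sup_const * nrm u + sup_const * nrm (D u)"
    by (intro add_mono mult_right_mono S nrm_nonneg)
  finally show ?thesis by (simp add: algebra_simps)
qed

end

section \<open>Conservation of mass and energy\<close>

lemma vector_derivative_bound:
  fixes f :: "real \<Rightarrow> 'a::real_normed_vector"
  assumes "convex S" and f: "\<And>x. x \<in> S \<Longrightarrow> (f has_vector_derivative f' x) (at x within S)"
    and B: "\<And>x. x \<in> S \<Longrightarrow> norm (f' x) \<le> B" and "x \<in> S" "y \<in> S"
  shows "norm (f x - f y) \<le> B * \<bar>x - y\<bar>"
  unfolding real_norm_def[symmetric]
proof (rule differentiable_bound[OF assms(1)])
  show "(f has_derivative (\<lambda>h. h *\<^sub>R f' x)) (at x within S)" if "x \<in> S" for x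
    using f[OF that] by (simp add: has_vector_derivative_def)
  show "onorm (\<lambda>h. h *\<^sub>R f' x) \<le> B" if "x \<in> S" for x
    using order_trans[OF norm_ge_zero B[OF that]] B[OF that]
    by (intro onorm_bound) (auto intro!: mult_left_mono simp: mult.commute[of B])
qed fact+

text \<open>The next two lemmas compare the integrand of \<open>N(s, t)\<close> with the increment of \<open>2/3 \<bar>v\<bar>\<^sup>6\<close>: with
  \<open>a = \<bar>w\<bar>\<^sup>2\<close> and \<open>b = \<bar>z\<bar>\<^sup>2\<close>, the real part of \<open>w cnj z\<close> is \<open>(a + b - \<bar>w - z\<bar>\<^sup>2) / 2\<close>, and
  \<open>(a\<^sup>2 - b\<^sup>2) (a + b) / 2 = 2/3 (a\<^sup>3 - b\<^sup>3) - (a - b)\<^sup>3 / 6\<close>. The difference is thus of second order.\<close>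

lemma quintic_identity:
  fixes w z :: complex
  shows "Re (complex_of_real (cmod w ^ 4 - cmod z ^ 4) * w * cnj z) - (2/3) * (cmod w ^ 6 - cmod z ^ 6)
     = - (((cmod w)\<^sup>2 - (cmod z)\<^sup>2) ^ 3) / 6 - (cmod w ^ 4 - cmod z ^ 4) * (cmod (w - z))\<^sup>2 / 2"
proof -
  define a b where "a = (cmod w)\<^sup>2" and "b = (cmod z)\<^sup>2"
  have 4: "cmod w ^ 4 = a\<^sup>2" "cmod z ^ 4 = b\<^sup>2" and 6: "cmod w ^ 6 = a ^ 3" "cmod z ^ 6 = b ^ 3"
    by (simp_all add: a_def b_def flip: power_mult)
  have d: "(cmod (w - z))\<^sup>2 = a + b - 2 * Re (w * cnj z)"
    unfolding a_def b_def cmod_power2 by (simp add: power2_eq_square algebra_simps)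
  have "Re (complex_of_real (a\<^sup>2 - b\<^sup>2) * w * cnj z) = (a\<^sup>2 - b\<^sup>2) * Re (w * cnj z)"
    by (simp add: mult.assoc algebra_simps)
  then show ?thesis
    unfolding 4 6 d unfolding a_def[symmetric] b_def[symmetric]
    by (simp add: power2_eq_square power3_eq_cube field_simps)
qed

lemma quintic_estimate:
  fixes w z :: complex
  assumes "cmod w \<le> B" "cmod z \<le> B"
  shows "\<bar>Re (complex_of_real (cmod w ^ 4 - cmod z ^ 4) * w * cnj z) - (2/3) * (cmod w ^ 6 - cmod z ^ 6)\<bar>
     \<le> 2 * B ^ 4 * (cmod (w - z))\<^sup>2"
proof -
  have B: "0 \<le> B" using assms(1) norm_ge_zero order_trans by blast
  define a b where "a = (cmod w)\<^sup>2" and "b = (cmod z)\<^sup>2"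
  have ab: "0 \<le> a" "a \<le> B\<^sup>2" "0 \<le> b" "b \<le> B\<^sup>2"
    using assms by (auto simp: a_def b_def intro: power_mono)
  have "\<bar>a - b\<bar> = \<bar>cmod w - cmod z\<bar> * (cmod w + cmod z)"
    unfolding a_def b_def by (simp add: power2_eq_square square_diff_square_factored abs_mult mult.commute)
  also have "\<dots> \<le> cmod (w - z) * (2 * B)"
    using assms norm_triangle_ineq3[of w z] by (intro mult_mono) auto
  finally have d1: "\<bar>a - b\<bar> \<le> 2 * B * cmod (w - z)" by (simp add: mult_ac)
  have d2: "\<bar>a - b\<bar> \<le> B\<^sup>2" using ab by linarith
  have "(a - b)\<^sup>2 \<le> (2 * B * cmod (w - z))\<^sup>2"
    using d1 by (metis abs_ge_zero power2_abs power_mono)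
  then have "\<bar>a - b\<bar> * (a - b)\<^sup>2 \<le> B\<^sup>2 * (2 * B * cmod (w - z))\<^sup>2"
    using d2 by (intro mult_mono) auto
  moreover have "\<bar>(a - b) ^ 3\<bar> = \<bar>a - b\<bar> * (a - b)\<^sup>2"
    by (simp add: power3_eq_cube power2_eq_square abs_mult mult.assoc)
  ultimately have t1: "\<bar>(a - b) ^ 3\<bar> \<le> 4 * (B ^ 4 * (cmod (w - z))\<^sup>2)"
    by (simp add: power_mult_distrib power4_eq_xxxx power2_eq_square mult_ac)
  have a4: "cmod w ^ 4 \<le> B ^ 4" "cmod z ^ 4 \<le> B ^ 4" using assms by (auto intro: power_mono)
  then have "\<bar>cmod w ^ 4 - cmod z ^ 4\<bar> \<le> B ^ 4"
    using zero_le_power[OF norm_ge_zero, of w 4] zero_le_power[OF norm_ge_zero, of z 4] by linarith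
  then have t2: "\<bar>(cmod w ^ 4 - cmod z ^ 4) * (cmod (w - z))\<^sup>2\<bar> \<le> B ^ 4 * (cmod (w - z))\<^sup>2"
    unfolding abs_mult by (intro mult_mono) auto
  have "0 \<le> B ^ 4 * (cmod (w - z))\<^sup>2" using B by simp
  with t1 t2 show ?thesis
    unfolding quintic_identity a_def[symmetric] b_def[symmetric] by linarith
qed

text \<open>A limit within \<open>S\<close> that agrees with the value, as a limit within a product; the points of the
  fibre over \<open>a\<close> are the reason why the value is needed.\<close>

lemma tendsto_fst_within:
  fixes f :: "'a::metric_space \<Rightarrow> 'c::metric_space" and b :: "'b::metric_space"
  assumes "(f \<longlongrightarrow> f a) (at a within S)"
  shows "((\<lambda>p. f (fst p)) \<longlongrightarrow> f a) (at (a, b) within S \<times> S')"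
proof (rule tendstoI)
  fix \<epsilon> :: real assume e: "0 < \<epsilon>"
  from tendstoD[OF assms e] obtain d where d: "d > 0" "\<And>x. x \<in> S \<Longrightarrow> x \<noteq> a \<Longrightarrow> dist x a < d \<Longrightarrow> dist (f x) (f a) < \<epsilon>"
    by (auto simp: eventually_at)
  have "dist (f (fst p)) (f a) < \<epsilon>" if "p \<in> S \<times> S'" "dist p (a, b) < d" for p
    using d(2)[of "fst p"] that e dist_fst_le[of p "(a, b)"] by (cases "fst p = a") auto
  then show "\<forall>\<^sub>F p in at (a, b) within S \<times> S'. dist (f (fst p)) (f a) < \<epsilon>"
    unfolding eventually_at using d(1) by blast
qed

lemma tendsto_snd_within:
  fixes f :: "'a::metric_space \<Rightarrow> 'c::metric_space" and b :: "'b::metric_space"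
  assumes "(f \<longlongrightarrow> f a) (at a within S)"
  shows "((\<lambda>p. f (snd p)) \<longlongrightarrow> f a) (at (b, a) within S' \<times> S)"
proof (rule tendstoI)
  fix \<epsilon> :: real assume e: "0 < \<epsilon>"
  from tendstoD[OF assms e] obtain d where d: "d > 0" "\<And>x. x \<in> S \<Longrightarrow> x \<noteq> a \<Longrightarrow> dist x a < d \<Longrightarrow> dist (f x) (f a) < \<epsilon>"
    by (auto simp: eventually_at)
  have "dist (f (snd p)) (f a) < \<epsilon>" if "p \<in> S' \<times> S" "dist p (b, a) < d" for p
    using d(2)[of "snd p"] that e dist_snd_le[of p "(b, a)"] by (cases "snd p = a") auto
  then show "\<forall>\<^sub>F p in at (b, a) within S' \<times> S. dist (f (snd p)) (f a) < \<epsilon>"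
    unfolding eventually_at using d(1) by blast
qed

text \<open>A weak solution \<open>v\<close> on the time domain \<open>J = [0, T)\<close>. In the definitions, \<open>M\<close> and \<open>A\<close> are the
  correlations of \<open>v\<close> and of its derivative in \<open>L2\<close> at two times, \<open>P s t\<close> is the right-hand side of the
  equation at time \<open>s\<close> tested with \<open>v t\<close>, and \<open>S6\<close> is \<open>\<parallel>v t\<parallel>\<^sub>6\<^sup>6\<close>, so that
  \<open>2 E(v t) = \<parallel>D (v t)\<parallel>\<^sup>2 - S6 t / 3\<close>.\<close>

locale nls_flow = finite_metric_graph G len for G :: "('v, 'e) pre_digraph" and len +
  fixes T :: ereal and v :: "real \<Rightarrow> 'e graph_fun"
  assumes solution: "nls_solution G len T v"
begin

definition J :: "real set" where "J = {t. 0 \<le> t \<and> ereal t < T}"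

definition M :: "real \<Rightarrow> real \<Rightarrow> complex" where "M s t = ip (v s) (v t)"

definition A :: "real \<Rightarrow> real \<Rightarrow> complex" where "A s t = ip (D (v s)) (D (v t))"

definition P :: "real \<Rightarrow> real \<Rightarrow> complex" where
  "P s t = A s t - ip (\<lambda>e x. complex_of_real (cmod (v s e x) ^ 4) * v s e x) (v t)"

definition S6 :: "real \<Rightarrow> real" where "S6 t = graph_integral G len (\<lambda>e x. cmod (v t e x) ^ 6)"

lemma v_H1: "t \<in> J \<Longrightarrow> v t \<in> H1"
  using solution by (auto simp: nls_solution_def J_def Let_def)

lemma v_L2: "t \<in> J \<Longrightarrow> v t \<in> L2" and Dv_L2: "t \<in> J \<Longrightarrow> D (v t) \<in> L2"
  using v_H1 H1_L2 D_L2 by auto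

lemma J_interval: "0 \<le> s \<Longrightarrow> s \<le> t \<Longrightarrow> t \<in> J \<Longrightarrow> s \<in> J"
  by (auto simp: J_def intro: le_less_trans[of "ereal s" "ereal t"])

lemma zero_in_J: "0 \<in> J"
  using solution by (auto simp: J_def nls_solution_def Let_def zero_ereal_def)

lemma v_cont: "t \<in> J \<Longrightarrow> ((\<lambda>s. H1_norm G len (\<lambda>e x. v s e x - v t e x)) \<longlongrightarrow> 0) (at t within J)"
  using solution unfolding nls_solution_def J_def Let_def by auto

lemma H1_norm_self: "H1_norm G len (\<lambda>e x. v t e x - v t e x) = 0"
  using nrm_D_const[of 0] by (simp add: H1_norm_def nrm_eq[of "\<lambda>e x. 0"])

lemma Dv_cont: "t \<in> J \<Longrightarrow> ((\<lambda>s. nrm (D (\<lambda>e x. v s e x - v t e x))) \<longlongrightarrow> 0) (at t within J)"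
  by (rule tendsto_sandwich[OF _ _ tendsto_const v_cont]) (auto simp: H1_norm_def nrm_nonneg)

lemma v_jointly_continuous:
  assumes e: "e \<in> arcs G"
  shows "continuous_on (J \<times> {0..len e}) (\<lambda>(t, x). v t e x)"
  unfolding continuous_on_def
proof (rule ballI)
  fix p assume p: "p \<in> J \<times> {0..len e}"
  obtain t0 x0 where p0: "p = (t0, x0)" "t0 \<in> J" "x0 \<in> {0..len e}" using p by auto
  let ?F = "at (t0, x0) within J \<times> {0..len e}"
  let ?n = "\<lambda>s. H1_norm G len (\<lambda>e x. v s e x - v t0 e x)"
  have "(?n \<longlongrightarrow> ?n t0) (at t0 within J)"
    using v_cont[OF p0(2)] unfolding H1_norm_self .
  from tendsto_fst_within[OF this] have 1: "((\<lambda>p. ?n (fst p)) \<longlongrightarrow> 0) ?F"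
    unfolding H1_norm_self .
  have "(v t0 e \<longlongrightarrow> v t0 e x0) (at x0 within {0..len e})"
    using H1_continuous[OF v_H1[OF p0(2)] e] p0(3) by (simp add: continuous_on_def)
  from tendsto_snd_within[OF this] have 2: "((\<lambda>p. v t0 e (snd p)) \<longlongrightarrow> v t0 e x0) ?F" .
  have "((\<lambda>p. v (fst p) e (snd p) - v t0 e (snd p)) \<longlongrightarrow> 0) ?F"
  proof (rule Lim_null_comparison)
    show "((\<lambda>p. sup_const * ?n (fst p)) \<longlongrightarrow> 0) ?F"
      using tendsto_mult_right_zero[OF 1] by simp
    show "\<forall>\<^sub>F p in ?F. norm (v (fst p) e (snd p) - v t0 e (snd p)) \<le> sup_const * ?n (fst p)"
      unfolding eventually_at_filter
    proof (intro always_eventually allI impI)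
      fix p assume "p \<in> J \<times> {0..len e}"
      then have "(\<lambda>e x. v (fst p) e x - v t0 e x) \<in> H1" "snd p \<in> {0..len e}"
        using p0 by (auto intro!: H1_diff v_H1)
      from H1_sup_bound[OF this(1) e this(2)]
      show "norm (v (fst p) e (snd p) - v t0 e (snd p)) \<le> sup_const * ?n (fst p)"
        by (simp add: H1_norm_def)
    qed
  qed
  from tendsto_add[OF this 2] show "((\<lambda>(t, x). v t e x) \<longlongrightarrow> (case p of (t, x) \<Rightarrow> v t e x)) (at p within J \<times> {0..len e})"
    unfolding p0 by (simp add: case_prod_beta')
qed

text \<open>Joint continuity in two times of the integral of a continuous function of the values of the
  solution.\<close>

lemma continuous_on_graph_integral:
  fixes h :: "complex \<times> complex \<Rightarrow> 'b::euclidean_space"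
  assumes h: "continuous_on UNIV h"
  shows "continuous_on (J \<times> J) (\<lambda>(s, t). graph_integral G len (\<lambda>e x. h (v s e x, v t e x)))"
proof -
  have "continuous_on (J \<times> J) (\<lambda>p. integral\<^sup>L (lebesgue_on {0..len e}) (\<lambda>x. h (v (fst p) e x, v (snd p) e x)))"
    if e: "e \<in> arcs G" for e
  proof -
    have "continuous_on ((J \<times> J) \<times> cbox 0 (len e)) (\<lambda>(p, x). h (v (fst p) e x, v (snd p) e x))"
    proof -
      have 1: "continuous_on ((J \<times> J) \<times> cbox 0 (len e)) (\<lambda>q. v (fst (fst q)) e (snd q))"
        using continuous_on_compose2[OF v_jointly_continuous[OF e], of "(J \<times> J) \<times> cbox 0 (len e)" "\<lambda>q. (fst (fst q), snd q)"]
        by (force intro: continuous_intros)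
      have 2: "continuous_on ((J \<times> J) \<times> cbox 0 (len e)) (\<lambda>q. v (snd (fst q)) e (snd q))"
        using continuous_on_compose2[OF v_jointly_continuous[OF e], of "(J \<times> J) \<times> cbox 0 (len e)" "\<lambda>q. (snd (fst q), snd q)"]
        by (force intro: continuous_intros)
      have "continuous_on ((J \<times> J) \<times> cbox 0 (len e)) (\<lambda>q. h (v (fst (fst q)) e (snd q), v (snd (fst q)) e (snd q)))"
        by (rule continuous_on_compose2[OF h continuous_on_Pair[OF 1 2]]) auto
      then show ?thesis by (simp add: case_prod_beta)
    qed
    from integral_continuous_on_param[OF this]
    have c: "continuous_on (J \<times> J) (\<lambda>p. integral (cbox 0 (len e)) (\<lambda>x. h (v (fst p) e x, v (snd p) e x)))" .
    have "integral\<^sup>L (lebesgue_on {0..len e}) (\<lambda>x. h (v (fst p) e x, v (snd p) e x))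
       = integral (cbox 0 (len e)) (\<lambda>x. h (v (fst p) e x, v (snd p) e x))" if "p \<in> J \<times> J" for p
    proof -
      have "continuous_on {0..len e} (\<lambda>x. h (v (fst p) e x, v (snd p) e x))"
        using that e by (intro continuous_on_compose2[OF h] continuous_on_Pair H1_continuous v_H1) auto
      from lebesgue_integral_eq_integral[OF continuous_imp_integrable_real[OF this]]
      show ?thesis by simp
    qed
    then show ?thesis using c by (simp cong: continuous_on_cong)
  qed
  then show ?thesis
    unfolding graph_integral_eq case_prod_beta by (intro continuous_on_sum)
qed

lemma continuous_on_A: "continuous_on (J \<times> J) (\<lambda>(s, t). A s t)"
  unfolding continuous_on_def
proof (rule ballI)
  fix p assume p: "p \<in> J \<times> J"
  obtain s0 t0 where p0: "p = (s0, t0)" "s0 \<in> J" "t0 \<in> J" using p by auto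
  let ?F = "at (s0, t0) within J \<times> J"
  let ?n = "\<lambda>t0 s. nrm (D (\<lambda>e x. v s e x - v t0 e x))"
  have n0: "?n t t = 0" for t using nrm_D_const[of 0] by simp
  have "(?n t \<longlongrightarrow> ?n t t) (at t within J)" if "t \<in> J" for t
    using Dv_cont[OF that] unfolding n0 .
  from tendsto_fst_within[OF this[OF p0(2)]] tendsto_snd_within[OF this[OF p0(3)]]
  have 1: "((\<lambda>p. ?n s0 (fst p)) \<longlongrightarrow> 0) ?F" and 2: "((\<lambda>p. ?n t0 (snd p)) \<longlongrightarrow> 0) ?F"
    unfolding n0 by blast+
  have "((\<lambda>p. A (fst p) (snd p) - A s0 t0) \<longlongrightarrow> 0) ?F"
  proof (rule Lim_null_comparison)
    let ?b = "\<lambda>p. ?n s0 (fst p) * (nrm (D (v t0)) + ?n t0 (snd p)) + nrm (D (v s0)) * ?n t0 (snd p)"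
    have "(?b \<longlongrightarrow> 0 * (nrm (D (v t0)) + 0) + nrm (D (v s0)) * 0) ?F"
      by (intro tendsto_intros 1 2)
    then show "(?b \<longlongrightarrow> 0) ?F" by simp
    show "\<forall>\<^sub>F p in ?F. norm (A (fst p) (snd p) - A s0 t0) \<le> ?b p"
      unfolding eventually_at_filter
    proof (intro always_eventually allI impI)
      fix p assume "p \<in> J \<times> J"
      then obtain s t where st: "p = (s, t)" "s \<in> J" "t \<in> J" by auto
      have split: "A s t - A s0 t0 = ip (D (\<lambda>e x. v s e x - v s0 e x)) (D (v t)) + ip (D (v s0)) (D (\<lambda>e x. v t e x - v t0 e x))"
        using st p0 by (simp add: A_def ip_D_diff_left ip_D_diff_right v_H1 Dv_L2)
      have "norm (A s t - A s0 t0) \<le> ?n s0 s * nrm (D (v t)) + nrm (D (v s0)) * ?n t0 t"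
        unfolding split using st p0 by (intro norm_triangle_mono ip_Cauchy_Schwarz D_L2 H1_diff v_H1)
      also have "\<dots> \<le> ?n s0 s * (nrm (D (v t0)) + ?n t0 t) + nrm (D (v s0)) * ?n t0 t"
        using st p0 by (intro add_right_mono mult_left_mono nrm_D_diff_le v_H1 nrm_nonneg)
      finally show "norm (A (fst p) (snd p) - A s0 t0) \<le> ?b p" using st by simp
    qed
  qed
  then show "((\<lambda>(s, t). A s t) \<longlongrightarrow> (case p of (s, t) \<Rightarrow> A s t)) (at p within J \<times> J)"
    unfolding p0 by (simp add: case_prod_beta' LIM_zero_iff)
qed

lemma continuous_on_P: "continuous_on (J \<times> J) (\<lambda>(s, t). P s t)"
proof -
  have "continuous_on UNIV (\<lambda>(a, b). complex_of_real (cmod a ^ 4) * a * cnj b)"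
    unfolding case_prod_beta by (intro continuous_intros)
  from continuous_on_diff[OF continuous_on_A continuous_on_graph_integral[OF this]] show ?thesis
    by (simp add: P_def L2_inner_def case_prod_beta)
qed

lemma continuous_on_S6: "continuous_on J S6"
proof -
  have "continuous_on UNIV (\<lambda>(a::complex, b::complex). cmod a ^ 6)"
    unfolding case_prod_beta by (intro continuous_intros)
  from continuous_on_graph_integral[OF this]
  have "continuous_on (J \<times> J) (\<lambda>p. S6 (fst p))" by (simp add: S6_def case_prod_beta)
  moreover have "continuous_on J (\<lambda>t. (t, t))" by (intro continuous_on_Pair continuous_on_id)
  ultimately have "continuous_on J (\<lambda>t. S6 (fst (t, t)))"
    by (rule continuous_on_compose2) auto
  then show ?thesis by simp
qed

lemma M_commute: "M t s = cnj (M s t)"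
  unfolding M_def by (rule ip_commute)

lemma A_commute: "A t s = cnj (A s t)"
  unfolding A_def by (rule ip_commute)

lemma M_diag: "M t t = complex_of_real ((nrm (v t))\<^sup>2)"
  unfolding M_def by (rule ip_self)

lemma A_diag: "A t t = complex_of_real ((nrm (D (v t)))\<^sup>2)"
  unfolding A_def by (rule ip_self)

lemma P_diag: "P t t = complex_of_real ((nrm (D (v t)))\<^sup>2 - S6 t)"
proof -
  have "complex_of_real (cmod z ^ 4) * z * cnj z = complex_of_real (cmod z ^ 6)" for z
  proof -
    have "z * cnj z = complex_of_real ((cmod z)\<^sup>2)"
      by (rule complex_norm_square[symmetric])
    then have "complex_of_real (cmod z ^ 4) * z * cnj z = complex_of_real (cmod z ^ 4 * (cmod z)\<^sup>2)"
      by (simp only: mult.assoc of_real_mult)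
    then show ?thesis by (simp flip: power_add)
  qed
  then have "ip (\<lambda>e x. complex_of_real (cmod (v t e x) ^ 4) * v t e x) (v t) = complex_of_real (S6 t)"
    unfolding L2_inner_def S6_def graph_integral_eq by (simp only: integral_complex_of_real of_real_sum)
  then show ?thesis unfolding P_def A_diag by simp
qed

lemma M_deriv:
  assumes "s \<in> J" "t \<in> J"
  shows "((\<lambda>s. M s t) has_vector_derivative - \<i> * P s t) (at s within J)"
proof -
  have "((\<lambda>s. \<i> * M s t) has_vector_derivative P s t) (at s within J)"
    using solution v_H1[OF assms(2)] assms(1) unfolding nls_solution_def J_def Let_def M_def P_def A_def by blast
  from has_vector_derivative_mult_right[OF this, of "- \<i>"] show ?thesis
    by (simp flip: mult.assoc)
qed


lemma Icc_subset_J: "t \<in> J \<Longrightarrow> {0..t} \<subseteq> J"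
  using J_interval by auto

text \<open>The increments satisfy \<open>\<parallel>v s - v t\<parallel>\<^sup>2 = o(\<bar>s - t\<bar>)\<close> uniformly on compact time intervals: testing the
  equation with \<open>v s - v t\<close> itself, the derivative of \<open>r \<mapsto> M r s - M r t\<close> is \<open>- \<i> (P r s - P r t)\<close>,
  which is small since \<open>P\<close> is uniformly continuous.\<close>

lemma increment_estimate:
  assumes "b \<in> J" "0 < \<eta>"
  shows "\<exists>\<delta>>0. \<forall>s\<in>{0..b}. \<forall>t\<in>{0..b}. \<bar>s - t\<bar> < \<delta> \<longrightarrow>
     (nrm (\<lambda>e x. v s e x - v t e x))\<^sup>2 \<le> \<eta> * \<bar>s - t\<bar>"
proof -
  have "uniformly_continuous_on ({0..b} \<times> {0..b}) (\<lambda>(s, t). P s t)"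
    using Icc_subset_J[OF assms(1)]
    by (intro compact_uniformly_continuous continuous_on_subset[OF continuous_on_P] compact_Times) auto
  with assms(2) obtain \<delta> where \<delta>: "0 < \<delta>"
    "\<And>p q. p \<in> {0..b} \<times> {0..b} \<Longrightarrow> q \<in> {0..b} \<times> {0..b} \<Longrightarrow> dist q p < \<delta> \<Longrightarrow>
      dist (case q of (s, t) \<Rightarrow> P s t) (case p of (s, t) \<Rightarrow> P s t) < \<eta>"
    unfolding uniformly_continuous_on_def by metis
  have "(nrm (\<lambda>e x. v s e x - v t e x))\<^sup>2 \<le> \<eta> * \<bar>s - t\<bar>"
    if st: "s \<in> {0..b}" "t \<in> {0..b}" "\<bar>s - t\<bar> < \<delta>" for s t
  proof -
    have J: "r \<in> J" if "r \<in> {0..b}" for r using that Icc_subset_J[OF assms(1)] by auto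
    let ?f = "\<lambda>r. M r s - M r t"
    have "norm (?f s - ?f t) \<le> \<eta> * \<bar>s - t\<bar>"
    proof (rule vector_derivative_bound[where S = "{0..b}" and f' = "\<lambda>r. - \<i> * P r s - - \<i> * P r t"])
      fix r assume r: "r \<in> {0..b}"
      show "(?f has_vector_derivative - \<i> * P r s - - \<i> * P r t) (at r within {0..b})"
        by (rule has_vector_derivative_within_subset[OF _ Icc_subset_J[OF assms(1)]])
          (intro has_vector_derivative_diff M_deriv J r st)
      have "dist (P r s) (P r t) < \<eta>"
        using \<delta>(2)[of "(r, t)" "(r, s)"] r st by (simp add: dist_Pair_Pair dist_real_def)
      then show "norm (- \<i> * P r s - - \<i> * P r t) \<le> \<eta>"
        unfolding right_diff_distrib[symmetric] norm_mult by (simp add: dist_norm)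
    qed (use st in auto)
    moreover have "?f s - ?f t = complex_of_real ((nrm (\<lambda>e x. v s e x - v t e x))\<^sup>2)"
      unfolding ip_self[symmetric] M_def using J st
      by (simp add: ip_diff_left ip_diff_right L2_diff v_L2)
    ultimately show ?thesis by (simp del: of_real_power)
  qed
  with \<delta>(1) show ?thesis by blast
qed

text \<open>The derivative of \<open>M\<close> along the diagonals of fixed time lag, up to the factor \<open>\<i>\<close>. It contains no
  gradient because \<open>A\<close> is Hermitian.\<close>

definition N :: "real \<Rightarrow> real \<Rightarrow> complex" where
  "N s t = graph_integral G len (\<lambda>e x. complex_of_real (cmod (v s e x) ^ 4 - cmod (v t e x) ^ 4) * v s e x * cnj (v t e x))"

lemma integrable_continuous_of_v:
  fixes h :: "complex \<times> complex \<Rightarrow> 'b::euclidean_space"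
  assumes "continuous_on UNIV h" "s \<in> J" "t \<in> J" "e \<in> arcs G"
  shows "integrable (lebesgue_on {0..len e}) (\<lambda>x. h (v s e x, v t e x))"
proof (rule continuous_imp_integrable_real)
  show "continuous_on {0..len e} (\<lambda>x. h (v s e x, v t e x))"
    using assms(2-) by (intro continuous_on_compose2[OF assms(1)] continuous_on_Pair H1_continuous v_H1) auto
qed

lemma P_minus_cnj_P:
  assumes "s \<in> J" "t \<in> J"
  shows "cnj (P t s) - P s t = N s t"
proof -
  let ?h = "\<lambda>(a, b). complex_of_real (cmod a ^ 4) * a * cnj b"
  let ?k = "\<lambda>(a, b). cnj (complex_of_real (cmod b ^ 4) * b * cnj a)"
  have c: "continuous_on UNIV ?h" "continuous_on UNIV ?k"
    unfolding case_prod_beta by (intro continuous_intros)+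
  have "N s t = graph_integral G len (\<lambda>e x. ?h (v s e x, v t e x) - ?k (v s e x, v t e x))"
    unfolding N_def by (intro graph_integral_cong) (simp add: algebra_simps)
  also have "\<dots> = graph_integral G len (\<lambda>e x. ?h (v s e x, v t e x)) - graph_integral G len (\<lambda>e x. ?k (v s e x, v t e x))"
    unfolding graph_integral_eq sum_subtractf[symmetric]
    by (intro sum.cong refl Bochner_Integration.integral_diff integrable_continuous_of_v c assms)
  also have "graph_integral G len (\<lambda>e x. ?k (v s e x, v t e x))
      = cnj (graph_integral G len (\<lambda>e x. complex_of_real (cmod (v t e x) ^ 4) * v t e x * cnj (v s e x)))"
    unfolding graph_integral_eq cnj_sum prod.case by (simp only: Bochner_Integration.integral_cnj)
  finally show ?thesis
    by (simp add: P_def L2_inner_def A_commute[of t s])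
qed

text \<open>The chain rule for the function \<open>M\<close> of two variables. The solution is not known to be
  differentiable in \<open>L2\<close>, but the mixed second difference \<open>?R\<close> below is \<open>o(\<bar>\<tau> - t\<bar>)\<close> by
  \<open>increment_estimate\<close>.\<close>

lemma M_diagonal_deriv:
  assumes h: "0 \<le> h" "b \<in> J" and t: "t \<in> {0..b - h}"
  shows "((\<lambda>\<tau>. M (\<tau> + h) \<tau>) has_vector_derivative \<i> * N (t + h) t) (at t within {0..b - h})"
proof -
  let ?S = "{0..b - h}"
  have SJ: "\<tau> \<in> J" "\<tau> + h \<in> J" if "\<tau> \<in> ?S" for \<tau>
    using that h Icc_subset_J[OF h(2)] by auto
  let ?R = "\<lambda>\<tau>. ip (\<lambda>e x. v (\<tau> + h) e x - v (t + h) e x) (\<lambda>e x. v \<tau> e x - v t e x)"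
  have 1: "((\<lambda>\<tau>. M (\<tau> + h) t) has_vector_derivative - \<i> * P (t + h) t) (at t within ?S)"
  proof -
    have s: "((\<lambda>\<tau>. \<tau> + h) has_vector_derivative 1) (at t within ?S)"
      by (auto intro!: derivative_eq_intros)
    have "((\<lambda>s. M s t) has_vector_derivative - \<i> * P (t + h) t) (at (t + h) within (\<lambda>\<tau>. \<tau> + h) ` ?S)"
      using SJ t h Icc_subset_J[OF h(2)] by (intro has_vector_derivative_within_subset[OF M_deriv]) auto
    from vector_diff_chain_within[OF s this] show ?thesis by (simp add: o_def)
  qed
  have 2: "((\<lambda>\<tau>. M (t + h) \<tau>) has_vector_derivative cnj (- \<i> * P t (t + h))) (at t within ?S)"
  proof -
    have "((\<lambda>s. M s (t + h)) has_vector_derivative - \<i> * P t (t + h)) (at t within ?S)"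
      using SJ t by (intro has_vector_derivative_within_subset[OF M_deriv]) auto
    from bounded_linear.has_vector_derivative[OF bounded_linear_cnj this] show ?thesis by (simp add: M_commute[of "t + h"])
  qed
  have 3: "(?R has_vector_derivative 0) (at t within ?S)"
    unfolding has_vector_derivative_def
  proof (rule has_derivativeI_sandwich[of 1, where H = "\<lambda>y. norm (?R y) / norm (y - t)"])
    show "bounded_linear (\<lambda>h. h *\<^sub>R (0::complex))" by simp
    have R0: "?R t = 0" by (simp add: ip_eq)
    show "norm ((?R y - ?R t) - (y - t) *\<^sub>R 0) / norm (y - t) \<le> norm (?R y) / norm (y - t)" for y
      unfolding R0 by simp
    show "((\<lambda>y. norm (?R y) / norm (y - t)) \<longlongrightarrow> 0) (at t within ?S)"
    proof (rule tendstoI)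
      fix \<epsilon> :: real assume e: "0 < \<epsilon>"
      then have "0 < \<epsilon> / 2" by simp
      from increment_estimate[OF h(2) this] obtain \<delta> where \<delta>: "0 < \<delta>"
        "\<And>s t. s \<in> {0..b} \<Longrightarrow> t \<in> {0..b} \<Longrightarrow> \<bar>s - t\<bar> < \<delta> \<Longrightarrow> (nrm (\<lambda>e x. v s e x - v t e x))\<^sup>2 \<le> \<epsilon> / 2 * \<bar>s - t\<bar>"
        by blast
      have "dist (norm (?R y) / norm (y - t)) 0 < \<epsilon>" if y: "y \<in> ?S" "y \<noteq> t" "dist y t < \<delta>" for y
      proof -
        let ?a = "nrm (\<lambda>e x. v (y + h) e x - v (t + h) e x)" and ?b = "nrm (\<lambda>e x. v y e x - v t e x)"
        have "?a\<^sup>2 \<le> \<epsilon> / 2 * \<bar>y - t\<bar>"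
          using \<delta>(2)[of "y + h" "t + h"] y t h by (auto simp: dist_real_def)
        moreover have "?b\<^sup>2 \<le> \<epsilon> / 2 * \<bar>y - t\<bar>"
          using \<delta>(2)[of y t] y t h by (auto simp: dist_real_def)
        moreover have "2 * ?a * ?b \<le> ?a\<^sup>2 + ?b\<^sup>2" by (rule sum_squares_bound)
        ultimately have "?a * ?b \<le> \<epsilon> / 2 * \<bar>y - t\<bar>" by linarith
        moreover have "norm (?R y) \<le> ?a * ?b"
          using SJ y t by (intro ip_Cauchy_Schwarz L2_diff v_L2)
        ultimately have "norm (?R y) \<le> \<epsilon> / 2 * \<bar>y - t\<bar>" by linarith
        then have "norm (?R y) / norm (y - t) \<le> \<epsilon> / 2"
          using y(2) by (simp add: divide_le_eq)
        then have "norm (?R y) / norm (y - t) < \<epsilon>" using e by linarith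
        then show ?thesis by (simp add: dist_real_def)
      qed
      then show "\<forall>\<^sub>F y in at t within ?S. dist (norm (?R y) / norm (y - t)) 0 < \<epsilon>"
        unfolding eventually_at using \<delta>(1) by blast
    qed
  qed simp
  have sum: "((\<lambda>\<tau>. M (\<tau> + h) t + M (t + h) \<tau> + ?R \<tau> - M (t + h) t) has_vector_derivative
      - \<i> * P (t + h) t + cnj (- \<i> * P t (t + h)) + 0 - 0) (at t within ?S)"
    by (intro has_vector_derivative_diff has_vector_derivative_add has_vector_derivative_const 1 2 3)
  have total: "- \<i> * P (t + h) t + cnj (- \<i> * P t (t + h)) + 0 - 0 = \<i> * N (t + h) t"
  proof -
    have e: "N (t + h) t = cnj (P t (t + h)) - P (t + h) t"
      using SJ t by (intro P_minus_cnj_P[symmetric]) auto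
    show ?thesis unfolding e by (simp add: algebra_simps)
  qed
  have split: "M (\<tau> + h) \<tau> = M (\<tau> + h) t + M (t + h) \<tau> + ?R \<tau> - M (t + h) t" if "\<tau> \<in> ?S" for \<tau>
    using SJ that t by (simp add: M_def ip_diff_left ip_diff_right L2_diff v_L2)
  show ?thesis
    by (rule has_vector_derivative_transform[OF t split sum[unfolded total]])
qed

lemma mass_conservation:
  assumes "t \<in> J"
  shows "nrm (v t) = nrm (v 0)"
proof -
  \<comment> \<open>The time lag \<open>0\<close>, for which \<open>N\<close> vanishes.\<close>
  have "norm (M t t - M 0 0) \<le> 0 * \<bar>t - 0\<bar>"
  proof (rule vector_derivative_bound[where S = "{0..t}" and f' = "\<lambda>_. 0"])
    show "((\<lambda>\<tau>. M \<tau> \<tau>) has_vector_derivative 0) (at r within {0..t})" if "r \<in> {0..t}" for r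
      using M_diagonal_deriv[of 0 t r] that assms by (simp add: N_def graph_integral_eq)
  qed (use assms in \<open>auto simp: J_def\<close>)
  then have "M t t = M 0 0" by simp
  then have "(nrm (v t))\<^sup>2 = (nrm (v 0))\<^sup>2" unfolding M_diag of_real_eq_iff .
  then show ?thesis using nrm_nonneg by (simp add: power2_eq_iff_nonneg)
qed


lemma N_estimate:
  assumes st: "s \<in> J" "t \<in> J"
    and B: "\<And>e x. e \<in> arcs G \<Longrightarrow> x \<in> {0..len e} \<Longrightarrow> cmod (v s e x) \<le> B"
      "\<And>e x. e \<in> arcs G \<Longrightarrow> x \<in> {0..len e} \<Longrightarrow> cmod (v t e x) \<le> B"
  shows "\<bar>Re (N s t) - (2/3) * (S6 s - S6 t)\<bar> \<le> 2 * B ^ 4 * (nrm (\<lambda>e x. v s e x - v t e x))\<^sup>2"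
proof -
  let ?n = "\<lambda>(a, b). complex_of_real (cmod a ^ 4 - cmod b ^ 4) * a * cnj b"
  let ?s = "\<lambda>(a::complex, b::complex). cmod a ^ 6" and ?t = "\<lambda>(a::complex, b::complex). cmod b ^ 6"
  let ?d = "\<lambda>(a::complex, b::complex). 2 * B ^ 4 * (cmod (a - b))\<^sup>2"
  let ?q = "\<lambda>p. Re (?n p) - (2/3) * (?s p - ?t p)"
  have c: "continuous_on UNIV ?n" "continuous_on UNIV ?s" "continuous_on UNIV ?t" "continuous_on UNIV ?d"
    unfolding case_prod_beta by (intro continuous_intros)+
  then have q: "continuous_on UNIV ?q" by (intro continuous_intros)
  note i = integrable_continuous_of_v[OF _ st]
  have eq: "Re (N s t) - (2/3) * (S6 s - S6 t) = (\<Sum>e\<in>arcs G. integral\<^sup>L (lebesgue_on {0..len e}) (\<lambda>x. ?q (v s e x, v t e x)))"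
  proof -
    have "integral\<^sup>L (lebesgue_on {0..len e}) (\<lambda>x. ?q (v s e x, v t e x))
      = Re (integral\<^sup>L (lebesgue_on {0..len e}) (\<lambda>x. ?n (v s e x, v t e x)))
        - (2/3) * (integral\<^sup>L (lebesgue_on {0..len e}) (\<lambda>x. ?s (v s e x, v t e x))
        - integral\<^sup>L (lebesgue_on {0..len e}) (\<lambda>x. ?t (v s e x, v t e x)))" if e: "e \<in> arcs G" for e
    proof -
      note ie = i[OF c(1) e] i[OF c(2) e] i[OF c(3) e]
      have iR: "integrable (lebesgue_on {0..len e}) (\<lambda>x. Re (?n (v s e x, v t e x)))"
        using ie(1) by (rule integrable_Re)
      have id: "integrable (lebesgue_on {0..len e}) (\<lambda>x. ?s (v s e x, v t e x) - ?t (v s e x, v t e x))"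
        by (rule Bochner_Integration.integrable_diff[OF ie(2,3)])
      show ?thesis
        unfolding Bochner_Integration.integral_diff[OF iR integrable_mult_right[OF id]]
          integral_mult_right_zero Bochner_Integration.integral_diff[OF ie(2,3)] integral_Re[OF ie(1)] ..
    qed
    then have "(\<Sum>e\<in>arcs G. integral\<^sup>L (lebesgue_on {0..len e}) (\<lambda>x. ?q (v s e x, v t e x)))
       = (\<Sum>e\<in>arcs G. Re (integral\<^sup>L (lebesgue_on {0..len e}) (\<lambda>x. ?n (v s e x, v t e x)))
        - (2/3) * (integral\<^sup>L (lebesgue_on {0..len e}) (\<lambda>x. ?s (v s e x, v t e x))
        - integral\<^sup>L (lebesgue_on {0..len e}) (\<lambda>x. ?t (v s e x, v t e x))))"
      by (rule sum.cong[OF refl])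
    also have "\<dots> = Re (N s t) - (2/3) * (S6 s - S6 t)"
      unfolding N_def S6_def graph_integral_eq sum_subtractf sum_distrib_left[symmetric] Re_sum prod.case ..
    finally show ?thesis by (rule sym)
  qed
  have "\<bar>\<Sum>e\<in>arcs G. integral\<^sup>L (lebesgue_on {0..len e}) (\<lambda>x. ?q (v s e x, v t e x))\<bar>
      \<le> (\<Sum>e\<in>arcs G. integral\<^sup>L (lebesgue_on {0..len e}) (\<lambda>x. ?d (v s e x, v t e x)))"
  proof (rule order_trans[OF sum_abs sum_mono])
    fix e assume e: "e \<in> arcs G"
    show "\<bar>integral\<^sup>L (lebesgue_on {0..len e}) (\<lambda>x. ?q (v s e x, v t e x))\<bar>
       \<le> integral\<^sup>L (lebesgue_on {0..len e}) (\<lambda>x. ?d (v s e x, v t e x))"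
    proof (rule Bochner_Integration.integral_abs_bound_integral)
      fix x assume "x \<in> space (lebesgue_on {0..len e})"
      then show "\<bar>?q (v s e x, v t e x)\<bar> \<le> ?d (v s e x, v t e x)"
        using quintic_estimate[OF B(1)[OF e] B(2)[OF e]] by simp
    qed (rule i[OF q e] i[OF c(4) e])+
  qed
  also have "\<dots> = 2 * B ^ 4 * (nrm (\<lambda>e x. v s e x - v t e x))\<^sup>2"
    unfolding nrm_sq sum_distrib_left prod.case integral_mult_right_zero ..
  finally show ?thesis unfolding eq .
qed

text \<open>The square of the gradient norm is \<open>A t t\<close>, a continuous function of time.\<close>

lemma bounded_on_compact_time:
  assumes "b \<in> J"
  shows "\<exists>B\<ge>0. \<forall>t\<in>{0..b}. \<forall>e\<in>arcs G. \<forall>x\<in>{0..len e}. cmod (v t e x) \<le> B"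
proof -
  have "continuous_on {0..b} (\<lambda>t. (\<lambda>(s, t). A s t) (t, t))"
    using Icc_subset_J[OF assms]
    by (intro continuous_on_compose2[OF continuous_on_A] continuous_on_Pair continuous_on_id) auto
  then have "compact ((\<lambda>t. A t t) ` {0..b})"
    by (intro compact_continuous_image) auto
  then have "bounded ((\<lambda>t. A t t) ` {0..b})" by (rule compact_imp_bounded)
  then obtain K where "\<forall>z\<in>(\<lambda>t. A t t) ` {0..b}. norm z \<le> K"
    unfolding bounded_iff by blast
  then have K: "norm (A t t) \<le> K" if "t \<in> {0..b}" for t using that by blast
  let ?B = "sup_const * (1 + K + nrm (v 0))"
  have "cmod (v t e x) \<le> ?B" if t: "t \<in> {0..b}" and e: "e \<in> arcs G" and x: "x \<in> {0..len e}" for t e x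
  proof -
    have tJ: "t \<in> J" using t Icc_subset_J[OF assms] by auto
    have "(nrm (D (v t)))\<^sup>2 \<le> K" using K[OF t] unfolding A_diag by (simp del: of_real_power)
    moreover have "nrm (D (v t)) \<le> 1 + (nrm (D (v t)))\<^sup>2"
      using sum_squares_bound[of 1 "nrm (D (v t))"] nrm_nonneg[of "D (v t)"] by simp
    ultimately have "nrm (D (v t)) + nrm (v t) \<le> 1 + K + nrm (v 0)"
      using mass_conservation[OF tJ] by linarith
    then have "sup_const * (nrm (D (v t)) + nrm (v t)) \<le> ?B"
      using sup_const_ge_1 by (intro mult_left_mono) auto
    then show ?thesis using H1_sup_bound[OF v_H1[OF tJ] e x] by linarith
  qed
  moreover have "0 \<le> K" using order_trans[OF norm_ge_zero K[of 0]] assms by (auto simp: J_def)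
  then have "0 \<le> ?B" using sup_const_ge_1 nrm_nonneg[of "v 0"] by (intro mult_nonneg_nonneg) auto
  ultimately show ?thesis by blast
qed

text \<open>The imaginary part of \<open>M (t + h) t / h\<close> tends to \<open>- (\<parallel>v'\<parallel>\<^sup>2 - \<parallel>v\<parallel>\<^sub>6\<^sup>6)\<close> as \<open>h \<rightarrow> 0\<close>, while its time
  derivative is \<open>2/3\<close> of a difference quotient of \<open>\<parallel>v\<parallel>\<^sub>6\<^sup>6\<close>, up to an error of order
  \<open>\<parallel>v (t + h) - v t\<parallel>\<^sup>2 / h = o(1)\<close>. Hence \<open>\<parallel>v'\<parallel>\<^sup>2 - \<parallel>v\<parallel>\<^sub>6\<^sup>6 / 3\<close> is constant.\<close>

lemma energy_conservation:
  assumes t1: "t1 \<in> J"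
  shows "(nrm (D (v t1)))\<^sup>2 - S6 t1 / 3 = (nrm (D (v 0)))\<^sup>2 - S6 0 / 3"
proof -
  have t1_nonneg: "0 \<le> t1" using t1 by (simp add: J_def)
  obtain b where b: "t1 < b" "b \<in> J"
  proof -
    have "ereal t1 < T" using t1 by (simp add: J_def)
    then obtain r where "ereal t1 < ereal r" "ereal r < T" using ereal_dense2 by blast
    then show ?thesis using t1_nonneg by (intro that[of r]) (auto simp: J_def)
  qed
  have bJ: "t \<in> J" if "t \<in> {0..b}" for t using that Icc_subset_J[OF b(2)] by auto
  obtain B where B: "0 \<le> B" "\<And>t e x. t \<in> {0..b} \<Longrightarrow> e \<in> arcs G \<Longrightarrow> x \<in> {0..len e} \<Longrightarrow> cmod (v t e x) \<le> B"
    using bounded_on_compact_time[OF b(2)] by blast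
  \<comment> \<open>The increment \<open>R (t + h) - R t\<close> has the derivative \<open>S6 (t + h) - S6 t\<close>; \<open>S6\<close> itself need not be differentiable.\<close>
  define R where "R t = integral {0..t} S6" for t
  have R: "(R has_vector_derivative S6 t) (at t within {0..b})" if "t \<in> {0..b}" for t
    unfolding R_def using that Icc_subset_J[OF b(2)]
    by (intro integral_has_vector_derivative continuous_on_subset[OF continuous_on_S6])
  define F where "F h t = Im (M (t + h) t) - (2/3) * (R (t + h) - R t)" for h t
  define X where "X t = - ((nrm (D (v t)))\<^sup>2 - S6 t / 3)" for t
  have lim: "((\<lambda>h. F h t / h) \<longlongrightarrow> X t) (at_right 0)" if t: "t \<in> {0..t1}" for t
  proof -
    have tb: "t \<in> {0..b}" using t b by auto
    let ?g = "\<lambda>s. Im (M s t) - (2/3) * R s"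
    have "((\<lambda>s. M s t) has_vector_derivative - \<i> * P t t) (at t within {0..b})"
      by (rule has_vector_derivative_within_subset[OF M_deriv Icc_subset_J]) (use bJ[OF tb] b in auto)
    from bounded_linear.has_vector_derivative[OF bounded_linear_Im this]
    have "((\<lambda>s. Im (M s t)) has_vector_derivative Im (- \<i> * P t t)) (at t within {0..b})" .
    from has_vector_derivative_diff[OF this has_vector_derivative_mult_right[OF R[OF tb], of "2/3"]]
    have "(?g has_real_derivative (Im (- \<i> * P t t) - (2/3) * S6 t)) (at t within {0..b})"
      by (simp add: has_real_derivative_iff_has_vector_derivative)
    then have "(?g has_real_derivative X t) (at t within {0..b})"
      unfolding P_diag X_def by (simp add: algebra_simps)
    then have L: "((\<lambda>s. (?g s - ?g t) / (s - t)) \<longlongrightarrow> X t) (at t within {0..b})"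
      by (simp add: has_field_derivative_iff)
    have "filterlim (\<lambda>h. t + h) (at t within {0..b}) (at_right 0)"
      unfolding filterlim_at
    proof
      have "((\<lambda>h. t + h) \<longlongrightarrow> t + 0) (at_right 0)" by (intro tendsto_intros)
      then show "((\<lambda>h. t + h) \<longlongrightarrow> t) (at_right 0)" by simp
      have "0 < b - t" using t b by auto
      then have "\<forall>\<^sub>F h in at_right 0. h \<in> {0<..<b - t}" by (rule eventually_at_right_real)
      then show "\<forall>\<^sub>F h in at_right 0. t + h \<in> {0..b} \<and> t + h \<noteq> t"
        by eventually_elim (use t in auto)
    qed
    from filterlim_compose[OF L this] have "((\<lambda>h. (?g (t + h) - ?g t) / h) \<longlongrightarrow> X t) (at_right 0)"
      by simp
    moreover have "Im (M t t) = 0" unfolding M_diag by simp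
    then have "F h t = ?g (t + h) - ?g t" for h
      unfolding F_def right_diff_distrib by simp
    ultimately show ?thesis by simp
  qed
  have "((\<lambda>h. F h t1 / h - F h 0 / h) \<longlongrightarrow> 0) (at_right 0)"
  proof (rule tendstoI)
    fix \<epsilon> :: real assume e: "0 < \<epsilon>"
    define \<eta> where "\<eta> = \<epsilon> / (2 * B ^ 4 * t1 + 1)"
    have den: "0 < 2 * B ^ 4 * t1 + 1" using B t1_nonneg by (intro add_nonneg_pos mult_nonneg_nonneg) auto
    have \<eta>: "0 < \<eta>" using e den by (simp add: \<eta>_def)
    have small: "2 * B ^ 4 * \<eta> * t1 < \<epsilon>"
      using e den by (simp add: \<eta>_def field_simps)
    from increment_estimate[OF b(2) \<eta>] obtain \<delta> where \<delta>: "0 < \<delta>"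
      "\<And>s t. s \<in> {0..b} \<Longrightarrow> t \<in> {0..b} \<Longrightarrow> \<bar>s - t\<bar> < \<delta> \<Longrightarrow> (nrm (\<lambda>e x. v s e x - v t e x))\<^sup>2 \<le> \<eta> * \<bar>s - t\<bar>"
      by blast
    have "0 < min \<delta> (b - t1)" using \<delta> b by auto
    then have "\<forall>\<^sub>F h in at_right 0. h \<in> {0<..<min \<delta> (b - t1)}" by (rule eventually_at_right_real)
    then show "\<forall>\<^sub>F h in at_right 0. dist (F h t1 / h - F h 0 / h) 0 < \<epsilon>"
    proof eventually_elim
      case (elim h)
      then have h: "0 < h" "h < \<delta>" "h < b - t1" by auto
      have "norm (F h t1 - F h 0) \<le> (2 * B ^ 4 * \<eta> * h) * \<bar>t1 - 0\<bar>"
      proof (rule vector_derivative_bound[where S = "{0..b - h}"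
            and f' = "\<lambda>\<tau>. Re (N (\<tau> + h) \<tau>) - (2/3) * (S6 (\<tau> + h) - S6 \<tau>)"])
        fix \<tau> assume \<tau>: "\<tau> \<in> {0..b - h}"
        have sub: "\<tau> \<in> {0..b}" "\<tau> + h \<in> {0..b}" "{0..b - h} \<subseteq> {0..b}" "(\<lambda>\<tau>. \<tau> + h) ` {0..b - h} \<subseteq> {0..b}"
          using \<tau> h by auto
        have 1: "((\<lambda>\<tau>. Im (M (\<tau> + h) \<tau>)) has_vector_derivative Im (\<i> * N (\<tau> + h) \<tau>)) (at \<tau> within {0..b - h})"
          using bounded_linear.has_vector_derivative[OF bounded_linear_Im M_diagonal_deriv[OF _ b(2) \<tau>]] h by simp
        have 2: "(R has_vector_derivative S6 \<tau>) (at \<tau> within {0..b - h})"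
          by (rule has_vector_derivative_within_subset[OF R[OF sub(1)] sub(3)])
        have 3: "((\<lambda>\<tau>. R (\<tau> + h)) has_vector_derivative S6 (\<tau> + h)) (at \<tau> within {0..b - h})"
        proof -
          have s: "((\<lambda>\<tau>. \<tau> + h) has_vector_derivative 1) (at \<tau> within {0..b - h})"
            by (auto intro!: derivative_eq_intros)
          from vector_diff_chain_within[OF s has_vector_derivative_within_subset[OF R[OF sub(2)] sub(4)]]
          show ?thesis by (simp add: o_def)
        qed
        from has_vector_derivative_diff[OF 1 has_vector_derivative_mult_right[OF has_vector_derivative_diff[OF 3 2], of "2/3"]]
        show "(F h has_vector_derivative Re (N (\<tau> + h) \<tau>) - (2/3) * (S6 (\<tau> + h) - S6 \<tau>)) (at \<tau> within {0..b - h})"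
          unfolding F_def by simp
        have "\<bar>Re (N (\<tau> + h) \<tau>) - (2/3) * (S6 (\<tau> + h) - S6 \<tau>)\<bar>
            \<le> 2 * B ^ 4 * (nrm (\<lambda>e x. v (\<tau> + h) e x - v \<tau> e x))\<^sup>2"
          using bJ sub B(2) by (intro N_estimate) auto
        also have "\<dots> \<le> 2 * B ^ 4 * (\<eta> * \<bar>(\<tau> + h) - \<tau>\<bar>)"
          using B(1) h \<delta>(2)[OF sub(2,1)] by (intro mult_left_mono) auto
        finally show "norm (Re (N (\<tau> + h) \<tau>) - (2/3) * (S6 (\<tau> + h) - S6 \<tau>)) \<le> 2 * B ^ 4 * \<eta> * h"
          using h by (simp add: mult.assoc)
      qed (use h t1_nonneg in auto)
      then have "\<bar>F h t1 - F h 0\<bar> \<le> (2 * B ^ 4 * \<eta> * t1) * h"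
        using t1_nonneg by (simp add: mult_ac)
      then have "\<bar>F h t1 / h - F h 0 / h\<bar> \<le> 2 * B ^ 4 * \<eta> * t1"
        using h by (simp add: diff_divide_distrib[symmetric] abs_divide divide_le_eq)
      then show ?case using small by simp
    qed
  qed
  moreover have "((\<lambda>h. F h t1 / h - F h 0 / h) \<longlongrightarrow> X t1 - X 0) (at_right 0)"
    by (intro tendsto_diff lim) (use t1_nonneg in auto)
  ultimately have "X t1 - X 0 = 0"
    by (intro tendsto_unique[of "at_right 0"]) auto
  then show ?thesis by (simp add: X_def)
qed

end

section \<open>Stability of the constants\<close>

context finite_metric_graph
begin

abbreviation L :: real where "L \<equiv> total_length G len"

text \<open>The mean value of a function and its deviation from the mean.\<close>

definition mean :: "'e graph_fun \<Rightarrow> complex" where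
  "mean u = graph_integral G len u / complex_of_real L"

definition fluct :: "'e graph_fun \<Rightarrow> 'e graph_fun" where
  "fluct u = (\<lambda>e x. u e x - mean u)"

lemma integral_const_edge:
  fixes c :: "'b::{banach, second_countable_topology}"
  assumes "e \<in> arcs G"
  shows "integral\<^sup>L (lebesgue_on {0..len e}) (\<lambda>x. c) = len e *\<^sub>R c"
  using len_pos[OF assms] by (simp add: measure_restrict_space)

lemma graph_integral_const: "graph_integral G len (\<lambda>e x. c) = L *\<^sub>R c"
  unfolding graph_integral_eq total_length_def scaleR_sum_left
  by (intro sum.cong refl integral_const_edge)

lemma nrm_const: "nrm (\<lambda>e x. c) = cmod c * sqrt L"
proof -
  have "(nrm (\<lambda>e x. c))\<^sup>2 = L * (cmod c)\<^sup>2"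
    using graph_integral_const[of "(cmod c)\<^sup>2"] unfolding nrm_sq graph_integral_eq by simp
  moreover have "0 \<le> L" unfolding total_length_def using len_pos by (intro sum_nonneg) (simp add: less_imp_le)
  ultimately have "(nrm (\<lambda>e x. c))\<^sup>2 = (cmod c * sqrt L)\<^sup>2" by (simp add: power_mult_distrib mult.commute)
  then show ?thesis using nrm_nonneg \<open>0 \<le> L\<close> by (subst (asm) power2_eq_iff_nonneg) auto
qed

lemma fluct_H1: "u \<in> H1 \<Longrightarrow> fluct u \<in> H1"
  unfolding fluct_def by (intro H1_diff H1_const)

lemma nrm_D_fluct:
  assumes "u \<in> H1" shows "nrm (D (fluct u)) = nrm (D u)"
proof (rule antisym)
  have "nrm (D (fluct u)) \<le> nrm (D u) + nrm (D (\<lambda>e x. fluct u e x - u e x))"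
    using assms by (intro nrm_D_diff_le fluct_H1)
  then show "nrm (D (fluct u)) \<le> nrm (D u)" by (simp add: fluct_def nrm_D_const)
  have "nrm (D u) \<le> nrm (D (fluct u)) + nrm (D (\<lambda>e x. u e x - fluct u e x))"
    using assms by (intro nrm_D_diff_le fluct_H1)
  then show "nrm (D u) \<le> nrm (D (fluct u))" by (simp add: fluct_def nrm_D_const)
qed

lemma integral_fluct:
  assumes "u \<in> H1" "0 < L" shows "graph_integral G len (fluct u) = 0"
proof -
  have "graph_integral G len (fluct u) = graph_integral G len u - graph_integral G len (\<lambda>e x. mean u)"
    unfolding graph_integral_eq fluct_def sum_subtractf[symmetric]
    using H1_L2[OF assms(1)]
    by (intro sum.cong refl Bochner_Integration.integral_diff integrable_lebesgue_on_const L2_interval_integrable) (auto simp: L2_def)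
  also have "\<dots> = 0"
    unfolding graph_integral_const using assms(2) by (simp add: mean_def scaleR_conv_of_real)
  finally show ?thesis .
qed

lemma nrm_sq_decompose:
  assumes "u \<in> H1" "0 < L"
  shows "(nrm u)\<^sup>2 = L * (cmod (mean u))\<^sup>2 + (nrm (fluct u))\<^sup>2"
proof -
  have "u = (\<lambda>e x. fluct u e x + mean u * 1)" by (auto simp: fluct_def)
  then have "(nrm u)\<^sup>2 = (nrm (\<lambda>e x. fluct u e x + mean u * 1))\<^sup>2" by simp
  also have "\<dots> = (nrm (fluct u))\<^sup>2 + 2 * Re (cnj (mean u) * ip (fluct u) (\<lambda>e x. 1)) + (cmod (mean u))\<^sup>2 * (nrm (\<lambda>e x. 1))\<^sup>2"
    using assms by (intro nrm_lincomb_sq H1_L2 fluct_H1 H1_const)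
  also have "ip (fluct u) (\<lambda>e x. 1) = 0"
    using integral_fluct[OF assms] by (simp add: L2_inner_def)
  finally show ?thesis using assms(2) by (simp add: nrm_const)
qed

text \<open>The Poincare inequality, by the definition of \<open>lambda2\<close> as an infimum.\<close>

lemma Poincare_lambda2:
  assumes u: "u \<in> H1" and L: "0 < L"
  shows "lambda2 G len * (nrm (fluct u))\<^sup>2 \<le> (nrm (D u))\<^sup>2"
proof (cases "nrm (fluct u) = 0")
  case False
  let ?S = "{(nrm (D \<phi>))\<^sup>2 / (nrm \<phi>)\<^sup>2 |\<phi>. \<phi> \<in> H1 \<and> (\<exists>e\<in>arcs G. \<exists>x\<in>{0..len e}. \<phi> e x \<noteq> 0) \<and>
            graph_integral G len \<phi> = 0}"
  have "\<exists>e\<in>arcs G. \<exists>x\<in>{0..len e}. fluct u e x \<noteq> 0"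
  proof (rule ccontr)
    assume "\<not> ?thesis"
    then have "graph_integral G len (\<lambda>e x. (cmod (fluct u e x))\<^sup>2) = graph_integral G len (\<lambda>e x. 0)"
      by (intro graph_integral_cong) auto
    then have "(nrm (fluct u))\<^sup>2 = 0" unfolding nrm_sq graph_integral_eq by simp
    with False show False by simp
  qed
  then have "(nrm (D (fluct u)))\<^sup>2 / (nrm (fluct u))\<^sup>2 \<in> ?S"
    using fluct_H1[OF u] integral_fluct[OF u L] by blast
  moreover have "bdd_below ?S" by (rule bdd_belowI[of _ 0]) auto
  ultimately have "lambda2 G len \<le> (nrm (D (fluct u)))\<^sup>2 / (nrm (fluct u))\<^sup>2"
    unfolding lambda2_def by (rule cInf_lower)
  then show ?thesis
    using False nrm_nonneg[of "fluct u"] unfolding nrm_D_fluct[OF u] by (simp add: pos_le_divide_eq)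
qed simp

lemma fluct_le:
  assumes u: "u \<in> H1" and L: "0 < L" and lam: "0 < lambda2 G len"
  shows "nrm (fluct u) \<le> nrm (D u) / sqrt (lambda2 G len)"
proof -
  have "(sqrt (lambda2 G len) * nrm (fluct u))\<^sup>2 \<le> (nrm (D u))\<^sup>2"
    using Poincare_lambda2[OF u L] lam by (simp add: power_mult_distrib)
  then have "sqrt (lambda2 G len) * nrm (fluct u) \<le> nrm (D u)"
    using nrm_nonneg by (rule power2_le_imp_le)
  then show ?thesis using lam by (simp add: pos_le_divide_eq mult.commute)
qed

text \<open>By the Poincare inequality, the supremum of \<open>\<bar>fluct u\<bar>\<close> is bounded by the gradient alone.\<close>

definition osc_const :: real where
  "osc_const = sup_const * (1 + 1 / sqrt (lambda2 G len))"

lemma sup_le_mean: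
  assumes u: "u \<in> H1" and L: "0 < L" and lam: "0 < lambda2 G len"
    and e: "e \<in> arcs G" and x: "x \<in> {0..len e}"
  shows "cmod (u e x) \<le> cmod (mean u) + osc_const * nrm (D u)"
proof -
  have "cmod (fluct u e x) \<le> sup_const * (nrm (D (fluct u)) + nrm (fluct u))"
    by (rule H1_sup_bound[OF fluct_H1[OF u] e x])
  also have "\<dots> \<le> sup_const * (nrm (D u) + nrm (D u) / sqrt (lambda2 G len))"
    unfolding nrm_D_fluct[OF u] using fluct_le[OF u L lam] sup_const_ge_1 by (intro mult_left_mono) auto
  also have "\<dots> = osc_const * nrm (D u)" by (simp add: osc_const_def algebra_simps)
  finally have "cmod (u e x - mean u) \<le> osc_const * nrm (D u)" by (simp add: fluct_def)
  then show ?thesis using norm_triangle_sub[of "u e x" "mean u"] by linarith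
qed

lemma integrable_compose_H1:
  fixes h :: "complex \<Rightarrow> 'b::euclidean_space"
  assumes "u \<in> H1" "continuous_on UNIV h" "e \<in> arcs G"
  shows "integrable (lebesgue_on {0..len e}) (\<lambda>x. h (u e x))"
  using assms by (intro continuous_imp_integrable_real continuous_on_compose2[OF assms(2)] H1_continuous) auto

text \<open>Expansion of \<open>\<parallel>u\<parallel>\<^sub>6\<^sup>6\<close> around the mean \<open>q\<close> of \<open>\<bar>u\<bar>\<^sup>2\<close>; the linear term drops out.\<close>

lemma sextic_expansion:
  assumes u: "u \<in> H1" and q: "(nrm u)\<^sup>2 = L * q"
  shows "graph_integral G len (\<lambda>e x. cmod (u e x) ^ 6)
     = L * q ^ 3 + graph_integral G len (\<lambda>e x. ((cmod (u e x))\<^sup>2 - q)\<^sup>2 * ((cmod (u e x))\<^sup>2 + 2 * q))"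
proof -
  let ?r = "\<lambda>z. ((cmod z)\<^sup>2 - q)\<^sup>2 * ((cmod z)\<^sup>2 + 2 * q)"
  have pt: "cmod z ^ 6 = (3 * q\<^sup>2 * (cmod z)\<^sup>2 - 2 * q ^ 3) + ?r z" for z
  proof -
    have "cmod z ^ 6 = ((cmod z)\<^sup>2) ^ 3" by (simp flip: power_mult)
    then show ?thesis by (simp add: power2_eq_square power3_eq_cube algebra_simps)
  qed
  have i2: "integrable (lebesgue_on {0..len e}) (\<lambda>x. (cmod (u e x))\<^sup>2)"
    and ir: "integrable (lebesgue_on {0..len e}) (\<lambda>x. ?r (u e x))" if "e \<in> arcs G" for e
    by (intro integrable_compose_H1[OF u _ that] continuous_intros)+
  have "integral\<^sup>L (lebesgue_on {0..len e}) (\<lambda>x. cmod (u e x) ^ 6)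
     = 3 * q\<^sup>2 * integral\<^sup>L (lebesgue_on {0..len e}) (\<lambda>x. (cmod (u e x))\<^sup>2)
       - integral\<^sup>L (lebesgue_on {0..len e}) (\<lambda>x. 2 * q ^ 3)
       + integral\<^sup>L (lebesgue_on {0..len e}) (\<lambda>x. ?r (u e x))" if e: "e \<in> arcs G" for e
  proof -
    note i3 = integrable_mult_right[OF i2[OF e], of "3 * q\<^sup>2"]
    note i4 = Bochner_Integration.integrable_diff[OF i3 integrable_lebesgue_on_const[of 0 "len e" "2 * q ^ 3"]]
    show ?thesis
      unfolding pt Bochner_Integration.integral_add[OF i4 ir[OF e]]
        Bochner_Integration.integral_diff[OF i3 integrable_lebesgue_on_const] integral_mult_right_zero ..
  qed
  then have "graph_integral G len (\<lambda>e x. cmod (u e x) ^ 6)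
     = 3 * q\<^sup>2 * (nrm u)\<^sup>2 - graph_integral G len (\<lambda>e x. 2 * q ^ 3) + graph_integral G len (\<lambda>e x. ?r (u e x))"
    unfolding graph_integral_eq nrm_sq by (simp only: sum.distrib sum_subtractf sum_distrib_left cong: sum.cong)
  also have "\<dots> = L * q ^ 3 + graph_integral G len (\<lambda>e x. ?r (u e x))"
    unfolding q graph_integral_const by (simp add: power2_eq_square power3_eq_cube)
  finally show ?thesis .
qed

lemma graph_integral_real_mono:
  fixes f g :: "'e \<Rightarrow> real \<Rightarrow> real"
  assumes "\<And>e. e \<in> arcs G \<Longrightarrow> integrable (lebesgue_on {0..len e}) (f e)"
    and "\<And>e. e \<in> arcs G \<Longrightarrow> integrable (lebesgue_on {0..len e}) (g e)"
    and "\<And>e x. e \<in> arcs G \<Longrightarrow> x \<in> {0..len e} \<Longrightarrow> f e x \<le> g e x"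
  shows "graph_integral G len f \<le> graph_integral G len g"
  unfolding graph_integral_eq using assms by (intro sum_mono integral_mono) auto

lemma sextic_lower:
  assumes u: "u \<in> H1" and q: "(nrm u)\<^sup>2 = L * q" "0 \<le> q"
  shows "L * q ^ 3 \<le> graph_integral G len (\<lambda>e x. cmod (u e x) ^ 6)"
proof -
  have "0 \<le> graph_integral G len (\<lambda>e x. ((cmod (u e x))\<^sup>2 - q)\<^sup>2 * ((cmod (u e x))\<^sup>2 + 2 * q))"
    unfolding graph_integral_eq using q(2) by (intro sum_nonneg integral_nonneg mult_nonneg_nonneg add_nonneg_nonneg) auto
  then show ?thesis unfolding sextic_expansion[OF u q(1)] by simp
qed

text \<open>The integral of \<open>(\<bar>u\<bar>\<^sup>2 - q)\<^sup>2\<close> only increases when the mean \<open>q\<close> of \<open>\<bar>u\<bar>\<^sup>2\<close> is replaced by \<open>\<bar>mean u\<bar>\<^sup>2\<close>,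
  and \<open>\<bar>u\<bar>\<^sup>2 - \<bar>mean u\<bar>\<^sup>2\<close> is at most \<open>2 K \<bar>fluct u\<bar>\<close> in modulus.\<close>

lemma sextic_upper:
  assumes u: "u \<in> H1" and L: "0 < L" and q: "(nrm u)\<^sup>2 = L * q" "0 \<le> q" "q \<le> K\<^sup>2" "0 \<le> K"
    and K: "\<And>e x. e \<in> arcs G \<Longrightarrow> x \<in> {0..len e} \<Longrightarrow> cmod (u e x) \<le> K"
  shows "graph_integral G len (\<lambda>e x. cmod (u e x) ^ 6) \<le> L * q ^ 3 + 12 * K ^ 4 * (nrm (fluct u))\<^sup>2"
proof -
  let ?c = "cmod (mean u)"
  let ?I = "\<lambda>h. graph_integral G len (\<lambda>e x. h (u e x) :: real)"
  have int: "integrable (lebesgue_on {0..len e}) (\<lambda>x. h (u e x) :: real)" if "continuous_on UNIV h" "e \<in> arcs G" for h e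
    by (rule integrable_compose_H1[OF u that])
  have c: "?c\<^sup>2 \<le> q"
    using nrm_sq_decompose[OF u L] q(1) L by (metis add_increasing2 eq_iff mult_le_cancel_left_pos zero_le_power2)
  with q have cK: "?c \<le> K" by (meson order_trans power2_le_imp_le)
  have 1: "?I (\<lambda>z. ((cmod z)\<^sup>2 - q)\<^sup>2 * ((cmod z)\<^sup>2 + 2 * q)) \<le> ?I (\<lambda>z. ((cmod z)\<^sup>2 - q)\<^sup>2 * (3 * K\<^sup>2))"
  proof (rule graph_integral_real_mono)
    fix e x assume "e \<in> arcs G" "x \<in> {0..len e}"
    then have "(cmod (u e x))\<^sup>2 \<le> K\<^sup>2" using K by (intro power_mono) auto
    then show "((cmod (u e x))\<^sup>2 - q)\<^sup>2 * ((cmod (u e x))\<^sup>2 + 2 * q) \<le> ((cmod (u e x))\<^sup>2 - q)\<^sup>2 * (3 * K\<^sup>2)"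
      using q(3) by (intro mult_left_mono) auto
  qed (intro int continuous_intros; assumption)+
  have 2: "?I (\<lambda>z. ((cmod z)\<^sup>2 - q)\<^sup>2 * (3 * K\<^sup>2)) = 3 * K\<^sup>2 * ?I (\<lambda>z. ((cmod z)\<^sup>2 - q)\<^sup>2)"
    unfolding graph_integral_eq by (simp add: sum_distrib_left sum_distrib_right mult_ac)
  have 3: "?I (\<lambda>z. ((cmod z)\<^sup>2 - q)\<^sup>2) \<le> ?I (\<lambda>z. ((cmod z)\<^sup>2 - ?c\<^sup>2)\<^sup>2)"
  proof -
    have i1: "integrable (lebesgue_on {0..len e}) (\<lambda>x. ((cmod (u e x))\<^sup>2 - q)\<^sup>2)"
      and i2: "integrable (lebesgue_on {0..len e}) (\<lambda>x. (cmod (u e x))\<^sup>2)" if "e \<in> arcs G" for e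
      by (intro int[OF _ that] continuous_intros)+
    let ?k = "q - ?c\<^sup>2"
    have pt: "((cmod z)\<^sup>2 - ?c\<^sup>2)\<^sup>2 = ((cmod z)\<^sup>2 - q)\<^sup>2 + (2 * ?k * (cmod z)\<^sup>2 + (?k\<^sup>2 - 2 * ?k * q))" for z
      by (simp add: power2_eq_square algebra_simps)
    have "integral\<^sup>L (lebesgue_on {0..len e}) (\<lambda>x. ((cmod (u e x))\<^sup>2 - ?c\<^sup>2)\<^sup>2)
      = integral\<^sup>L (lebesgue_on {0..len e}) (\<lambda>x. ((cmod (u e x))\<^sup>2 - q)\<^sup>2)
       + (2 * ?k * integral\<^sup>L (lebesgue_on {0..len e}) (\<lambda>x. (cmod (u e x))\<^sup>2)
        + integral\<^sup>L (lebesgue_on {0..len e}) (\<lambda>x. ?k\<^sup>2 - 2 * ?k * q))" if e: "e \<in> arcs G" for e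
    proof -
      note i3 = integrable_mult_right[OF i2[OF e], of "2 * ?k"]
      note i4 = Bochner_Integration.integrable_add[OF i3 integrable_lebesgue_on_const[of 0 "len e" "?k\<^sup>2 - 2 * ?k * q"]]
      show ?thesis
        unfolding pt Bochner_Integration.integral_add[OF i1[OF e] i4]
          Bochner_Integration.integral_add[OF i3 integrable_lebesgue_on_const] integral_mult_right_zero ..
    qed
    then have "?I (\<lambda>z. ((cmod z)\<^sup>2 - ?c\<^sup>2)\<^sup>2)
       = ?I (\<lambda>z. ((cmod z)\<^sup>2 - q)\<^sup>2) + (2 * ?k * (nrm u)\<^sup>2 + graph_integral G len (\<lambda>e x. ?k\<^sup>2 - 2 * ?k * q))"
      unfolding graph_integral_eq nrm_sq by (simp only: sum.distrib sum_distrib_left cong: sum.cong)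
    also have "2 * ?k * (nrm u)\<^sup>2 + graph_integral G len (\<lambda>e x. ?k\<^sup>2 - 2 * ?k * q) = L * ?k\<^sup>2"
      unfolding q(1) graph_integral_const by (simp add: algebra_simps)
    finally show ?thesis using L by simp
  qed
  have 4: "?I (\<lambda>z. ((cmod z)\<^sup>2 - ?c\<^sup>2)\<^sup>2) \<le> ?I (\<lambda>z. 4 * K\<^sup>2 * (cmod (z - mean u))\<^sup>2)"
  proof (rule graph_integral_real_mono)
    fix e x assume ex: "e \<in> arcs G" "x \<in> {0..len e}"
    let ?z = "u e x"
    have "\<bar>cmod ?z - ?c\<bar> \<le> cmod (?z - mean u)" by (rule norm_triangle_ineq3)
    moreover have "cmod ?z + ?c \<le> 2 * K" using K[OF ex] cK by linarith
    ultimately have "\<bar>cmod ?z - ?c\<bar> * (cmod ?z + ?c) \<le> cmod (?z - mean u) * (2 * K)"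
      by (intro mult_mono) auto
    then have "(\<bar>cmod ?z - ?c\<bar> * (cmod ?z + ?c))\<^sup>2 \<le> (cmod (?z - mean u) * (2 * K))\<^sup>2"
      by (intro power_mono) auto
    moreover have "(\<bar>cmod ?z - ?c\<bar> * (cmod ?z + ?c))\<^sup>2 = ((cmod ?z)\<^sup>2 - ?c\<^sup>2)\<^sup>2"
      unfolding power_mult_distrib power2_abs by (simp add: power2_eq_square algebra_simps)
    ultimately show "((cmod ?z)\<^sup>2 - ?c\<^sup>2)\<^sup>2 \<le> 4 * K\<^sup>2 * (cmod (?z - mean u))\<^sup>2"
      by (simp add: power_mult_distrib mult_ac)
  qed (intro int continuous_intros; assumption)+
  have 5: "?I (\<lambda>z. 4 * K\<^sup>2 * (cmod (z - mean u))\<^sup>2) = 4 * K\<^sup>2 * (nrm (fluct u))\<^sup>2"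
    unfolding graph_integral_eq nrm_sq fluct_def by (simp add: sum_distrib_left)
  have "?I (\<lambda>z. ((cmod z)\<^sup>2 - q)\<^sup>2) \<le> 4 * K\<^sup>2 * (nrm (fluct u))\<^sup>2"
    using 3 4 5 by linarith
  then have "3 * K\<^sup>2 * ?I (\<lambda>z. ((cmod z)\<^sup>2 - q)\<^sup>2) \<le> 3 * K\<^sup>2 * (4 * K\<^sup>2 * (nrm (fluct u))\<^sup>2)"
    by (intro mult_left_mono) auto
  also have "\<dots> = 12 * K ^ 4 * (nrm (fluct u))\<^sup>2"
    by (simp add: power2_eq_square power4_eq_xxxx)
  finally show ?thesis
    unfolding sextic_expansion[OF u q(1)] using 1 2 by linarith
qed

text \<open>Coercivity of the energy near the constants. The coefficient is positive if \<open>4 K\<^sup>4 < \<lambda>\<^sub>2\<close>.\<close>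

lemma energy_coercive:
  assumes u: "u \<in> H1" and L: "0 < L" and lam: "0 < lambda2 G len"
    and q: "(nrm u)\<^sup>2 = L * q" "0 \<le> q" "q \<le> K\<^sup>2" "0 \<le> K"
    and K: "\<And>e x. e \<in> arcs G \<Longrightarrow> x \<in> {0..len e} \<Longrightarrow> cmod (u e x) \<le> K"
  shows "(1 - 4 * K ^ 4 / lambda2 G len) * (nrm (D u))\<^sup>2
     \<le> (nrm (D u))\<^sup>2 - graph_integral G len (\<lambda>e x. cmod (u e x) ^ 6) / 3 + L * q ^ 3 / 3"
proof -
  have "(nrm (fluct u))\<^sup>2 \<le> (nrm (D u))\<^sup>2 / lambda2 G len"
    using Poincare_lambda2[OF u L] lam by (simp add: pos_le_divide_eq mult.commute)
  then have "4 * K ^ 4 * (nrm (fluct u))\<^sup>2 \<le> 4 * K ^ 4 * ((nrm (D u))\<^sup>2 / lambda2 G len)"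
    using q(4) by (intro mult_left_mono) auto
  moreover have "graph_integral G len (\<lambda>e x. cmod (u e x) ^ 6) \<le> L * q ^ 3 + 12 * K ^ 4 * (nrm (fluct u))\<^sup>2"
    using u L q K by (rule sextic_upper)
  ultimately show ?thesis by (simp add: algebra_simps)
qed

text \<open>The distance to the orbit of a constant, in terms of the gradient and of the mass.\<close>

lemma orbit_dist_le:
  assumes "u \<in> H1"
  shows "orbit_dist G len w u \<le> H1_norm G len (\<lambda>e x. u e x - cis \<theta> * w e x)"
  unfolding orbit_dist_def
  by (rule cINF_lower) (auto intro!: bdd_belowI[of _ 0] simp: H1_norm_def nrm_nonneg add_nonneg_nonneg)

lemma orbit_dist_const_le:
  assumes u: "u \<in> H1" and L: "0 < L" and lam: "0 < lambda2 G len" and k: "0 \<le> \<kappa>"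
  shows "orbit_dist G len (\<lambda>e x. complex_of_real \<kappa>) u
    \<le> (1 + 2 / sqrt (lambda2 G len)) * nrm (D u) + \<bar>nrm u - \<kappa> * sqrt L\<bar>"
proof -
  \<comment> \<open>The phase of the mean aligns the constant with \<open>u\<close>.\<close>
  let ?c = "mean u" and ?\<theta> = "Arg (mean u)"
  let ?d = "nrm (D u) / sqrt (lambda2 G len)"
  have c: "?c = complex_of_real (cmod ?c) * cis ?\<theta>"
    using rcis_cmod_Arg[of ?c] by (simp add: rcis_def)
  have "complex_of_real (cmod ?c - \<kappa>) * cis ?\<theta> = ?c - cis ?\<theta> * complex_of_real \<kappa>"
    unfolding of_real_diff left_diff_distrib c[symmetric] by (simp add: mult.commute)
  then have eq: "(\<lambda>e x. u e x - cis ?\<theta> * complex_of_real \<kappa>)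
      = (\<lambda>e x. fluct u e x + (complex_of_real (cmod ?c - \<kappa>) * cis ?\<theta>) * 1)"
    by (simp add: fluct_def)
  have f: "nrm (fluct u) \<le> ?d" by (rule fluct_le[OF u L lam])
  have "nrm (\<lambda>e x. fluct u e x + (complex_of_real (cmod ?c - \<kappa>) * cis ?\<theta>) * 1)
      \<le> nrm (fluct u) + cmod (complex_of_real (cmod ?c - \<kappa>) * cis ?\<theta>) * nrm (\<lambda>e x. 1)"
    using u by (intro nrm_lincomb_le H1_L2 fluct_H1 H1_const)
  also have "cmod (complex_of_real (cmod ?c - \<kappa>) * cis ?\<theta>) * nrm (\<lambda>e x. 1) = \<bar>cmod ?c * sqrt L - \<kappa> * sqrt L\<bar>"
    using L unfolding norm_mult norm_of_real norm_cis nrm_const left_diff_distrib[symmetric] abs_mult by simp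
  also have "\<bar>cmod ?c * sqrt L - \<kappa> * sqrt L\<bar> \<le> \<bar>nrm u - \<kappa> * sqrt L\<bar> + nrm (fluct u)"
  proof -
    have sq: "(nrm u)\<^sup>2 = (cmod ?c * sqrt L)\<^sup>2 + (nrm (fluct u))\<^sup>2"
      using nrm_sq_decompose[OF u L] L by (simp add: power_mult_distrib mult.commute)
    have nn: "0 \<le> cmod ?c * sqrt L" "0 \<le> nrm (fluct u)" using L nrm_nonneg by auto
    have "cmod ?c * sqrt L \<le> nrm u"
      by (rule power2_le_imp_le) (use sq nrm_nonneg in auto)
    moreover have "nrm u \<le> cmod ?c * sqrt L + nrm (fluct u)"
    proof (rule power2_le_imp_le)
      show "(nrm u)\<^sup>2 \<le> (cmod ?c * sqrt L + nrm (fluct u))\<^sup>2"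
        unfolding sq power2_sum using mult_nonneg_nonneg[OF nn] by (simp add: mult_ac)
    qed (use nn in auto)
    ultimately show ?thesis by linarith
  qed
  finally have 1: "nrm (\<lambda>e x. u e x - cis ?\<theta> * complex_of_real \<kappa>) \<le> 2 * ?d + \<bar>nrm u - \<kappa> * sqrt L\<bar>"
    unfolding eq using f by linarith
  have "nrm (D (\<lambda>e x. u e x - cis ?\<theta> * complex_of_real \<kappa>)) \<le> nrm (D u)"
    using nrm_D_diff_le[OF H1_diff[OF u H1_const] u, of "cis ?\<theta> * complex_of_real \<kappa>"]
    by (simp add: nrm_D_const)
  with 1 have "H1_norm G len (\<lambda>e x. u e x - cis ?\<theta> * complex_of_real \<kappa>)
      \<le> (1 + 2 / sqrt (lambda2 G len)) * nrm (D u) + \<bar>nrm u - \<kappa> * sqrt L\<bar>"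
    by (simp add: H1_norm_def algebra_simps)
  then show ?thesis using orbit_dist_le[OF u, of "\<lambda>e x. complex_of_real \<kappa>" ?\<theta>] by linarith
qed

text \<open>Conversely, the distance to the orbit bounds the gradient and the deviation of the mass. Note that
  \<open>\<kappa> sqrt L\<close> is the norm of the constant \<open>\<kappa>\<close> in \<open>L2\<close>.\<close>

lemma orbit_dist_const_lessD:
  assumes u: "u \<in> H1" and k: "0 \<le> \<kappa>" and d: "orbit_dist G len (\<lambda>e x. complex_of_real \<kappa>) u < \<delta>"
  shows "nrm (D u) < \<delta>" "\<bar>nrm u - \<kappa> * sqrt L\<bar> < \<delta>"
proof -
  obtain \<theta> where \<theta>: "H1_norm G len (\<lambda>e x. u e x - cis \<theta> * complex_of_real \<kappa>) < \<delta>"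
    using d unfolding orbit_dist_def
    by (subst (asm) cINF_less_iff) (auto intro!: bdd_belowI[of _ 0] simp: H1_norm_def nrm_nonneg add_nonneg_nonneg)
  let ?w = "\<lambda>(e::'e) (x::real). cis \<theta> * complex_of_real \<kappa>"
  let ?r = "\<lambda>e x. u e x - cis \<theta> * complex_of_real \<kappa>"
  have r: "?r \<in> H1" "?w \<in> H1" using u by (auto intro: H1_diff H1_const)
  have "nrm (D u) \<le> nrm (D ?w) + nrm (D ?r)" using u r by (intro nrm_D_diff_le)
  then show "nrm (D u) < \<delta>" using \<theta> nrm_nonneg[of ?r] by (simp add: nrm_D_const H1_norm_def)
  have nw: "nrm ?w = \<kappa> * sqrt L" using k by (simp add: nrm_const norm_mult)
  have "nrm (\<lambda>e x. ?r e x + 1 * ?w e x) \<le> nrm ?r + cmod 1 * nrm ?w"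
    using r by (intro nrm_lincomb_le H1_L2)
  moreover have "nrm (\<lambda>e x. u e x - ?r e x) \<le> nrm u + nrm ?r"
    using r u by (intro nrm_diff_le H1_L2)
  ultimately have "\<bar>nrm u - nrm ?w\<bar> \<le> nrm ?r" by simp
  then show "\<bar>nrm u - \<kappa> * sqrt L\<bar> < \<delta>"
    using \<theta> nrm_nonneg[of "D ?r"] unfolding nw by (simp add: H1_norm_def)
qed


end

lemma (in nls_flow) continuous_on_nrm_D: "continuous_on J (\<lambda>t. nrm (D (v t)))"
proof -
  have "continuous_on J (\<lambda>t. (\<lambda>(s, t). A s t) (t, t))"
    by (intro continuous_on_compose2[OF continuous_on_A] continuous_on_Pair continuous_on_id) auto
  then have "continuous_on J (\<lambda>t. sqrt (Re (A t t)))"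
    by (intro continuous_intros) simp
  then show ?thesis unfolding A_diag using nrm_nonneg by (simp add: real_sqrt_unique)
qed

text \<open>As long as the gradient is small, coercivity and the conservation laws improve its bound;
  by continuity in time it remains small.\<close>

lemma (in nls_flow) gradient_stays_small:
  assumes L: "0 < L" and lam: "0 < lambda2 G len"
    and K: "0 \<le> K" "4 * K ^ 4 < lambda2 G len"
    and r: "nrm (v 0) / sqrt L + r \<le> K"
    and small: "osc_const * nrm (D (v 0)) < r * sqrt (1 - 4 * K ^ 4 / lambda2 G len)"
    and t: "t \<in> J"
  shows "nrm (D (v t)) * sqrt (1 - 4 * K ^ 4 / lambda2 G len) \<le> nrm (D (v 0))"
proof -
  define \<eta> where "\<eta> = sqrt (1 - 4 * K ^ 4 / lambda2 G len)"
  have \<eta>: "0 < \<eta>" "\<eta> \<le> 1" "\<eta>\<^sup>2 = 1 - 4 * K ^ 4 / lambda2 G len"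
    using K lam by (auto simp: \<eta>_def)
  define q where "q = (nrm (v 0))\<^sup>2 / L"
  have q: "0 \<le> q" "(nrm (v 0))\<^sup>2 = L * q" using L by (auto simp: q_def)
  have osc: "0 \<le> osc_const"
    using sup_const_ge_1 lam by (auto simp: osc_const_def intro!: mult_nonneg_nonneg add_nonneg_nonneg)
  have "0 \<le> osc_const * nrm (D (v 0))" using osc nrm_nonneg by simp
  then have "0 < r * \<eta>" using small by (simp add: \<eta>_def)
  then have r0: "0 < r" using \<eta>(1) by (simp add: zero_less_mult_iff)
  have "(nrm (v 0) / sqrt L)\<^sup>2 \<le> K\<^sup>2"
    using r r0 nrm_nonneg[of "v 0"] L by (intro power_mono) auto
  then have qK: "q \<le> K\<^sup>2" using L by (simp add: q_def power_divide)
  have improve: "nrm (D (v s)) * \<eta> \<le> nrm (D (v 0))" if s: "s \<in> J" "osc_const * nrm (D (v s)) \<le> r" for s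
  proof -
    have qs: "(nrm (v s))\<^sup>2 = L * q" using mass_conservation[OF s(1)] q by simp
    have "L * (cmod (mean (v s)))\<^sup>2 \<le> (nrm (v 0))\<^sup>2"
      using nrm_sq_decompose[OF v_H1[OF s(1)] L] mass_conservation[OF s(1)] by simp
    then have "(cmod (mean (v s)))\<^sup>2 \<le> (nrm (v 0) / sqrt L)\<^sup>2"
      using L by (simp add: power_divide pos_le_divide_eq mult.commute)
    then have m: "cmod (mean (v s)) \<le> nrm (v 0) / sqrt L"
      by (rule power2_le_imp_le) (use nrm_nonneg L in auto)
    have "cmod (v s e x) \<le> K" if "e \<in> arcs G" "x \<in> {0..len e}" for e x
      using sup_le_mean[OF v_H1[OF s(1)] L lam that] m s(2) r by linarith
    from energy_coercive[OF v_H1[OF s(1)] L lam qs q(1) qK K(1) this]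
    have "\<eta>\<^sup>2 * (nrm (D (v s)))\<^sup>2 \<le> (nrm (D (v s)))\<^sup>2 - S6 s / 3 + L * q ^ 3 / 3"
      unfolding \<eta>(3) S6_def .
    also have "\<dots> = (nrm (D (v 0)))\<^sup>2 - S6 0 / 3 + L * q ^ 3 / 3"
      using energy_conservation[OF s(1)] by simp
    also have "\<dots> \<le> (nrm (D (v 0)))\<^sup>2"
      using sextic_lower[OF v_H1[OF zero_in_J] q(2,1)] by (simp add: S6_def)
    finally have "(nrm (D (v s)) * \<eta>)\<^sup>2 \<le> (nrm (D (v 0)))\<^sup>2" by (simp add: power_mult_distrib mult.commute)
    then show ?thesis using nrm_nonneg by (rule power2_le_imp_le)
  qed
  have less: "osc_const * nrm (D (v s)) < r" if "s \<in> J" "osc_const * nrm (D (v s)) \<le> r" for s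
  proof -
    have "(osc_const * nrm (D (v s))) * \<eta> \<le> osc_const * nrm (D (v 0))"
      using mult_left_mono[OF improve[OF that] osc] by (simp add: mult.assoc)
    also have "\<dots> < r * \<eta>" using small by (simp add: \<eta>_def)
    finally show ?thesis using \<eta>(1) by simp
  qed
  have "osc_const * nrm (D (v t)) \<le> r"
  proof (rule ccontr)
    assume big: "\<not> ?thesis"
    have "osc_const * nrm (D (v 0)) < r * \<eta>" using small by (simp add: \<eta>_def)
    also have "\<dots> \<le> r" using r0 \<eta> by (simp add: mult_left_le)
    finally have "osc_const * nrm (D (v 0)) \<le> r" by simp
    moreover have "0 \<le> t" using t by (simp add: J_def)
    moreover have "continuous_on {0..t} (\<lambda>s. osc_const * nrm (D (v s)))"
      by (intro continuous_intros continuous_on_subset[OF continuous_on_nrm_D] Icc_subset_J t)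
    ultimately obtain s where s: "0 \<le> s" "s \<le> t" "osc_const * nrm (D (v s)) = r"
      using IVT'[of "\<lambda>s. osc_const * nrm (D (v s))" 0 r t] big by auto
    have "s \<in> J" using s(1,2) t by (rule J_interval)
    from less[OF this] s(3) show False by simp
  qed
  from improve[OF t this] show ?thesis by (simp add: \<eta>_def)
qed

text \<open>The hypothesis \<open>\<mu> < \<mu>1\<close> says that \<open>4 \<kappa>\<^sup>4 < \<lambda>\<^sub>2\<close>. In particular \<open>\<lambda>\<^sub>2 > 0\<close>, so that the
  Poincare inequality bounds \<open>fluct\<close> by the gradient.\<close>

theorem (in finite_metric_graph) constant_orbitally_stable:
  assumes L: "0 < L" and \<mu>: "0 < \<mu>" "\<mu> < \<mu>1 G len"
  shows "orbitally_stable G len (\<lambda>e x. complex_of_real (sqrt (\<mu> / L)))"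
proof -
  let ?\<kappa> = "sqrt (\<mu> / L)"
  have k: "0 < ?\<kappa>" using L \<mu> by simp
  have kL: "?\<kappa> * sqrt L = sqrt \<mu>" using L by (simp add: real_sqrt_divide)
  have ml: "\<mu> / L < sqrt (lambda2 G len / 4)"
    using \<mu>(2) L by (simp add: \<mu>1_def pos_divide_less_eq mult.commute)
  have "0 < \<mu> / L" using \<mu> L by simp
  with ml have "0 < sqrt (lambda2 G len / 4)" by linarith
  then have lam: "0 < lambda2 G len" by simp
  have "(\<mu> / L)\<^sup>2 < (sqrt (lambda2 G len / 4))\<^sup>2"
    using ml \<open>0 < \<mu> / L\<close> by (intro power_strict_mono) auto
  then have "4 * (\<mu> / L)\<^sup>2 < lambda2 G len" using lam by simp
  moreover have "?\<kappa> ^ 4 = (\<mu> / L)\<^sup>2"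
  proof -
    have "?\<kappa> ^ 4 = (?\<kappa>\<^sup>2)\<^sup>2" by (simp only: power_mult[symmetric]) simp
    then show ?thesis using \<mu> L by simp
  qed
  ultimately have k4: "4 * ?\<kappa> ^ 4 < lambda2 G len" by simp
  obtain K where K: "?\<kappa> < K" "4 * K ^ 4 < lambda2 G len"
  proof -
    have "((\<lambda>K. 4 * K ^ 4) \<longlongrightarrow> 4 * ?\<kappa> ^ 4) (at_right ?\<kappa>)" by (intro tendsto_intros)
    from order_tendstoD(2)[OF this k4] have "\<forall>\<^sub>F K in at_right ?\<kappa>. 4 * K ^ 4 < lambda2 G len" .
    with eventually_at_right_less[of ?\<kappa>] have "\<forall>\<^sub>F K in at_right ?\<kappa>. ?\<kappa> < K \<and> 4 * K ^ 4 < lambda2 G len"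
      by eventually_elim simp
    then have "\<exists>K. ?\<kappa> < K \<and> 4 * K ^ 4 < lambda2 G len"
      by (rule eventually_happens'[rotated]) simp
    then show ?thesis using that by blast
  qed
  have K0: "0 \<le> K" using K k by linarith
  define \<eta> where "\<eta> = sqrt (1 - 4 * K ^ 4 / lambda2 G len)"
  have \<eta>: "0 < \<eta>" using K lam by (simp add: \<eta>_def)
  \<comment> \<open>Half of the gap between \<open>\<kappa>\<close> and \<open>K\<close> absorbs the deviation of the mass, half the oscillation of the solution.\<close>
  define r where "r = (K - ?\<kappa>) / 2"
  have r: "0 < r" using K by (simp add: r_def)
  have osc: "0 < osc_const"
    unfolding osc_const_def using sup_const_ge_1 lam by (intro mult_pos_pos add_pos_pos) auto
  define C where "C = (1 + 2 / sqrt (lambda2 G len)) / \<eta> + 1"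
  have C: "0 < C" using lam \<eta> by (auto simp: C_def intro!: add_pos_pos divide_pos_pos)
  show ?thesis
    unfolding orbitally_stable_def
  proof (intro allI impI)
    fix \<epsilon> :: real assume e: "0 < \<epsilon>"
    define \<delta> where "\<delta> = min (\<epsilon> / (2 * C)) (min (r * \<eta> / osc_const) (r * sqrt L))"
    have \<delta>0: "0 < \<delta>" using e C r \<eta> osc L by (simp add: \<delta>_def)
    have \<delta>: "\<delta> \<le> \<epsilon> / (2 * C)" "\<delta> \<le> r * \<eta> / osc_const" "\<delta> \<le> r * sqrt L" by (auto simp: \<delta>_def)
    show "\<exists>\<delta>>0. \<forall>v0\<in>H1. orbit_dist G len (\<lambda>e x. complex_of_real ?\<kappa>) v0 < \<delta> \<longrightarrow>
        (\<forall>T v. nls_solution G len T v \<and> v 0 = v0 \<longrightarrow>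
           (SUP t\<in>{t. 0 \<le> t \<and> ereal t < T}. ereal (orbit_dist G len (\<lambda>e x. complex_of_real ?\<kappa>) (v t))) < ereal \<epsilon>)"
    proof (intro exI[of _ \<delta>] conjI ballI impI allI \<delta>0)
      fix v0 T v
      assume v0: "v0 \<in> H1" and d: "orbit_dist G len (\<lambda>e x. complex_of_real ?\<kappa>) v0 < \<delta>"
        and sol: "nls_solution G len T v \<and> v 0 = v0"
      interpret nls_flow G len T v by unfold_locales (use sol in simp)
      have D0: "nrm (D (v 0)) < \<delta>" and m0: "\<bar>nrm (v 0) - ?\<kappa> * sqrt L\<bar> < \<delta>"
        using orbit_dist_const_lessD[OF v0 _ d] k sol by auto
      have "nrm (v 0) \<le> (?\<kappa> + r) * sqrt L"
        using m0 \<delta>(3) unfolding distrib_right by linarith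
      then have "nrm (v 0) / sqrt L \<le> ?\<kappa> + r" using L by (simp add: pos_divide_le_eq)
      then have rK: "nrm (v 0) / sqrt L + r \<le> K" unfolding r_def by (simp add: field_simps)
      have "osc_const * nrm (D (v 0)) < osc_const * \<delta>" using D0 osc by simp
      also have "\<dots> \<le> r * \<eta>" using \<delta>(2) osc by (simp add: pos_le_divide_eq mult.commute)
      finally have small: "osc_const * nrm (D (v 0)) < r * \<eta>" .
      \<comment> \<open>The bound by \<open>\<epsilon> / 2\<close> leaves room for the strict inequality on the supremum.\<close>
      have bound: "orbit_dist G len (\<lambda>e x. complex_of_real ?\<kappa>) (v t) \<le> \<epsilon> / 2" if t: "t \<in> J" for t
      proof -
        have "nrm (D (v t)) * \<eta> \<le> nrm (D (v 0))"
          using gradient_stays_small[OF L lam K0 K(2) rK small[unfolded \<eta>_def] t] by (simp add: \<eta>_def)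
        then have "nrm (D (v t)) \<le> \<delta> / \<eta>" using D0 \<eta> by (simp add: pos_le_divide_eq)
        then have "(1 + 2 / sqrt (lambda2 G len)) * nrm (D (v t)) \<le> (1 + 2 / sqrt (lambda2 G len)) * (\<delta> / \<eta>)"
          using lam by (intro mult_left_mono) auto
        moreover have "\<bar>nrm (v t) - ?\<kappa> * sqrt L\<bar> \<le> \<delta>" using m0 mass_conservation[OF t] by simp
        ultimately have "orbit_dist G len (\<lambda>e x. complex_of_real ?\<kappa>) (v t)
            \<le> (1 + 2 / sqrt (lambda2 G len)) * (\<delta> / \<eta>) + \<delta>"
          using orbit_dist_const_le[OF v_H1[OF t] L lam, of ?\<kappa>] k by linarith
        also have "\<dots> = C * \<delta>" by (simp add: C_def algebra_simps add_divide_distrib)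
        also have "\<dots> \<le> \<epsilon> / 2" using \<delta>(1) C by (simp add: pos_le_divide_eq mult_ac)
        finally show ?thesis .
      qed
      have "(SUP t\<in>{t. 0 \<le> t \<and> ereal t < T}. ereal (orbit_dist G len (\<lambda>e x. complex_of_real ?\<kappa>) (v t))) \<le> ereal (\<epsilon> / 2)"
        using bound by (intro SUP_least) (auto simp: J_def)
      also have "\<dots> < ereal \<epsilon>" using e by simp
      finally show "(SUP t\<in>{t. 0 \<le> t \<and> ereal t < T}. ereal (orbit_dist G len (\<lambda>e x. complex_of_real ?\<kappa>) (v t))) < ereal \<epsilon>" .
    qed
  qed
qed

section \<open>The constant as a stationary solution\<close>

text \<open>The selected weak derivative of a constant is a null function, not literally \<open>0\<close>; this is enough for
  it to have the weak derivative \<open>0\<close>.\<close>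

lemma weak_deriv_weak_deriv_const:
  shows "weak_deriv l (\<lambda>_. c) \<in> H1_interval l"
    and "AE x in lebesgue. x \<in> {0..l} \<longrightarrow> weak_deriv l (weak_deriv l (\<lambda>_. c)) x = 0"
proof -
  let ?g = "weak_deriv l (\<lambda>_. c)"
  have g: "?g \<in> L2_interval l" by (rule weak_deriv_props(1)[OF H1_interval_const])
  have 0: "(\<lambda>_. 0) \<in> L2_interval l" by (intro L2_interval_continuous continuous_intros)
  have w: "has_weak_deriv l ?g (\<lambda>_. 0)"
    unfolding has_weak_deriv_def set_LINT_eq_lebesgue_on
  proof (intro allI impI)
    fix \<phi> assume t: "test_function l \<phi>"
    have "integral\<^sup>L (lebesgue_on {0..l}) (\<lambda>x. complex_of_real (deriv \<phi> x) * ?g x) = 0"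
    proof (rule integral_eq_zero_AE)
      show "AE x in lebesgue_on {0..l}. complex_of_real (deriv \<phi> x) * ?g x = 0"
        using weak_deriv_const_AE[of l c] unfolding AE_lebesgue_on_Icc by eventually_elim auto
    qed
    then show "integral\<^sup>L (lebesgue_on {0..l}) (\<lambda>x. complex_of_real (deriv \<phi> x) * ?g x)
        = - integral\<^sup>L (lebesgue_on {0..l}) (\<lambda>x. complex_of_real (\<phi> x) * 0)" by simp
  qed
  show h: "?g \<in> H1_interval l" unfolding H1_interval_def using g 0 w by blast
  show "AE x in lebesgue. x \<in> {0..l} \<longrightarrow> weak_deriv l ?g x = 0"
    using weak_deriv_unique_AE[OF g weak_deriv_props(1)[OF h] 0 weak_deriv_props(2)[OF h] w] .
qed

context finite_metric_graph
begin

lemma const_H2K: "(\<lambda>e x. c) \<in> H2K_graph G len"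
  unfolding H2K_graph_def mem_Collect_eq
proof (intro conjI ballI)
  show "(\<lambda>e x. c) \<in> H1_graph G len" by (rule H1_const)
  show "(\<lambda>x. c) \<in> H2_interval (len e)" for e
    unfolding H2_interval_def
    using H1_interval_L2[OF H1_interval_const] weak_deriv_weak_deriv_const(1) weak_deriv_props(2)[OF H1_interval_const] by blast
  have v: "vector_derivative (\<lambda>x. c) (at y within {0..len e}) = 0" if "e \<in> arcs G" "y \<in> {0..len e}" for e y
    using that len_pos[OF that(1)]
    by (intro vector_derivative_within_cbox[of 0 "len e", simplified]) (auto intro: derivative_eq_intros)
  show "kirchhoff G len (\<lambda>e x. c)"
    unfolding kirchhoff_def
  proof
    fix w assume "w \<in> verts G"
    have "(\<Sum>e\<in>out_arcs G w. vector_derivative (\<lambda>x. c) (at 0 within {0..len e})) = 0"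
      using len_pos by (intro sum.neutral ballI v) (auto simp: out_arcs_def less_imp_le)
    moreover have "(\<Sum>e\<in>in_arcs G w. vector_derivative (\<lambda>x. c) (at (len e) within {0..len e})) = 0"
      using len_pos by (intro sum.neutral ballI v) (auto simp: in_arcs_def less_imp_le)
    ultimately show "(\<Sum>e\<in>out_arcs G w. vector_derivative (\<lambda>x. c) (at 0 within {0..len e})) -
        (\<Sum>e\<in>in_arcs G w. vector_derivative (\<lambda>x. c) (at (len e) within {0..len e})) = 0" by simp
  qed
qed

lemma const_stationary: "stationary_nls G len (cmod c ^ 4) (\<lambda>e x. c)"
  unfolding stationary_nls_def graph_deriv_def
proof
  fix e
  show "AE x in lebesgue. x \<in> {0..len e} \<longrightarrow> weak_deriv (len e) (weak_deriv (len e) (\<lambda>x. c)) x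
      + complex_of_real (cmod c ^ 4) * c - complex_of_real (cmod c ^ 4) * c = 0"
    using weak_deriv_weak_deriv_const(2)[of "len e" c] by eventually_elim simp
qed

end

theorem corollary2p7:
  fixes G :: "('v, 'e) pre_digraph" and len :: "real \<Rightarrow> 'e \<Rightarrow> real" and b :: 'e
  assumes "\<And>l. 0 < l \<Longrightarrow> compact_metric_graph G (len l)"
    and "\<And>e. \<not> terminal_edge G e"
    and "\<not> admits_cycle_covering G"
    and "bridging_edge G b"
    and "\<And>l. 0 < l \<Longrightarrow> len l b = l"
    and "\<exists>L. \<forall>l>0. \<forall>e\<in>arcs G. \<not> bridging_edge G e \<longrightarrow> len l e = L e"
    and "\<And>l e. 0 < l \<Longrightarrow> bridging_edge G e \<Longrightarrow> e \<noteq> b \<Longrightarrow> len l e \<le> l"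
    and "\<exists>B. \<forall>l>0. \<forall>e. bridging_edge G e \<and> e \<noteq> b \<longrightarrow> len l e \<le> B"
  shows "\<exists>l0>0. \<forall>l. 0 < l \<and> l < l0 \<longrightarrow>
           (\<forall>\<mu>. \<mu>R < \<mu> \<and> \<mu> < \<mu>1 G (len l) \<longrightarrow>
              (\<exists>u lam. u = (\<lambda>e x. complex_of_real (sqrt (\<mu> / total_length G (len l)))) \<and>
                     u \<in> H2K_graph G (len l) \<and>
                     stationary_nls G (len l) lam u \<and>
                     (Lp_norm 2 G (len l) u)\<^sup>2 = \<mu> \<and>
                     orbitally_stable G (len l) u))"
proof (intro exI[of _ 1] conjI allI impI)
  \<comment> \<open>The threshold \<open>1\<close> is arbitrary: the stability of the constants holds at every length.\<close>
  fix l \<mu> :: real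
  assume l: "0 < l \<and> l < 1" and \<mu>: "\<mu>R < \<mu> \<and> \<mu> < \<mu>1 G (len l)"
  interpret finite_metric_graph G "len l"
    using assms(1)[of l] l fin_digraph.finite_arcs
    by unfold_locales (auto simp: compact_metric_graph_def)
  have "b \<in> arcs G" using assms(4) by (simp add: bridging_edge_def)
  then have L: "0 < total_length G (len l)"
    unfolding total_length_def using finite_arcs len_pos by (intro sum_pos) auto
  have "0 < \<mu>R" by (simp add: \<mu>R_def)
  with \<mu> have \<mu>0: "0 < \<mu>" by linarith
  let ?\<kappa> = "sqrt (\<mu> / total_length G (len l))"
  have "cmod (complex_of_real ?\<kappa>) = ?\<kappa>" using \<mu>0 L by simp
  then have "(Lp_norm 2 G (len l) (\<lambda>e x. complex_of_real ?\<kappa>))\<^sup>2 = \<mu>"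
    unfolding nrm_const using \<mu>0 L by (simp add: power_mult_distrib)
  then show "\<exists>u lam. u = (\<lambda>e x. complex_of_real (sqrt (\<mu> / total_length G (len l)))) \<and>
                     u \<in> H2K_graph G (len l) \<and>
                     stationary_nls G (len l) lam u \<and>
                     (Lp_norm 2 G (len l) u)\<^sup>2 = \<mu> \<and>
                     orbitally_stable G (len l) u"
    using const_H2K const_stationary constant_orbitally_stable[OF L \<mu>0] \<mu> by blast
qed simp

end
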